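(* Let $p>0$, $\alpha\in[0,2)$, $\lambda>0$, $b\in\mathbb R^d$, and let $R$ be a Borel measure on $\mathbb R^d$ with $R(\{0\})=0$ such that: if $\alpha\in(0,2)$, then $\int_{\mathbb R^d}|x|^\alpha R(\mathrm dx)<\infty$; if $\alpha=0$, then $\int_{|x|\le 2}R(\mathrm dx)+\int_{|x|>2}\log|x|\,R(\mathrm dx)<\infty$; and if $\alpha=1$, moreover $\int_{|x|\le2}|x|R(\mathrm dx)+\int_{|x|>2}|x|\log|x|\,R(\mathrm dx)<\infty$. Assume in addition that $0<R(\mathbb R^d)<\infty$, and set $\gamma=1+\lfloor\alpha/p\rfloor$. Let $Y=\{Y_t:t\ge0\}$ be a TSOU-process with parameter $\lambda$ and limiting distribution $\mathrm{TS}^p_\alpha(R,b)$. Let $s\ge0$, $t>0$ and $y\in\mathbb R^d$. Then, given $Y_s=y$, the (conditional) distribution of $Y_{s+t}$ is the distribution of $$ e^{-\lambda t} y + (1-e^{-\lambda t})b - \sum_{n=0}^{\gamma-1}b_n + X_0 + e^{-\lambda t} \sum_{n=1}^{\gamma-1}X_n + \sum_{j=1}^{N} V_j W_j, $$ where $b_0,\dots,b_{\gamma-1}\in\mathbb R^d$ are constants and $N, X_0, X_1,\dots,X_{\gamma-1}, V_1, V_2, \dots, W_1, W_2, \dots$ are independent random variables with: 1. $X_0\sim \mathrm{TS}^p_\alpha(R_0,0)$ with $R_0(\mathrm dx) = (1-e^{-\alpha \lambda t})R(\mathrm dx)$; 2. if $\gamma\ge2$, then $X_n \sim \mathrm{TS}^p_{\alpha-np}(R_n,0)$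 with $R_n(\mathrm dx) = \frac{1}{n!}(1-e^{-p \lambda t})^n R(\mathrm dx)$ for $n=1,2,\dots,\gamma-1$; 3. $V_1, V_2, \dots$ are identically distributed with distribution $R^1$, where $R^1(\mathrm dx)=R(\mathrm dx)/R(\mathbb R^{d})$; 4. $W_1, W_2, \dots$ are identically distributed with distribution $\mathrm{IGa}(\alpha,\gamma,p,e^{p\lambda t})$; 5. $N$ has a Poisson distribution with mean $e^{-\alpha \lambda t}R(\mathbb R^d)K_{\alpha,\gamma,p,e^{p\lambda t}}$; 6. $b_0 = e^{-\alpha\lambda t}\, K_{(\alpha-1),\gamma,p,e^{p\lambda t}} \int_{\mathbb R^{d}} x\, R(\mathrm dx)$ if $\alpha\in[1,2)$ and $b_0=0$ if $\alpha\in[0,1)$; and, if $\gamma\ge2$, then for $n=1,2,\dots,\gamma-1$, $$ b_n = \begin{cases} e^{-\lambda t}\, p^{-1}\Gamma\left(\frac{1-\alpha+np}{p}\right)\int_{\mathbb R^{d}}x\, R_n(\mathrm dx) & \text{if } 1\le \alpha<1+ np,\\ 0 & \text{otherwise.} \end{cases} $$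
   Context: Conventions: $\sum_{n=1}^0=0$; $\lfloor x\rfloor$ is the integer part of $x\ge 0$; $|\cdot|$ and $\langle\cdot,\cdot\rangle$ are the usual norm and inner product on $\mathbb R^d$. Infinitely divisible distributions. $\mathrm{ID}(A,M,b)_h$ denotes the distribution on $\mathbb R^d$ with characteristic function $\exp\{C(z)\}$, where $C(z)=-\frac12\langle z,Az\rangle+i\langle b,z\rangle+\int_{\mathbb R^d}(e^{i\langle z,x\rangle}-1-i\langle z,x\rangle h(x))M(\mathrm dx)$. Here $A$ is a symmetric nonnegative-definite $d\times d$ matrix, $b\in\mathbb R^d$, $M$ is a Lévy measure ($M(\{0\})=0$, $\int(|x|^2\wedge1)M(\mathrm dx)<\infty$), and $h:\mathbb R^d\to\mathbb R$ is a Borel function making the integrand $M$-integrable for all $z$. Tempered stable distributions. For $p>0$, $\alpha\in[0,2)$, $b\in\mathbb R^d$ and a Borel measure $R$ on $\mathbb R^d$ with $R(\{0\})=0$ such that $\int|x|^\alpha R(\mathrm dx)<\infty$ if $\alpha\in(0,2)$, $\int_{|x|\le 2}R(\mathrm dx)+\int_{|x|>2}\log|x|R(\mathrm dx)<\infty$ if $\alpha=0$, and additionally $\int_{|x|\le2}|x|R(\mathrm dx)+\int_{|x|>2}|x|\log|x|R(\mathrm dx)<\infty$ if $\alpha=1$, the $p$-tempered $\alpha$-stable distribution $\mathrm{TS}^p_\alpha(R,b)$ is $\mathrm{ID}(0,L,b)_{h_\alpha}$, where $L(B)=\int_{\mathbb R^d}\int_0^\infty 1_B(ux)u^{-1-\alpha}e^{-u^p}\,\mathrm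 du\,R(\mathrm dx)$ for Borel $B\subseteq\mathbb R^d$, and $h_\alpha$ is the constant function equal to $0$ if $\alpha\in[0,1)$ and to $1$ if $\alpha\in[1,2)$. TSOU-processes. Let $Z=\{Z_t:t\ge0\}$ be a Lévy process on $\mathbb R^d$ and $\lambda>0$. An OU-process with parameter $\lambda$ and background driving Lévy process $Z$ is the solution $Y_t=e^{-\lambda t}Y_0+\int_0^te^{-\lambda(t-s)}\,\mathrm dZ_s$ of $\mathrm dY_t=-\lambda Y_t\,\mathrm dt+\mathrm dZ_t$, with $Y_0$ independent of $Z$; it is a Markov process. Its limiting distribution is the weak limit of the law of $Y_t$ as $t\to\infty$, when this exists. Every $\mathrm{TS}^p_\alpha(R,b)$ is selfdecomposable and hence is the limiting distribution of some OU-process with parameter $\lambda$; an OU-process with parameter $\lambda$ and limiting distribution $\mathrm{TS}^p_\alpha(R,b)$ is called a TSOU-process. Incomplete gamma distribution. For $\gamma,\zeta>0$ let $G_{\gamma,\zeta}(u)=\frac{\zeta^\gamma}{\Gamma(\gamma)}\int_0^u x^{\gamma-1}e^{-x\zeta}\,\mathrm dx$, $u>0$. For $\beta\in\mathbb R$, $\gamma>0$, $p>0$, $\eta>1$ with $p\gamma>\beta$, $\mathrm{IGa}(\beta,\gamma,p,\eta)$ is the distribution on $(0,\infty)$ with density $f_{\beta,\gamma,p,\eta}(u)=\frac{1}{K_{\beta,\gamma,p,\eta}}G_{\gamma,(\eta-1)}(u^p)e^{-u^p}u^{-1-\beta}$, $u>0$, where $K_{\beta,\gamma,p,\eta}=\int_0^\infty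 G_{\gamma,(\eta-1)}(u^p)e^{-u^p}u^{-1-\beta}\,\mathrm du$ is the normalizing constant. *)

theory Defs
  imports "HOL-Probability.Probability"
begin

definition char_vec :: "(real^'d) measure \<Rightarrow> real^'d \<Rightarrow> complex" where
  "char_vec \<mu> z = (CLINT x|\<mu>. iexp (z \<bullet> x))"

definition levy_measure :: "(real^'d) measure \<Rightarrow> bool" where
  "levy_measure M \<longleftrightarrow> sets M = sets borel \<and> emeasure M {0} = 0 \<and>
     (\<integral>\<^sup>+x. ennreal (min ((norm x)\<^sup>2) 1) \<partial>M) < \<infinity>"

definition ID_integrand :: "(real^'d \<Rightarrow> real) \<Rightarrow> real^'d \<Rightarrow> real^'d \<Rightarrow> complex" where
  "ID_integrand h z x = iexp (z \<bullet> x) - 1 - \<i> * complex_of_real (z \<bullet> x * h x)"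

definition ID_exponent ::
  "real^'d^'d \<Rightarrow> (real^'d) measure \<Rightarrow> real^'d \<Rightarrow> (real^'d \<Rightarrow> real) \<Rightarrow> real^'d \<Rightarrow> complex" where
  "ID_exponent A M b h z =
     - complex_of_real (z \<bullet> (A *v z)) / 2 + \<i> * complex_of_real (b \<bullet> z) + (CLINT x|M. ID_integrand h z x)"

text \<open>\<open>is_ID \<mu> A M b h\<close> reads \<open>\<mu> = ID(A,M,b)\<^sub>h\<close>. It is a predicate, so that no distribution with
  the given characteristic function is presupposed to exist.\<close>

definition is_ID ::
  "(real^'d) measure \<Rightarrow> real^'d^'d \<Rightarrow> (real^'d) measure \<Rightarrow> real^'d \<Rightarrow> (real^'d \<Rightarrow> real) \<Rightarrow> bool" where
  "is_ID \<mu> A M b h \<longleftrightarrow>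
     transpose A = A \<and> (\<forall>z. 0 \<le> z \<bullet> (A *v z)) \<and> levy_measure M \<and>
     h \<in> borel_measurable borel \<and> (\<forall>z. complex_integrable M (ID_integrand h z)) \<and>
     prob_space \<mu> \<and> sets \<mu> = sets borel \<and> (\<forall>z. char_vec \<mu> z = exp (ID_exponent A M b h z))"

definition TS_admissible :: "real \<Rightarrow> (real^'d) measure \<Rightarrow> bool" where
  "TS_admissible \<alpha> R \<longleftrightarrow> sets R = sets borel \<and> emeasure R {0} = 0 \<and>
     (0 < \<alpha> \<and> \<alpha> < 2 \<longrightarrow> (\<integral>\<^sup>+x. ennreal (norm x powr \<alpha>) \<partial>R) < \<infinity>) \<and>
     (\<alpha> = 0 \<longrightarrow>
        emeasure R {x. norm x \<le> 2} + (\<integral>\<^sup>+x\<in>{x. norm x > 2}. ennreal (ln (norm x)) \<partial>R) < \<infinity>) \<and>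
     (\<alpha> = 1 \<longrightarrow>
        (\<integral>\<^sup>+x\<in>{x. norm x \<le> 2}. ennreal (norm x) \<partial>R) +
        (\<integral>\<^sup>+x\<in>{x. norm x > 2}. ennreal (norm x * ln (norm x)) \<partial>R) < \<infinity>)"

definition TS_levy :: "real \<Rightarrow> real \<Rightarrow> (real^'d) measure \<Rightarrow> (real^'d) measure" where
  "TS_levy p \<alpha> R = measure_of UNIV (sets borel)
     (\<lambda>B. \<integral>\<^sup>+x. (\<integral>\<^sup>+u\<in>{0<..}. indicator B (u *\<^sub>R x) *
              ennreal (u powr (-1 - \<alpha>) * exp (- (u powr p))) \<partial>lborel) \<partial>R)"

definition TS_h :: "real \<Rightarrow> real^'d \<Rightarrow> real" where
  "TS_h \<alpha> = (\<lambda>_. if \<alpha> < 1 then 0 else 1)"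

definition is_TS :: "(real^'d) measure \<Rightarrow> real \<Rightarrow> real \<Rightarrow> (real^'d) measure \<Rightarrow> real^'d \<Rightarrow> bool" where
  "is_TS \<mu> p \<alpha> R b \<longleftrightarrow> 0 < p \<and> 0 \<le> \<alpha> \<and> \<alpha> < 2 \<and> TS_admissible \<alpha> R \<and>
     is_ID \<mu> 0 (TS_levy p \<alpha> R) b (TS_h \<alpha>)"

text \<open>Processes indexed by \<open>t \<ge> 0\<close> are functions on \<open>real\<close> whose values at negative times are
  ignored.\<close>

definition levy_process :: "'w measure \<Rightarrow> (real \<Rightarrow> 'w \<Rightarrow> real^'d) \<Rightarrow> bool" where
  "levy_process M Z \<longleftrightarrow> prob_space M \<and>
     (\<forall>t\<ge>0. Z t \<in> borel_measurable M) \<and>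
     (AE \<omega> in M. Z 0 \<omega> = 0) \<and>
     (\<forall>(\<tau> :: nat \<Rightarrow> real) n. 0 \<le> \<tau> 0 \<and> (\<forall>i<n. \<tau> i < \<tau> (Suc i)) \<longrightarrow>
        prob_space.indep_vars M (\<lambda>_. borel) (\<lambda>i \<omega>. Z (\<tau> (Suc i)) \<omega> - Z (\<tau> i) \<omega>) {..<n}) \<and>
     (\<forall>s\<ge>0. \<forall>t\<ge>0. distr M borel (\<lambda>\<omega>. Z (s + t) \<omega> - Z s \<omega>) = distr M borel (Z t)) \<and>
     (\<forall>t\<ge>0. \<forall>\<epsilon>>0. ((\<lambda>s. measure M {\<omega> \<in> space M. norm (Z s \<omega> - Z t \<omega>) > \<epsilon>}) \<longlongrightarrow> 0)
        (at t within {0..})) \<and>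
     (AE \<omega> in M. (\<forall>t\<ge>0. continuous (at_right t) (\<lambda>u. Z u \<omega>)) \<and>
        (\<forall>t>0. \<exists>l. ((\<lambda>u. Z u \<omega>) \<longlongrightarrow> l) (at_left t)))"

text \<open>\<open>I\<close> is a version of \<open>\<integral>\<^sub>a\<^sup>b f(u) dZ\<^sub>u\<close> for a deterministic continuous \<open>f\<close>: the limit in
  probability of the left-point Riemann sums as the mesh of the partition tends to \<open>0\<close>.\<close>

definition has_stoch_integral ::
  "'w measure \<Rightarrow> (real \<Rightarrow> 'w \<Rightarrow> real^'d) \<Rightarrow> (real \<Rightarrow> real) \<Rightarrow> real \<Rightarrow> real \<Rightarrow> ('w \<Rightarrow> real^'d) \<Rightarrow> bool" where
  "has_stoch_integral M Z f a b I \<longleftrightarrow> I \<in> borel_measurable M \<and>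
     (\<forall>\<epsilon>>0. \<forall>\<eta>>0. \<exists>\<delta>>0. \<forall>(\<tau> :: nat \<Rightarrow> real) n.
        \<tau> 0 = a \<and> \<tau> n = b \<and> (\<forall>i<n. \<tau> i \<le> \<tau> (Suc i) \<and> \<tau> (Suc i) - \<tau> i < \<delta>) \<longrightarrow>
        measure M {\<omega> \<in> space M.
          norm ((\<Sum>i<n. f (\<tau> i) *\<^sub>R (Z (\<tau> (Suc i)) \<omega> - Z (\<tau> i) \<omega>)) - I \<omega>) > \<epsilon>} < \<eta>)"

text \<open>The events generated by a random variable. Independence below is stated through them because
  \<open>indep_vars\<close> requires all variables to have the same value type.\<close>

definition events_of :: "'w measure \<Rightarrow> 'b measure \<Rightarrow> ('w \<Rightarrow> 'b) \<Rightarrow> 'w set set" where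
  "events_of M S X = {X -` A \<inter> space M | A. A \<in> sets S}"

definition OU_process ::
  "'w measure \<Rightarrow> real \<Rightarrow> (real \<Rightarrow> 'w \<Rightarrow> real^'d) \<Rightarrow> (real \<Rightarrow> 'w \<Rightarrow> real^'d) \<Rightarrow> bool" where
  "OU_process M lam Z Y \<longleftrightarrow> 0 < lam \<and> levy_process M Z \<and>
     (\<forall>t\<ge>0. Y t \<in> borel_measurable M) \<and>
     prob_space.indep_set M (events_of M borel (Y 0))
       (sigma_sets (space M) (\<Union>t\<in>{0..}. events_of M borel (Z t))) \<and>
     (\<forall>t\<ge>0. \<exists>I. has_stoch_integral M Z (\<lambda>u. exp (- lam * (t - u))) 0 t I \<and>
        (AE \<omega> in M. Y t \<omega> = exp (- lam * t) *\<^sub>R Y 0 \<omega> + I \<omega>))"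

definition limiting_distribution :: "'w measure \<Rightarrow> (real \<Rightarrow> 'w \<Rightarrow> real^'d) \<Rightarrow> (real^'d) measure \<Rightarrow> bool" where
  "limiting_distribution M Y \<mu> \<longleftrightarrow> prob_space \<mu> \<and> sets \<mu> = sets borel \<and>
     (\<forall>f :: real^'d \<Rightarrow> real. continuous_on UNIV f \<and> bounded (range f) \<longrightarrow>
        ((\<lambda>t. \<integral>x. f x \<partial>(distr M borel (Y t))) \<longlongrightarrow> (\<integral>x. f x \<partial>\<mu>)) at_top)"

definition TSOU_process ::
  "'w measure \<Rightarrow> real \<Rightarrow> real \<Rightarrow> real \<Rightarrow> (real^'d) measure \<Rightarrow> real^'d \<Rightarrow> (real \<Rightarrow> 'w \<Rightarrow> real^'d) \<Rightarrow> bool" where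
  "TSOU_process M lam p \<alpha> R b Y \<longleftrightarrow>
     (\<exists>Z. OU_process M lam Z Y) \<and> (\<exists>\<mu>. is_TS \<mu> p \<alpha> R b \<and> limiting_distribution M Y \<mu>)"

text \<open>\<open>\<kappa> y\<close> is the conditional distribution of \<open>X\<close> given \<open>T = y\<close>: \<open>\<kappa>\<close> is a regular conditional
  distribution of \<open>X\<close> given \<open>T\<close>.\<close>

definition conditional_distribution ::
  "'w measure \<Rightarrow> ('w \<Rightarrow> real^'d) \<Rightarrow> ('w \<Rightarrow> real^'d) \<Rightarrow> (real^'d \<Rightarrow> (real^'d) measure) \<Rightarrow> bool" where
  "conditional_distribution M X T \<kappa> \<longleftrightarrow> \<kappa> \<in> measurable borel (prob_algebra borel) \<and>
     (\<forall>A\<in>sets borel. \<forall>B\<in>sets borel.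
        emeasure M {\<omega> \<in> space M. T \<omega> \<in> A \<and> X \<omega> \<in> B} =
        (\<integral>\<^sup>+y\<in>A. emeasure (\<kappa> y) B \<partial>(distr M borel T)))"

definition gamma_cdf :: "real \<Rightarrow> real \<Rightarrow> real \<Rightarrow> real" where
  "gamma_cdf \<gamma> \<zeta> u = \<zeta> powr \<gamma> / Gamma \<gamma> * (LBINT x:{0<..<u}. x powr (\<gamma> - 1) * exp (- x * \<zeta>))"

definition IGa_weight :: "real \<Rightarrow> real \<Rightarrow> real \<Rightarrow> real \<Rightarrow> real \<Rightarrow> real" where
  "IGa_weight \<beta> \<gamma> p \<eta> u = gamma_cdf \<gamma> (\<eta> - 1) (u powr p) * exp (- (u powr p)) * u powr (-1 - \<beta>)"

definition IGa_K :: "real \<Rightarrow> real \<Rightarrow> real \<Rightarrow> real \<Rightarrow> real" where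
  "IGa_K \<beta> \<gamma> p \<eta> = (LBINT u:{0<..}. IGa_weight \<beta> \<gamma> p \<eta> u)"

definition IGa :: "real \<Rightarrow> real \<Rightarrow> real \<Rightarrow> real \<Rightarrow> real measure" where
  "IGa \<beta> \<gamma> p \<eta> = density lborel
     (\<lambda>u. ennreal (indicator {0<..} u * (IGa_weight \<beta> \<gamma> p \<eta> u / IGa_K \<beta> \<gamma> p \<eta>)))"

definition TSOU_R :: "real \<Rightarrow> real \<Rightarrow> real \<Rightarrow> real \<Rightarrow> (real^'d) measure \<Rightarrow> nat \<Rightarrow> (real^'d) measure" where
  "TSOU_R p \<alpha> lam t R n =
     scale_measure (ennreal (if n = 0 then 1 - exp (- \<alpha> * lam * t)
                             else (1 - exp (- p * lam * t)) ^ n / fact n)) R"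

definition TSOU_b :: "real \<Rightarrow> real \<Rightarrow> real \<Rightarrow> real \<Rightarrow> (real^'d) measure \<Rightarrow> nat \<Rightarrow> nat \<Rightarrow> real^'d" where
  "TSOU_b p \<alpha> lam t R g n =
     (if n = 0 then
        (if 1 \<le> \<alpha> then (exp (- \<alpha> * lam * t) * IGa_K (\<alpha> - 1) (real g) p (exp (p * lam * t))) *\<^sub>R (\<integral>x. x \<partial>R)
         else 0)
      else
        (if 1 \<le> \<alpha> \<and> \<alpha> < 1 + real n * p
         then (exp (- lam * t) * (1 / p) * Gamma ((1 - \<alpha> + real n * p) / p)) *\<^sub>R
                (\<integral>x. x \<partial>(TSOU_R p \<alpha> lam t R n))
         else 0))"

datatype rv_index = Ix_N | Ix_X nat | Ix_V nat | Ix_W nat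

definition TSOU_variables ::
  "real \<Rightarrow> real \<Rightarrow> real \<Rightarrow> real \<Rightarrow> (real^'d) measure \<Rightarrow> nat \<Rightarrow> 'q measure \<Rightarrow> ('q \<Rightarrow> nat) \<Rightarrow>
   (nat \<Rightarrow> 'q \<Rightarrow> real^'d) \<Rightarrow> (nat \<Rightarrow> 'q \<Rightarrow> real^'d) \<Rightarrow> (nat \<Rightarrow> 'q \<Rightarrow> real) \<Rightarrow> bool" where
  "TSOU_variables p \<alpha> lam t R g Q N X V W \<longleftrightarrow> prob_space Q \<and>
     N \<in> measurable Q (count_space UNIV) \<and>
     (\<forall>n<g. X n \<in> borel_measurable Q) \<and>
     (\<forall>j\<ge>1. V j \<in> borel_measurable Q \<and> W j \<in> borel_measurable Q) \<and>
     prob_space.indep_sets Q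
       (\<lambda>i. case i of
              Ix_N \<Rightarrow> events_of Q (count_space UNIV) N
            | Ix_X n \<Rightarrow> events_of Q borel (X n)
            | Ix_V j \<Rightarrow> events_of Q borel (V j)
            | Ix_W j \<Rightarrow> events_of Q borel (W j))
       ({Ix_N} \<union> Ix_X ` {..<g} \<union> Ix_V ` {1..} \<union> Ix_W ` {1..}) \<and>
     is_TS (distr Q borel (X 0)) p \<alpha> (TSOU_R p \<alpha> lam t R 0) 0 \<and>
     (\<forall>n\<in>{1..<g}. is_TS (distr Q borel (X n)) p (\<alpha> - real n * p) (TSOU_R p \<alpha> lam t R n) 0) \<and>
     (\<forall>j\<ge>1. distr Q borel (V j) = scale_measure (1 / emeasure R UNIV) R) \<and>
     (\<forall>j\<ge>1. distr Q borel (W j) = IGa \<alpha> (real g) p (exp (p * lam * t))) \<and>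
     distr Q (count_space UNIV) N =
       measure_pmf (poisson_pmf
         (exp (- \<alpha> * lam * t) * measure R UNIV * IGa_K \<alpha> (real g) p (exp (p * lam * t))))"

definition TSOU_transition ::
  "real \<Rightarrow> real \<Rightarrow> real \<Rightarrow> real \<Rightarrow> (real^'d) measure \<Rightarrow> real^'d \<Rightarrow> nat \<Rightarrow> ('q \<Rightarrow> nat) \<Rightarrow>
   (nat \<Rightarrow> 'q \<Rightarrow> real^'d) \<Rightarrow> (nat \<Rightarrow> 'q \<Rightarrow> real^'d) \<Rightarrow> (nat \<Rightarrow> 'q \<Rightarrow> real) \<Rightarrow> real^'d \<Rightarrow> 'q \<Rightarrow> real^'d" where
  "TSOU_transition p \<alpha> lam t R b g N X V W y \<omega> =
     exp (- lam * t) *\<^sub>R y + (1 - exp (- lam * t)) *\<^sub>R b - (\<Sum>n<g. TSOU_b p \<alpha> lam t R g n)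
     + X 0 \<omega> + exp (- lam * t) *\<^sub>R (\<Sum>n\<in>{1..<g}. X n \<omega>) + (\<Sum>j\<in>{1..N \<omega>}. W j \<omega> *\<^sub>R V j \<omega>)"

end

theory Submission
  imports Defs
begin

text \<open>Put \<open>a = exp (- lam t)\<close>. The increment \<open>U = Y\<^bsub>s+t\<^esub> - a Y\<^sub>s\<close> is independent of \<open>Y\<^sub>s\<close> and its law does
  not depend on \<open>s\<close>. Letting \<open>s\<close> tend to infinity, its characteristic function is
  \<open>\<phi>(z) / \<phi>(a z)\<close>, where \<open>\<phi>\<close> belongs to the limiting distribution. After substituting \<open>u / a\<close> for \<open>u\<close>
  in the exponent of \<open>\<phi>(a z)\<close>, the quotient corresponds to the radial density
  \<open>u\<^bsup>-1-\<alpha>\<^esup> (e\<^bsup>-v\<^esup> - a\<^bsup>\<alpha>\<^esup> e\<^bsup>-\<eta>v\<^esup>)\<close> with \<open>v = u\<^bsup>p\<^esup>\<close> and \<open>\<eta> = a\<^bsup>-p\<^esup>\<close>. Since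
  the gamma distribution function of integer shape is \<open>G(v) = 1 - e\<^bsup>-(\<eta>-1)v\<^esup> \<Sum>\<^bsub>n<\<gamma>\<^esub> ((\<eta>-1)v)\<^bsup>n\<^esup> / n!\<close>,
  the bracket equals
  \<open>(1 - a\<^bsup>\<alpha>\<^esup>) e\<^bsup>-v\<^esup> + a\<^bsup>\<alpha>\<^esup> \<Sum>\<^bsub>1\<le>n<\<gamma>\<^esub> ((\<eta>-1)v)\<^bsup>n\<^esup> / n! e\<^bsup>-\<eta>v\<^esup> + a\<^bsup>\<alpha>\<^esup> G(v) e\<^bsup>-v\<^esup>\<close>,
  and the three parts are the exponents of \<open>X\<^sub>0\<close>, of \<open>a X\<^sub>n\<close> (after rescaling \<open>u\<close>) and of the compound
  Poisson sum; the vectors \<open>b\<^sub>n\<close> account for the different centerings.\<close>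

section \<open>Uniqueness of characteristic functions in Euclidean spaces\<close>

text \<open>The value of \<gamma> balances two demands. The jump density is integrable at 0 only if
  \<open>\<alpha> < p * \<gamma>\<close>, since G(v) is of order v^\<gamma> there; the indices
  \<alpha> - n p with n < \<gamma> are all nonnegative only if
  \<open>(\<gamma> - 1) * p \<le> \<alpha>\<close>. Exactly one integer satisfies both. Exponents
  are compared along one direction x at a time and under the single centering that belongs to
  \<alpha>: the kernel depends on z and x through z \<bullet> x only, and R is integrated over last.
  The theorem also claims that suitable variables exist, and the Levy measures of the X_n are
  infinite in general, so their laws have to be constructed. They are limits of sums of independent
  compensated compound Poisson variables. Almost sure convergence must be read off from the
  characteristic functions of the summands, which a Gaussian average over frequencies
  achieves.\<close>

text \<open>Levy's uniqueness theorem on the line, applied to the law of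
  \<open>x \<bullet> i\<close> under the normalised density \<open>\<rho> / c\<close>. The range
  [1, 3] is that of 2 + q with |q| \<le> 1: a signed weight q becomes positive after adding 2, and
  the total weight stays away from 0.\<close>

lemma weighted_coordinate_eq:
  fixes \<mu> \<nu> :: "'a::euclidean_space measure"
  assumes "prob_space \<mu>" "prob_space \<nu>" and [measurable_cong]: "sets \<mu> = sets borel" "sets \<nu> = sets borel"
    and [measurable]: "\<rho> \<in> borel_measurable borel" and \<rho>: "\<And>x. 1 \<le> \<rho> x" "\<And>x. \<rho> x \<le> (3::real)"
    and eq: "\<And>s. (CLINT x|\<mu>. iexp (s * (x \<bullet> i)) * \<rho> x) = (CLINT x|\<nu>. iexp (s * (x \<bullet> i)) * \<rho> x)"
    and [measurable]: "B \<in> sets borel"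
  shows "(\<integral>x. indicator B (x \<bullet> i) * \<rho> x \<partial>\<mu>) = (\<integral>x. indicator B (x \<bullet> i) * \<rho> x \<partial>\<nu>)"
proof -
  interpret \<mu>: prob_space \<mu> by fact
  interpret \<nu>: prob_space \<nu> by fact
  have \<rho>0: "0 \<le> \<rho> x" for x using \<rho>(1)[of x] by linarith
  define c where "c = (\<integral>x. \<rho> x \<partial>\<mu>)"
  \<comment> \<open>At frequency 0 the hypothesis equates the total weights, so both laws are
    divided by the same \<open>c\<close>.\<close>
  have c\<nu>: "c = (\<integral>x. \<rho> x \<partial>\<nu>)" using eq[of 0] by (simp add: c_def)
  have int: "integrable \<mu> \<rho>" "integrable \<nu> \<rho>"
    by (auto intro!: \<mu>.integrable_const_bound[where B=3] \<nu>.integrable_const_bound[where B=3] simp: \<rho> \<rho>0)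
  have c1: "1 \<le> c" using integral_mono[OF _ int(1), of "\<lambda>_. 1"] \<rho> by (simp add: c_def \<mu>.prob_space)
  define D where "D m = distr (density m (\<lambda>x. ennreal (\<rho> x / c))) borel (\<lambda>x. x \<bullet> i)" for m :: "'a measure"
  have D: "real_distribution (D m) \<and> char (D m) = (\<lambda>s. (CLINT x|m. iexp (s * (x \<bullet> i)) * \<rho> x) / c)
     \<and> measure (D m) B = (\<integral>x. indicator B (x \<bullet> i) * \<rho> x \<partial>m) / c"
    if m: "prob_space m" and [measurable_cong]: "sets m = sets borel" and cm: "c = (\<integral>x. \<rho> x \<partial>m)" and im: "integrable m \<rho>" for m
  proof -
    interpret m: prob_space m by fact
    have e: "emeasure (density m (\<lambda>x. ennreal (\<rho> x / c))) (space m) = 1"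
      using c1 \<rho>0 im cm
      by (subst emeasure_density) (auto simp: nn_integral_eq_integral cong: nn_integral_cong)
    have pd: "prob_space (density m (\<lambda>x. ennreal (\<rho> x / c)))"
      by (rule prob_spaceI) (use e in simp)
    interpret pd: prob_space "density m (\<lambda>x. ennreal (\<rho> x / c))" by fact
    have 1: "real_distribution (D m)"
      unfolding D_def by (rule pd.real_distribution_distr) simp
    interpret DD: real_distribution "D m" by fact
    have 2: "char (D m) s = (CLINT x|m. iexp (s * (x \<bullet> i)) * \<rho> x) / c" for s
      unfolding char_def D_def
      apply (subst integral_distr, simp, simp)
      apply (subst integral_density, simp, simp)
      using c1 \<rho>0
      by (auto simp: scaleR_conv_of_real mult.commute simp flip: integral_divide_zero intro!: Bochner_Integration.integral_cong)
    have "measure (D m) B = (\<integral>x. indicator B x \<partial>D m)" by (simp add: D_def)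
    also have "\<dots> = (\<integral>x. indicator B (x \<bullet> i) * \<rho> x \<partial>m) / c"
      unfolding D_def
      apply (subst integral_distr, simp, simp)
      apply (subst integral_density, simp, simp)
      using c1 \<rho>0
      by (auto simp: mult.commute simp flip: integral_divide_zero intro!: Bochner_Integration.integral_cong)
    finally show ?thesis using 1 2 by auto
  qed
  have D1: "real_distribution (D \<mu>)" "char (D \<mu>) = (\<lambda>s. (CLINT x|\<mu>. iexp (s * (x \<bullet> i)) * \<rho> x) / c)"
     "measure (D \<mu>) B = (\<integral>x. indicator B (x \<bullet> i) * \<rho> x \<partial>\<mu>) / c"
    using D[of \<mu>] assms int c_def by auto
  have D2: "real_distribution (D \<nu>)" "char (D \<nu>) = (\<lambda>s. (CLINT x|\<nu>. iexp (s * (x \<bullet> i)) * \<rho> x) / c)"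
     "measure (D \<nu>) B = (\<integral>x. indicator B (x \<bullet> i) * \<rho> x \<partial>\<nu>) / c"
    using D[of \<nu>] assms int c\<nu> by auto
  have "D \<mu> = D \<nu>" using D1 D2 eq by (intro Levy_uniqueness) auto
  then show ?thesis using D1(3) D2(3) c1 by auto
qed

text \<open>Coordinate indicators are inserted one basis vector at a time. The frequency
  \<open>z\<close> is kept and stays arbitrary in the induction, because testing the new coordinate
  with frequency s shifts \<open>z\<close> along its basis vector.\<close>

lemma char_eq_boxes:
  fixes \<mu> \<nu> :: "'a::euclidean_space measure"
  assumes p: "prob_space \<mu>" "prob_space \<nu>" and s[measurable_cong]: "sets \<mu> = sets borel" "sets \<nu> = sets borel"
    and eq: "\<And>z. (CLINT x|\<mu>. iexp (z \<bullet> x)) = (CLINT x|\<nu>. iexp (z \<bullet> x))"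
    and S: "finite S"
  shows "(\<And>i. B i \<in> sets borel) \<Longrightarrow>
    (CLINT x|\<mu>. iexp (z \<bullet> x) * (\<Prod>i\<in>S. indicator (B i) (x \<bullet> i))) = (CLINT x|\<nu>. iexp (z \<bullet> x) * (\<Prod>i\<in>S. indicator (B i) (x \<bullet> i)))"
  using S
proof (induction S arbitrary: z)
  case empty then show ?case using eq by simp
next
  case (insert i S)
  interpret \<mu>: prob_space \<mu> by fact
  interpret \<nu>: prob_space \<nu> by fact
  note [measurable] = insert.prems
  define P :: "'a \<Rightarrow> real" where "P = (\<lambda>x. \<Prod>i\<in>S. indicator (B i) (x \<bullet> i))"
  have [measurable]: "P \<in> borel_measurable borel" unfolding P_def by measurable
  have P01: "0 \<le> P x" "P x \<le> 1" for x unfolding P_def by (auto intro!: prod_nonneg prod_le_1 simp: indicator_def)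
  have IH: "(CLINT x|\<mu>. iexp (z \<bullet> x) * P x) = (CLINT x|\<nu>. iexp (z \<bullet> x) * P x)" for z
    using insert by (simp add: P_def of_real_indicator)
  have int: "complex_integrable m (\<lambda>x. iexp (z \<bullet> x) * P x)" "complex_integrable m (\<lambda>x. iexp (z \<bullet> x))"
      "integrable m (\<lambda>x. cos (z \<bullet> x) * P x)" "integrable m (\<lambda>x. sin (z \<bullet> x) * P x)"
      "integrable m (\<lambda>x. indicator (B i) (x \<bullet> i) * (cos (z \<bullet> x) * P x))" "integrable m (\<lambda>x. indicator (B i) (x \<bullet> i) * (sin (z \<bullet> x) * P x))"
      "integrable m (\<lambda>x. indicator (B i) (x \<bullet> i) * 2 :: real)"
    if "prob_space m" and [measurable_cong]: "sets m = sets borel" for m z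
  proof -
    interpret m: prob_space m by fact
    have *: "P x \<le> 2" for x using P01[of x] by simp
    have **: "\<bar>cos (z \<bullet> x)\<bar> * P x \<le> 2" "\<bar>sin (z \<bullet> x)\<bar> * P x \<le> 2" for x
      using P01[of x] mult_le_one[of "\<bar>cos (z \<bullet> x)\<bar>" "P x"] mult_le_one[of "\<bar>sin (z \<bullet> x)\<bar>" "P x"] by auto
    show "complex_integrable m (\<lambda>x. iexp (z \<bullet> x) * P x)" "complex_integrable m (\<lambda>x. iexp (z \<bullet> x))"
      "integrable m (\<lambda>x. cos (z \<bullet> x) * P x)" "integrable m (\<lambda>x. sin (z \<bullet> x) * P x)"
      "integrable m (\<lambda>x. indicator (B i) (x \<bullet> i) * (cos (z \<bullet> x) * P x))" "integrable m (\<lambda>x. indicator (B i) (x \<bullet> i) * (sin (z \<bullet> x) * P x))"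
      "integrable m (\<lambda>x. indicator (B i) (x \<bullet> i) * 2 :: real)"
      by (auto intro!: m.integrable_const_bound[where B=2] simp: norm_mult P01 abs_mult indicator_def * **)
  qed
  note i\<mu> = int[OF p(1) s(1)] and i\<nu> = int[OF p(2) s(2)]
  \<comment> \<open>Real and imaginary part of \<open>iexp (z \<bullet> x) * P x\<close>: the
    weights of the one-dimensional lemma have to be real.\<close>
  define q where "q = (\<lambda>b x. if b then cos (z \<bullet> x) * P x else sin (z \<bullet> x) * P x)"
  have [measurable]: "q b \<in> borel_measurable borel" for b unfolding q_def by (cases b) simp_all
  have qb: "\<bar>q b x\<bar> \<le> 1" for b x
    using P01[of x] by (auto simp: q_def abs_mult intro!: mult_le_one)
  have qeq: "(CLINT x|\<mu>. iexp (s * (x \<bullet> i)) * q b x) = (CLINT x|\<nu>. iexp (s * (x \<bullet> i)) * q b x)" for s b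
  proof -
    let ?u = "z + s *\<^sub>R i" and ?v = "- z + s *\<^sub>R i"
    have cs: "complex_of_real (cos y) = (iexp y + iexp (-y)) / 2" "complex_of_real (sin y) = (iexp y - iexp (-y)) / (2*\<i>)" for y
      by (auto simp: cos_exp_eq sin_exp_eq simp flip: cos_of_real sin_of_real)
    \<comment> \<open>By Euler's formulas the product is a combination of the frequencies
      \<open>?u\<close> and \<open>?v\<close>, and the induction hypothesis applies at both.\<close>
    have "iexp (s * (x \<bullet> i)) * q b x = (if b then (iexp (?u \<bullet> x) * P x + iexp (?v \<bullet> x) * P x) / 2
            else (iexp (?u \<bullet> x) * P x - iexp (?v \<bullet> x) * P x) / (2*\<i>))" for x
    proof -
      have u: "iexp (?u \<bullet> x) = iexp (s * (x \<bullet> i)) * iexp (z \<bullet> x)"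
        by (simp add: inner_left_distrib inner_commute algebra_simps flip: exp_add)
      have v: "iexp (?v \<bullet> x) = iexp (s * (x \<bullet> i)) * iexp (- (z \<bullet> x))"
        by (simp add: inner_left_distrib inner_commute algebra_simps flip: exp_add)
      show ?thesis unfolding u v q_def by (cases b) (simp_all only: cs of_real_mult if_True if_False, simp_all add: field_simps)
    qed
    note h = this
    show ?thesis
      unfolding h by (cases b)
        (simp_all only: if_True if_False integral_divide_zero i\<mu>(1) i\<nu>(1) IH Bochner_Integration.integral_add Bochner_Integration.integral_diff)
  qed
  have "(CLINT x|\<mu>. iexp (s * (x \<bullet> i)) * complex_of_real (2 + q b x)) = (CLINT x|\<nu>. iexp (s * (x \<bullet> i)) * complex_of_real (2 + q b x))" for s b
  proof -
    have "(CLINT x|m. iexp (s * (x \<bullet> i)) * complex_of_real (2 + q b x)) = 2 * (CLINT x|m. iexp ((s *\<^sub>R i) \<bullet> x)) + (CLINT x|m. iexp (s * (x \<bullet> i)) * q b x)"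
      if m: "prob_space m" and [measurable_cong]: "sets m = sets borel" for m
    proof -
      interpret m: prob_space m by fact
      have "complex_integrable m (\<lambda>x. iexp (s * (x \<bullet> i)) * q b x)"
        by (rule m.integrable_const_bound[where B=1]) (auto simp: norm_mult qb)
      then show ?thesis using int(2)[OF that, of "s *\<^sub>R i"]
        by (simp add: algebra_simps inner_commute)
    qed
    from this[OF p(1) s(1)] this[OF p(2) s(2)] show ?thesis by (simp only: qeq eq)
  qed
  moreover have "(CLINT x|\<mu>. iexp (s * (x \<bullet> i)) * complex_of_real 2) = (CLINT x|\<nu>. iexp (s * (x \<bullet> i)) * complex_of_real 2)" for s
    using eq[of "s *\<^sub>R i"] by (simp add: inner_commute)
  moreover have "1 \<le> 2 + q b x" "2 + q b x \<le> 3" for b x using qb[of b x] by auto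
  \<comment> \<open>The one-dimensional lemma is applied to the weight \<open>2 + q b\<close> and to
    the constant weight 2; their difference is the signed weight.\<close>
  ultimately have A: "(\<integral>x. indicator (B i) (x \<bullet> i) * (2 + q b x) \<partial>\<mu>) = (\<integral>x. indicator (B i) (x \<bullet> i) * (2 + q b x) \<partial>\<nu>)"
    "(\<integral>x. indicator (B i) (x \<bullet> i) * (2::real) \<partial>\<mu>) = (\<integral>x. indicator (B i) (x \<bullet> i) * 2 \<partial>\<nu>)" for b
    by (intro weighted_coordinate_eq p s; simp)+
  have "(\<integral>x. indicator (B i) (x \<bullet> i) * q b x \<partial>\<mu>) = (\<integral>x. indicator (B i) (x \<bullet> i) * q b x \<partial>\<nu>)" for b
  proof -
    have "integrable \<mu> (\<lambda>x. indicator (B i) (x \<bullet> i) * q b x)" "integrable \<nu> (\<lambda>x. indicator (B i) (x \<bullet> i) * q b x)"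
      using i\<mu>(5,6) i\<nu>(5,6) by (cases b; simp add: q_def)+
    then show ?thesis
      using A(1)[of b] A(2) i\<mu>(7) i\<nu>(7) by (simp add: distrib_left del: integral_mult_left_zero integral_mult_left)
  qed
  note B = this[of True] this[of False]
  have "(CLINT x|m. iexp (z \<bullet> x) * (\<Prod>i\<in>insert i S. indicator (B i) (x \<bullet> i))) =
     complex_of_real (\<integral>x. indicator (B i) (x \<bullet> i) * (cos (z \<bullet> x) * P x) \<partial>m) + \<i> * complex_of_real (\<integral>x. indicator (B i) (x \<bullet> i) * (sin (z \<bullet> x) * P x) \<partial>m)"
    if m: "prob_space m" and [measurable_cong]: "sets m = sets borel" for m
  proof -
    have PC: "(\<Prod>i\<in>S. indicator (B i) (x \<bullet> i)) = complex_of_real (P x)" for x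
      by (simp add: P_def of_real_indicator)
    have "iexp (z \<bullet> x) * (\<Prod>i\<in>insert i S. indicator (B i) (x \<bullet> i)) =
      complex_of_real (indicator (B i) (x \<bullet> i) * (cos (z \<bullet> x) * P x)) + \<i> * complex_of_real (indicator (B i) (x \<bullet> i) * (sin (z \<bullet> x) * P x))" for x
      unfolding prod.insert[OF insert.hyps]
      by (subst PC) (auto simp: cis_conv_exp[symmetric] complex_eq_iff indicator_def split: if_splits)
    then show ?thesis using int[OF that]
      by (simp del: of_real_mult)
  qed
  then show ?case using B p s by (simp add: q_def)
qed

text \<open>At frequency 0, with all basis vectors used, \<open>char_eq_boxes\<close> compares the
  masses of open boxes, an intersection-stable generator of the Borel sets.\<close>

theorem char_unique:
  fixes \<mu> \<nu> :: "'a::euclidean_space measure"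
  assumes p: "prob_space \<mu>" "prob_space \<nu>" and s[measurable_cong]: "sets \<mu> = sets borel" "sets \<nu> = sets borel"
    and eq: "\<And>z. (CLINT x|\<mu>. iexp (z \<bullet> x)) = (CLINT x|\<nu>. iexp (z \<bullet> x))"
  shows "\<mu> = \<nu>"
proof (rule measure_eqI_generator_eq)
  interpret \<mu>: prob_space \<mu> by fact
  interpret \<nu>: prob_space \<nu> by fact
  let ?E = "range (\<lambda>(a, b). box a b::'a set)"
  show "Int_stable ?E"
    by (auto simp: Int_stable_def box_Int_box)
  show "?E \<subseteq> Pow UNIV" "sets \<mu> = sigma_sets UNIV ?E" "sets \<nu> = sigma_sets UNIV ?E"
    by (simp_all add: borel_eq_box s)
  let ?A = "\<lambda>n::nat. box (- (real n *\<^sub>R One)) (real n *\<^sub>R One) :: 'a set"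
  show "range ?A \<subseteq> ?E" "(\<Union>i. ?A i) = UNIV"
    unfolding UN_box_eq_UNIV by auto
  show "emeasure \<mu> (?A i) \<noteq> \<infinity>" for i by simp
  fix X assume "X \<in> ?E"
  then obtain a b where X: "X = box a b" by auto
  define B where "B i = {a \<bullet> i <..< b \<bullet> i}" for i
  have *: "indicator X x = (\<Prod>i\<in>Basis. indicator (B i) (x \<bullet> i) :: real)" for x
    by (auto simp: X box_def B_def indicator_def prod_zero_iff split: if_splits)
  have "measure m X = Re (CLINT x|m. iexp (0 \<bullet> x) * (\<Prod>i\<in>Basis. indicator (B i) (x \<bullet> i)))"
    if m: "prob_space m" and [measurable_cong]: "sets m = sets borel" for m
  proof -
    interpret m: prob_space m by fact
    have [measurable]: "X \<in> sets m" using that X by simp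
    have "(CLINT x|m. iexp (0 \<bullet> x) * (\<Prod>i\<in>Basis. indicator (B i) (x \<bullet> i))) = complex_of_real (\<integral>x. indicator X x \<partial>m)"
      by (subst integral_complex_of_real[symmetric]) (simp add: * of_real_indicator)
    then show ?thesis by simp
  qed
  then have "measure \<mu> X = measure \<nu> X"
    using char_eq_boxes[OF p s eq finite_Basis, of B 0] p s by (simp add: B_def)
  then show "emeasure \<mu> X = emeasure \<nu> X"
    by (simp add: \<mu>.emeasure_eq_measure \<nu>.emeasure_eq_measure)
qed

section \<open>The transition law of an Ornstein-Uhlenbeck process\<close>

lemma norm_iexp_diff_le: "norm (iexp x - iexp y) \<le> min 2 \<bar>x - y\<bar>"
proof -
  have "iexp x - iexp y = iexp y * (iexp (x - y) - 1)"
    by (simp add: right_diff_distrib exp_diff)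
  then have "norm (iexp x - iexp y) = norm (iexp (x - y) - 1)" by (simp add: norm_mult)
  then show ?thesis using iexp_approx1[of "x - y" 0] iexp_approx2[of "x - y" 0] by simp
qed

text \<open>The means of \<open>min 1 (norm _)\<close> metrise convergence in probability. If both
  errors are at most 1, truncation leaves them unchanged and the Lipschitz bound with
  \<open>K\<close> applies; if one exceeds 1, the trivial bound 2 does. Hence the constant 2 + K.
  Two error terms occur because Y_s and Y_{s+t} are approximated by different Riemann sums.\<close>

lemma (in prob_space) tendsto_expectation_iexp:
  fixes A B :: "nat \<Rightarrow> 'a \<Rightarrow> 'b::real_normed_vector"
  assumes [measurable]: "\<And>n. \<theta>n n \<in> borel_measurable M" "\<theta> \<in> borel_measurable M"
    and A: "(\<lambda>n. \<integral>x. min 1 (norm (A n x)) \<partial>M) \<longlonglongrightarrow> 0" and B: "(\<lambda>n. \<integral>x. min 1 (norm (B n x)) \<partial>M) \<longlonglongrightarrow> 0"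
    and mA: "\<And>n. (\<lambda>x. norm (A n x)) \<in> borel_measurable M" and mB: "\<And>n. (\<lambda>x. norm (B n x)) \<in> borel_measurable M"
    and le: "\<And>n x. x \<in> space M \<Longrightarrow> \<bar>\<theta>n n x - \<theta> x\<bar> \<le> K * (norm (A n x) + norm (B n x))" and K: "0 \<le> K"
  shows "(\<lambda>n. CLINT x|M. iexp (\<theta>n n x)) \<longlonglongrightarrow> (CLINT x|M. iexp (\<theta> x))"
proof (rule LIM_zero_cancel, rule Lim_null_comparison)
  note [measurable] = mA mB
  have i: "integrable M (\<lambda>x. min 1 (norm (A n x)))" "integrable M (\<lambda>x. min 1 (norm (B n x)))" for n
    by (auto intro!: integrable_const_bound[where B=1])
  show "(\<lambda>n. (2 + K) * ((\<integral>x. min 1 (norm (A n x)) \<partial>M) + (\<integral>x. min 1 (norm (B n x)) \<partial>M))) \<longlonglongrightarrow> 0"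
    using tendsto_mult_right_zero[OF tendsto_add_zero[OF A B]] by simp
  show "\<forall>\<^sub>F n in sequentially. norm ((CLINT x|M. iexp (\<theta>n n x)) - (CLINT x|M. iexp (\<theta> x))) \<le>
     (2 + K) * ((\<integral>x. min 1 (norm (A n x)) \<partial>M) + (\<integral>x. min 1 (norm (B n x)) \<partial>M))"
  proof (rule always_eventually, rule allI)
    fix n
    have "(CLINT x|M. iexp (\<theta>n n x)) - (CLINT x|M. iexp (\<theta> x)) = (CLINT x|M. iexp (\<theta>n n x) - iexp (\<theta> x))"
      by (rule Bochner_Integration.integral_diff[symmetric]) (auto intro!: integrable_const_bound[where B=1])
    also have "norm \<dots> \<le> (\<integral>x. norm (iexp (\<theta>n n x) - iexp (\<theta> x)) \<partial>M)" by (rule integral_norm_bound)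
    also have "\<dots> \<le> (\<integral>x. (2 + K) * (min 1 (norm (A n x)) + min 1 (norm (B n x))) \<partial>M)"
    proof (rule integral_mono)
      show "integrable M (\<lambda>x. norm (iexp (\<theta>n n x) - iexp (\<theta> x)))"
        by (intro integrable_norm Bochner_Integration.integrable_diff integrable_const_bound[where B=1]) auto
      show "integrable M (\<lambda>x. (2 + K) * (min 1 (norm (A n x)) + min 1 (norm (B n x))))"
        using i by (intro integrable_mult_right Bochner_Integration.integrable_add)
      fix x assume x: "x \<in> space M"
      define u v where "u = norm (A n x)" and "v = norm (B n x)"
      have uv: "0 \<le> u" "0 \<le> v" by (auto simp: u_def v_def)
      have 1: "norm (iexp (\<theta>n n x) - iexp (\<theta> x)) \<le> 2" "norm (iexp (\<theta>n n x) - iexp (\<theta> x)) \<le> K * (u + v)"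
        using norm_iexp_diff_le[of "\<theta>n n x" "\<theta> x"] le[OF x, of n] by (auto simp: u_def v_def)
      show "norm (iexp (\<theta>n n x) - iexp (\<theta> x)) \<le> (2 + K) * (min 1 (norm (A n x)) + min 1 (norm (B n x)))"
        unfolding u_def[symmetric] v_def[symmetric]
      proof (cases "u \<le> 1 \<and> v \<le> 1")
        case True
        then have "K * (u + v) \<le> (2 + K) * (min 1 u + min 1 v)"
          using uv by (intro mult_mono) (use K in auto)
        then show "norm (iexp (\<theta>n n x) - iexp (\<theta> x)) \<le> (2 + K) * (min 1 u + min 1 v)" using 1 by linarith
      next
        case False
        then have "(2 + K) * 1 \<le> (2 + K) * (min 1 u + min 1 v)"
          using uv K by (intro mult_left_mono) auto
        moreover have "norm (iexp (\<theta>n n x) - iexp (\<theta> x)) \<le> (2 + K) * 1" using 1 K by simp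
        ultimately show "norm (iexp (\<theta>n n x) - iexp (\<theta> x)) \<le> (2 + K) * (min 1 u + min 1 v)" by (rule order_trans[rotated])
      qed
    qed
    also have "\<dots> = (2 + K) * ((\<integral>x. min 1 (norm (A n x)) \<partial>M) + (\<integral>x. min 1 (norm (B n x)) \<partial>M))"
      using i by (simp only: integral_mult_right_zero Bochner_Integration.integral_add)
    finally show "norm ((CLINT x|M. iexp (\<theta>n n x)) - (CLINT x|M. iexp (\<theta> x))) \<le>
      (2 + K) * ((\<integral>x. min 1 (norm (A n x)) \<partial>M) + (\<integral>x. min 1 (norm (B n x)) \<partial>M))" .
  qed
qed

lemma (in prob_space) expectation_min_norm_le:
  fixes X :: "'a \<Rightarrow> 'b::real_normed_vector"
  assumes [measurable]: "(\<lambda>x. norm (X x)) \<in> borel_measurable M" and e: "0 \<le> e"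
  shows "(\<integral>x. min 1 (norm (X x)) \<partial>M) \<le> e + prob {x\<in>space M. norm (X x) > e}"
proof -
  let ?E = "{x\<in>space M. norm (X x) > e}"
  have "(\<integral>x. min 1 (norm (X x)) \<partial>M) \<le> (\<integral>x. e + indicator ?E x \<partial>M)"
  proof (rule integral_mono)
    show "integrable M (\<lambda>x. min 1 (norm (X x)))" by (auto intro!: integrable_const_bound[where B=1])
    show "integrable M (\<lambda>x. e + indicator ?E x)"
      by (intro Bochner_Integration.integrable_add integrable_real_indicator) (auto simp: emeasure_eq_measure)
    show "min 1 (norm (X x)) \<le> e + indicator ?E x" if "x \<in> space M" for x
      using e that by (cases "norm (X x) > e") auto
  qed
  also have "\<dots> = e + prob ?E"
    by (subst Bochner_Integration.integral_add) (auto simp: prob_space emeasure_eq_measure)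
  finally show ?thesis .
qed

text \<open>Evaluates the limit over all partitions along one sequence of mesh at most C / n, in the
  form that \<open>tendsto_expectation_iexp\<close> takes. The case n = 0 is left open since the
  partitions used later divide by n.\<close>

lemma has_stoch_integral_tendsto:
  fixes Z :: "real \<Rightarrow> 'w \<Rightarrow> real^'d"
  assumes M: "prob_space M" and I: "has_stoch_integral M Z f a b I"
    and Z: "\<And>n i. Z (\<tau> n i) \<in> borel_measurable M"
    and \<tau>: "\<And>n. 0 < n \<Longrightarrow> \<tau> n 0 = a" "\<And>n. 0 < n \<Longrightarrow> \<tau> n (k n) = b"
    and mesh: "\<And>n i. 0 < n \<Longrightarrow> i < k n \<Longrightarrow> \<tau> n i \<le> \<tau> n (Suc i) \<and> \<tau> n (Suc i) - \<tau> n i \<le> C / real n"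
  shows "(\<lambda>n. \<integral>\<omega>. min 1 (norm ((\<Sum>i<k n. f (\<tau> n i) *\<^sub>R (Z (\<tau> n (Suc i)) \<omega> - Z (\<tau> n i) \<omega>)) - I \<omega>)) \<partial>M) \<longlonglongrightarrow> 0"
proof (rule LIMSEQ_I)
  interpret prob_space M by fact
  let ?D = "\<lambda>n \<omega>. (\<Sum>i<k n. f (\<tau> n i) *\<^sub>R (Z (\<tau> n (Suc i)) \<omega> - Z (\<tau> n i) \<omega>)) - I \<omega>"
  note [measurable] = Z
  have [measurable]: "I \<in> borel_measurable M" using I by (simp add: has_stoch_integral_def)
  fix r :: real assume r: "0 < r"
  \<comment> \<open>Tolerance and exceptional probability are both r / 2, because
    \<open>expectation_min_norm_le\<close> adds them.\<close>
  then have "0 < r / 2" by simp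
  with I[unfolded has_stoch_integral_def, THEN conjunct2, rule_format, of "r / 2" "r / 2"]
  obtain \<delta> where \<delta>: "\<delta> > 0"
    "\<And>\<tau> n. \<tau> 0 = a \<and> \<tau> n = b \<and> (\<forall>i<n. \<tau> i \<le> \<tau> (Suc i) \<and> \<tau> (Suc i) - \<tau> i < \<delta>) \<Longrightarrow>
        measure M {\<omega> \<in> space M.
          norm ((\<Sum>i<n. f (\<tau> i) *\<^sub>R (Z (\<tau> (Suc i)) \<omega> - Z (\<tau> i) \<omega>)) - I \<omega>) > r / 2} < r / 2"
    by blast
  obtain n0 where n0: "C / \<delta> < real n0" using reals_Archimedean2 by blast
  have "norm ((\<integral>\<omega>. min 1 (norm (?D n \<omega>)) \<partial>M) - 0) < r" if n: "max 1 n0 \<le> n" for n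
  proof -
    have "0 < n" using n by simp
    have "C < \<delta> * real n0" using n0 \<delta>(1) by (simp add: field_simps)
    also have "\<dots> \<le> \<delta> * real n" using n \<delta>(1) by (intro mult_left_mono) auto
    finally have C: "C / real n < \<delta>" using \<open>0 < n\<close> by (simp add: field_simps)
    have "\<tau> n i \<le> \<tau> n (Suc i) \<and> \<tau> n (Suc i) - \<tau> n i < \<delta>" if "i < k n" for i
      using mesh[OF \<open>0 < n\<close> that] C by linarith
    then have "measure M {\<omega> \<in> space M. norm (?D n \<omega>) > r / 2} < r / 2"
      using \<tau>[OF \<open>0 < n\<close>] by (intro \<delta>(2)) blast
    moreover have "(\<integral>\<omega>. min 1 (norm (?D n \<omega>)) \<partial>M) \<le> r / 2 + prob {\<omega> \<in> space M. norm (?D n \<omega>) > r / 2}"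
      using r by (intro expectation_min_norm_le) auto
    moreover have "0 \<le> (\<integral>\<omega>. min 1 (norm (?D n \<omega>)) \<partial>M)" by (intro integral_nonneg_AE) simp
    ultimately show ?thesis by simp
  qed
  then show "\<exists>no. \<forall>n\<ge>no. norm ((\<integral>\<omega>. min 1 (norm (?D n \<omega>)) \<partial>M) - 0) < r" by blast
qed

section \<open>Factorisation over independent increments\<close>

text \<open>\<open>Y 0\<close> is independent of the sigma-algebra \<open>N\<close> generated by all
  of Z, and the increments are independent among themselves. The product of the increment factors is
  \<open>N\<close>-measurable, so the first fact splits off \<open>Y 0\<close> and the second
  factorises the rest.\<close>

lemma OU_increments_char:
  fixes Z Y :: "real \<Rightarrow> 'w \<Rightarrow> real^'d"
  assumes OU: "OU_process M lam Z Y" and \<tau>: "0 \<le> \<tau> 0" "\<And>i. i < n \<Longrightarrow> \<tau> i < \<tau> (Suc i)"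
  shows "(CLINT \<omega>|M. iexp (v \<bullet> Y 0 \<omega> + (\<Sum>i<n. c i \<bullet> (Z (\<tau> (Suc i)) \<omega> - Z (\<tau> i) \<omega>)))) =
    (CLINT \<omega>|M. iexp (v \<bullet> Y 0 \<omega>)) * (\<Prod>i<n. CLINT \<omega>|M. iexp (c i \<bullet> (Z (\<tau> (Suc i)) \<omega> - Z (\<tau> i) \<omega>)))"
proof -
  have L: "levy_process M Z" and Ym: "\<And>t. 0 \<le> t \<Longrightarrow> Y t \<in> borel_measurable M"
    and ind: "prob_space.indep_set M (events_of M borel (Y 0)) (sigma_sets (space M) (\<Union>t\<in>{0..}. events_of M borel (Z t)))"
    using OU by (auto simp: OU_process_def)
  interpret prob_space M using L by (simp add: levy_process_def)
  have Zm: "Z t \<in> borel_measurable M" if "0 \<le> t" for t using L that by (simp add: levy_process_def)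
  have \<tau>0: "0 \<le> \<tau> i" if "i \<le> n" for i
    using that
  proof (induction i)
    case (Suc i)
    then show ?case using \<tau>(2)[of i] by simp
  qed (use \<tau> in simp)
  define N where "N = sigma (space M) (\<Union>t\<in>{0..}. events_of M borel (Z t))"
  have sub: "(\<Union>t\<in>{0..}. events_of M borel (Z t)) \<subseteq> Pow (space M)" by (auto simp: events_of_def)
  have sN: "sets N = sigma_sets (space M) (\<Union>t\<in>{0..}. events_of M borel (Z t))" and spN: "space N = space M"
    using sub by (simp_all add: N_def)
  have ZN: "Z t \<in> borel_measurable N" if "0 \<le> t" for t
  proof (rule measurableI)
    fix A :: "(real^'d) set" assume "A \<in> sets borel"
    then have "Z t -` A \<inter> space M \<in> (\<Union>t\<in>{0..}. events_of M borel (Z t))" using that by (auto simp: events_of_def)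
    then show "Z t -` A \<inter> space N \<in> sets N" unfolding sN spN by (rule sigma_sets.Basic)
  qed simp
  define V where "V = vimage_algebra (space M) (Y 0) borel"
  have sV: "sets V = events_of M borel (Y 0)" and spV: "space V = space M"
    by (simp_all add: V_def sets_vimage_algebra2 events_of_def)
  have YV: "Y 0 \<in> borel_measurable V" unfolding V_def by (rule measurable_vimage_algebra1) simp
  let ?D = "\<lambda>i \<omega>. Z (\<tau> (Suc i)) \<omega> - Z (\<tau> i) \<omega>"
  let ?X = "\<lambda>\<omega>. iexp (v \<bullet> Y 0 \<omega>)" and ?P = "\<lambda>\<omega>. \<Prod>i<n. iexp (c i \<bullet> ?D i \<omega>)"
  have Dm: "?D i \<in> borel_measurable M" "?D i \<in> borel_measurable N" if "i < n" for i
    using \<tau>0 that Zm ZN by (auto intro!: borel_measurable_diff)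
  have Xm: "?X \<in> borel_measurable M" "?X \<in> borel_measurable V" using Ym[of 0] YV by auto
  have Pm: "?P \<in> borel_measurable M" "?P \<in> borel_measurable N"
    using Dm by (auto intro!: borel_measurable_prod measurable_compose[of _ _ borel "\<lambda>x. iexp (c _ \<bullet> x)"])
  \<comment> \<open>Events of a function measurable for a sub-sigma-algebra lie in it; thus
    independence descends from \<open>V\<close> and \<open>N\<close> to the two complex
    variables.\<close>
  have sig: "sigma_sets (space M) {f -` A \<inter> space M |A. A \<in> sets borel} \<subseteq> sets W"
    if "f \<in> borel_measurable W" "space W = space M" for W and f :: "'w \<Rightarrow> complex"
    using that measurable_sets[OF that(1)] sets.sigma_sets_subset[of "{f -` A \<inter> space M |A. A \<in> sets borel}" W] by auto
  have "indep_var borel ?X borel ?P"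
    unfolding indep_var_eq
  proof (intro conjI Xm Pm)
    show "indep_set (sigma_sets (space M) {?X -` A \<inter> space M |A. A \<in> sets borel}) (sigma_sets (space M) {?P -` A \<inter> space M |A. A \<in> sets borel})"
      unfolding indep_set_def
    proof (rule indep_sets_mono_sets[OF ind[unfolded indep_set_def]])
      show "case_bool (sigma_sets (space M) {?X -` A \<inter> space M |A. A \<in> sets borel}) (sigma_sets (space M) {?P -` A \<inter> space M |A. A \<in> sets borel}) i
        \<subseteq> case_bool (events_of M borel (Y 0)) (sigma_sets (space M) (\<Union>t\<in>{0..}. events_of M borel (Z t))) i" for i
        using sig[OF Xm(2) spV] sig[OF Pm(2) spN] by (cases i) (simp_all add: sV sN)
    qed
  qed
  moreover have "complex_integrable M ?X" "complex_integrable M ?P"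
    using Xm(1) Pm(1) by (auto intro!: integrable_const_bound[where B=1] simp flip: prod_norm)
  ultimately have 1: "(CLINT \<omega>|M. ?X \<omega> * ?P \<omega>) = (CLINT \<omega>|M. ?X \<omega>) * (CLINT \<omega>|M. ?P \<omega>)"
    by (rule indep_var_lebesgue_integral)
  have "indep_vars (\<lambda>_. borel) ?D {..<n}"
    using L \<tau> by (simp add: levy_process_def)
  then have "indep_vars (\<lambda>_. borel) (\<lambda>i \<omega>. iexp (c i \<bullet> ?D i \<omega>)) {..<n}"
    by (rule indep_vars_compose2) simp
  then have 2: "(CLINT \<omega>|M. ?P \<omega>) = (\<Prod>i<n. CLINT \<omega>|M. iexp (c i \<bullet> ?D i \<omega>))"
  proof (rule indep_vars_lebesgue_integral[rotated])
    show "complex_integrable M (\<lambda>\<omega>. iexp (c i \<bullet> ?D i \<omega>))" if "i \<in> {..<n}" for i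
      using Dm(1)[of i] that by (auto intro!: integrable_const_bound[where B=1])
  qed simp
  have "iexp (v \<bullet> Y 0 \<omega> + (\<Sum>i<n. c i \<bullet> ?D i \<omega>)) = ?X \<omega> * ?P \<omega>" for \<omega>
    by (simp add: distrib_left exp_add sum_distrib_left exp_sum)
  then show ?thesis using 1 2 by simp
qed

lemma levy_increment_char:
  assumes L: "levy_process M Z" and "0 \<le> u" "0 \<le> r"
  shows "(CLINT \<omega>|M. iexp (c \<bullet> (Z (u + r) \<omega> - Z u \<omega>))) = (CLINT \<omega>|M. iexp (c \<bullet> Z r \<omega>))"
proof -
  have Zm[measurable]: "Z t \<in> borel_measurable M" if "0 \<le> t" for t using L that by (simp add: levy_process_def)
  have "distr M borel (\<lambda>\<omega>. Z (u + r) \<omega> - Z u \<omega>) = distr M borel (Z r)"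
    using assms by (simp add: levy_process_def)
  then have "(CLINT x|distr M borel (\<lambda>\<omega>. Z (u + r) \<omega> - Z u \<omega>). iexp (c \<bullet> x)) = (CLINT x|distr M borel (Z r). iexp (c \<bullet> x))"
    by simp
  then show ?thesis using Zm[of "u + r"] Zm[of u] Zm[of r] assms by (simp add: integral_distr)
qed

text \<open>A partition of \<open>[0, s + t]\<close> that contains \<open>s\<close>; its part in \<open>[0, s]\<close> is empty if \<open>s = 0\<close>.\<close>

definition split_count :: "real \<Rightarrow> nat \<Rightarrow> nat" where
  "split_count s n = (if s = 0 then 0 else n)"

definition split_partition :: "real \<Rightarrow> real \<Rightarrow> nat \<Rightarrow> nat \<Rightarrow> real" where
  "split_partition s t n i =
     (let m = split_count s n in if i \<le> m then s * real i / real m else s + t * real (i - m) / real n)"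

text \<open>At the junction index \<open>split_count s n\<close> the first branch of the definition
  applies and yields s * n / n = s; for s = 0 it yields 0 / 0 = 0. Both formulas therefore hold
  there.\<close>

lemma split_partition_simps:
  assumes "0 < n" "0 \<le> s"
  shows "split_partition s t n 0 = 0" "split_partition s t n (split_count s n + j) = s + t * real j / real n"
    and "i \<le> split_count s n \<Longrightarrow> split_partition s t n i = s * real i / real n"
  using assms by (auto simp: split_partition_def split_count_def Let_def)

lemma split_partition_step:
  assumes n: "0 < n" and s: "0 \<le> s"
  shows "split_partition s t n (Suc i) - split_partition s t n i = (if i < split_count s n then s / real n else t / real n)"
proof (cases "i < split_count s n")
  case True
  then show ?thesis using n by (simp add: split_partition_simps(3)[OF n s] field_simps)
next
  case False
  then obtain j where j: "i = split_count s n + j" by (metis le_iff_add not_less)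
  have 1: "split_partition s t n (Suc i) = s + t * real (Suc j) / real n"
    using split_partition_simps(2)[OF n s, of t "Suc j"] by (simp add: j)
  have 2: "split_partition s t n i = s + t * real j / real n"
    using split_partition_simps(2)[OF n s, of t j] by (simp add: j)
  show ?thesis unfolding 1 2 using False n by (simp add: field_simps)
qed

lemma split_partition_nonneg:
  assumes "0 \<le> s" "0 \<le> t"
  shows "0 \<le> split_partition s t n i"
  using assms by (simp add: split_partition_def Let_def)

lemma sum_lessThan_add:
  fixes f :: "nat \<Rightarrow> 'a::comm_monoid_add"
  shows "(\<Sum>i<m + n. f i) = (\<Sum>i<m. f i) + (\<Sum>j<n. f (m + j))"
  by (induction n) (simp_all add: add.assoc)

lemma prod_lessThan_add:
  fixes f :: "nat \<Rightarrow> 'a::comm_monoid_mult"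
  shows "(\<Prod>i<m + n. f i) = (\<Prod>i<m. f i) * (\<Prod>j<n. f (m + j))"
  by (induction n) (simp_all add: mult.assoc)

text \<open>Everything is replaced by Riemann sums over one partition of [0, s + t] through s. Since
  \<open>exp (- lam * (s + t - x)) = a * exp (- lam * (s - x))\<close>, the increments before s
  cancel in the sum for \<open>Y (s + t)\<close> minus \<open>a\<close> times the sum for
  \<open>Y s\<close>. The remaining block is independent of \<open>Y 0\<close> and of the earlier
  increments and, by stationarity, distributed as a Riemann sum of \<open>I\<close> on
  [0, t].\<close>

lemma OU_joint_char:
  fixes Z Y :: "real \<Rightarrow> 'w \<Rightarrow> real^'d"
  assumes OU: "OU_process M lam Z Y" and s: "0 \<le> s" and t: "0 < t"
    and I: "has_stoch_integral M Z (\<lambda>u. exp (- lam * (t - u))) 0 t I"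
  shows "(CLINT \<omega>|M. iexp (w \<bullet> Y s \<omega> + z \<bullet> (Y (s + t) \<omega> - exp (- lam * t) *\<^sub>R Y s \<omega>))) =
    (CLINT \<omega>|M. iexp (w \<bullet> Y s \<omega>)) * (CLINT \<omega>|M. iexp (z \<bullet> I \<omega>))"
proof -
  have L: "levy_process M Z" and Ym: "\<And>t. 0 \<le> t \<Longrightarrow> Y t \<in> borel_measurable M"
    and ex: "\<And>t. 0 \<le> t \<Longrightarrow> \<exists>I. has_stoch_integral M Z (\<lambda>u. exp (- lam * (t - u))) 0 t I \<and>
        (AE \<omega> in M. Y t \<omega> = exp (- lam * t) *\<^sub>R Y 0 \<omega> + I \<omega>)"
    using OU by (auto simp: OU_process_def)
  interpret prob_space M using L by (simp add: levy_process_def)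
  have Zm: "Z t \<in> borel_measurable M" if "0 \<le> t" for t using L that by (simp add: levy_process_def)
  define a where "a = exp (- lam * t)"
  obtain Is where Is: "has_stoch_integral M Z (\<lambda>u. exp (- lam * (s - u))) 0 s Is"
    and Ys: "AE \<omega> in M. Y s \<omega> = exp (- lam * s) *\<^sub>R Y 0 \<omega> + Is \<omega>" using ex[OF s] by blast
  obtain Ist where Ist: "has_stoch_integral M Z (\<lambda>u. exp (- lam * (s + t - u))) 0 (s + t) Ist"
    and Yst: "AE \<omega> in M. Y (s + t) \<omega> = exp (- lam * (s + t)) *\<^sub>R Y 0 \<omega> + Ist \<omega>" using ex[of "s + t"] s t by auto
  have [measurable]: "Is \<in> borel_measurable M" "Ist \<in> borel_measurable M" "I \<in> borel_measurable M" "Y 0 \<in> borel_measurable M"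
    using Is Ist I Ym[of 0] by (auto simp: has_stoch_integral_def)
  define m where "m n = split_count s n" for n
  define T where "T = split_partition s t"
  define T1 where "T1 n i = T n (min i (m n))" for n i
  define T3 where "T3 n i = t * real i / real n" for n i
  have T0: "0 \<le> T n i" for n i using s t by (simp add: T_def split_partition_nonneg)
  have TZ: "Z (T n i) \<in> borel_measurable M" "Z (T1 n i) \<in> borel_measurable M" "Z (T3 n i) \<in> borel_measurable M" for n i
    using T0 t by (auto intro!: Zm simp: T1_def T3_def)
  note [measurable] = TZ
  let ?D = "\<lambda>n i \<omega>. Z (T n (Suc i)) \<omega> - Z (T n i) \<omega>"
  define S1 where "S1 n \<omega> = (\<Sum>i<m n. exp (- lam * (s - T n i)) *\<^sub>R ?D n i \<omega>)" for n \<omega>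
  define S where "S n \<omega> = (\<Sum>i<m n + n. exp (- lam * (s + t - T n i)) *\<^sub>R ?D n i \<omega>)" for n \<omega>
  define S3 where "S3 n \<omega> = (\<Sum>i<n. exp (- lam * (t - T3 n i)) *\<^sub>R (Z (T3 n (Suc i)) \<omega> - Z (T3 n i) \<omega>))" for n \<omega>
  have [measurable]: "S1 n \<in> borel_measurable M" "S n \<in> borel_measurable M" "S3 n \<in> borel_measurable M" for n
    unfolding S1_def S_def S3_def by measurable
  note step = split_partition_step[OF _ s, where t=t, folded T_def m_def]
  note simps = split_partition_simps[OF _ s, where t=t, folded T_def m_def]
  have Tm: "T n (m n) = s" if "0 < n" for n using simps(2)[OF that, of 0] by simp
  have c1: "(\<lambda>n. \<integral>\<omega>. min 1 (norm (S1 n \<omega> - Is \<omega>)) \<partial>M) \<longlonglongrightarrow> 0"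
  proof -
    have "(\<lambda>n. \<integral>\<omega>. min 1 (norm ((\<Sum>i<m n. exp (- lam * (s - T1 n i)) *\<^sub>R (Z (T1 n (Suc i)) \<omega> - Z (T1 n i) \<omega>)) - Is \<omega>)) \<partial>M) \<longlonglongrightarrow> 0"
    proof (rule has_stoch_integral_tendsto[OF prob_space_axioms Is TZ(2), where C=s])
      show "T1 n 0 = 0" "T1 n (m n) = s" if "0 < n" for n using Tm[OF that] simps(1)[OF that] by (auto simp: T1_def)
      show "T1 n i \<le> T1 n (Suc i) \<and> T1 n (Suc i) - T1 n i \<le> s / real n" if "0 < n" "i < m n" for n i
        using step[OF that(1), of i] that s by (simp add: T1_def min_def) (smt (verit) divide_nonneg_nonneg of_nat_0_le_iff)
    qed
    moreover have "S1 n \<omega> = (\<Sum>i<m n. exp (- lam * (s - T1 n i)) *\<^sub>R (Z (T1 n (Suc i)) \<omega> - Z (T1 n i) \<omega>))" for n \<omega>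
      unfolding S1_def by (intro sum.cong refl) (simp add: T1_def min_def)
    ultimately show ?thesis by simp
  qed
  have c2: "(\<lambda>n. \<integral>\<omega>. min 1 (norm (S n \<omega> - Ist \<omega>)) \<partial>M) \<longlonglongrightarrow> 0"
    unfolding S_def
  proof (rule has_stoch_integral_tendsto[OF prob_space_axioms Ist TZ(1), where C="s + t"])
    show "T n 0 = 0" "T n (m n + n) = s + t" if "0 < n" for n using simps(1)[OF that] simps(2)[OF that, of n] that by auto
    show "T n i \<le> T n (Suc i) \<and> T n (Suc i) - T n i \<le> (s + t) / real n" if "0 < n" "i < m n + n" for n i
    proof -
      have "0 \<le> s / real n" "0 \<le> t / real n" using s t by auto
      then show ?thesis using step[OF that(1), of i] by (simp add: add_divide_distrib split: if_splits)
    qed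
  qed
  have c3: "(\<lambda>n. \<integral>\<omega>. min 1 (norm (S3 n \<omega> - I \<omega>)) \<partial>M) \<longlonglongrightarrow> 0"
    unfolding S3_def
  proof (rule has_stoch_integral_tendsto[OF prob_space_axioms I TZ(3), where C=t])
    show "T3 n i \<le> T3 n (Suc i) \<and> T3 n (Suc i) - T3 n i \<le> t / real n" if "0 < n" for n i
      using t that by (simp add: T3_def field_simps)
  qed (auto simp: T3_def)
  \<comment> \<open>The coefficient of \<open>Y 0\<close> once \<open>Y s\<close> is expanded; in
    \<open>Y (s + t) - a *\<^sub>R Y s\<close> the initial value cancels.\<close>
  define v where "v = exp (- lam * s) *\<^sub>R w"
  have lim3: "(\<lambda>n. CLINT \<omega>|M. iexp (z \<bullet> S3 n \<omega>)) \<longlonglongrightarrow> (CLINT \<omega>|M. iexp (z \<bullet> I \<omega>))"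
  proof (rule tendsto_expectation_iexp[where A="\<lambda>n \<omega>. S3 n \<omega> - I \<omega>" and B="\<lambda>n \<omega>. 0::real^'d" and K="norm z"])
    show "\<bar>z \<bullet> S3 n \<omega> - z \<bullet> I \<omega>\<bar> \<le> norm z * (norm (S3 n \<omega> - I \<omega>) + norm (0::real^'d))" for n \<omega>
      using Cauchy_Schwarz_ineq2[of z "S3 n \<omega> - I \<omega>"] by (simp add: inner_diff_right)
  qed (use c3 in simp_all)
  have lim1: "(\<lambda>n. CLINT \<omega>|M. iexp (v \<bullet> Y 0 \<omega> + w \<bullet> S1 n \<omega>)) \<longlonglongrightarrow> (CLINT \<omega>|M. iexp (v \<bullet> Y 0 \<omega> + w \<bullet> Is \<omega>))"
  proof (rule tendsto_expectation_iexp[where A="\<lambda>n \<omega>. S1 n \<omega> - Is \<omega>" and B="\<lambda>n \<omega>. 0::real^'d" and K="norm w"])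
    show "\<bar>(v \<bullet> Y 0 \<omega> + w \<bullet> S1 n \<omega>) - (v \<bullet> Y 0 \<omega> + w \<bullet> Is \<omega>)\<bar> \<le> norm w * (norm (S1 n \<omega> - Is \<omega>) + norm (0::real^'d))" for n \<omega>
      using Cauchy_Schwarz_ineq2[of w "S1 n \<omega> - Is \<omega>"] by (simp add: inner_diff_right)
  qed (use c1 in simp_all)
  have lim2: "(\<lambda>n. CLINT \<omega>|M. iexp (v \<bullet> Y 0 \<omega> + (w \<bullet> S1 n \<omega> + z \<bullet> (S n \<omega> - a *\<^sub>R S1 n \<omega>)))) \<longlonglongrightarrow>
     (CLINT \<omega>|M. iexp (v \<bullet> Y 0 \<omega> + (w \<bullet> Is \<omega> + z \<bullet> (Ist \<omega> - a *\<^sub>R Is \<omega>))))"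
  proof (rule tendsto_expectation_iexp[where A="\<lambda>n \<omega>. S1 n \<omega> - Is \<omega>" and B="\<lambda>n \<omega>. S n \<omega> - Ist \<omega>" and K="norm (w - a *\<^sub>R z) + norm z"])
    fix n \<omega>
    have "(v \<bullet> Y 0 \<omega> + (w \<bullet> S1 n \<omega> + z \<bullet> (S n \<omega> - a *\<^sub>R S1 n \<omega>))) - (v \<bullet> Y 0 \<omega> + (w \<bullet> Is \<omega> + z \<bullet> (Ist \<omega> - a *\<^sub>R Is \<omega>)))
       = (w - a *\<^sub>R z) \<bullet> (S1 n \<omega> - Is \<omega>) + z \<bullet> (S n \<omega> - Ist \<omega>)"
      by (simp add: inner_diff_right inner_diff_left algebra_simps)
    also have "\<bar>\<dots>\<bar> \<le> norm (w - a *\<^sub>R z) * norm (S1 n \<omega> - Is \<omega>) + norm z * norm (S n \<omega> - Ist \<omega>)"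
      by (intro order_trans[OF abs_triangle_ineq] add_mono Cauchy_Schwarz_ineq2)
    also have "\<dots> \<le> (norm (w - a *\<^sub>R z) + norm z) * (norm (S1 n \<omega> - Is \<omega>) + norm (S n \<omega> - Ist \<omega>))"
      by (simp add: distrib_right distrib_left)
    finally show "\<bar>(v \<bullet> Y 0 \<omega> + (w \<bullet> S1 n \<omega> + z \<bullet> (S n \<omega> - a *\<^sub>R S1 n \<omega>))) - (v \<bullet> Y 0 \<omega> + (w \<bullet> Is \<omega> + z \<bullet> (Ist \<omega> - a *\<^sub>R Is \<omega>)))\<bar>
      \<le> (norm (w - a *\<^sub>R z) + norm z) * (norm (S1 n \<omega> - Is \<omega>) + norm (S n \<omega> - Ist \<omega>))" .
  qed (use c1 c2 in simp_all)
  have fact: "(CLINT \<omega>|M. iexp (v \<bullet> Y 0 \<omega> + (w \<bullet> S1 n \<omega> + z \<bullet> (S n \<omega> - a *\<^sub>R S1 n \<omega>)))) =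
     (CLINT \<omega>|M. iexp (v \<bullet> Y 0 \<omega> + w \<bullet> S1 n \<omega>)) * (CLINT \<omega>|M. iexp (z \<bullet> S3 n \<omega>))" if n: "0 < n" for n
  proof -
    \<comment> \<open>Independence of increments is available for strictly increasing times only.
      For s = 0 the first part of the partition is empty, so its zero step width never
      occurs.\<close>
    have inc: "T n i < T n (Suc i)" if "i < m n + n" for i
    proof -
      have "0 < t / real n" "i < m n \<Longrightarrow> 0 < s / real n" using s t n by (auto simp: m_def split_count_def split: if_splits)
      then show ?thesis using step[OF n, of i] by (simp split: if_splits)
    qed
    have inc3: "T3 n i < T3 n (Suc i)" for i using t n by (simp add: T3_def field_simps)
    define c where "c i = (if i < m n then exp (- lam * (s - T n i)) *\<^sub>R w else exp (- lam * (s + t - T n i)) *\<^sub>R z)" for i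
    have e: "exp (- lam * (s + t - x)) = a * exp (- lam * (s - x))" for x
      by (simp add: a_def algebra_simps flip: exp_add)
    have "S n \<omega> - a *\<^sub>R S1 n \<omega> = (\<Sum>j<n. exp (- lam * (s + t - T n (m n + j))) *\<^sub>R ?D n (m n + j) \<omega>)" for \<omega>
    proof -
      have "S n \<omega> = (\<Sum>i<m n. exp (- lam * (s + t - T n i)) *\<^sub>R ?D n i \<omega>) + (\<Sum>j<n. exp (- lam * (s + t - T n (m n + j))) *\<^sub>R ?D n (m n + j) \<omega>)"
        unfolding S_def by (rule sum_lessThan_add)
      moreover have "a *\<^sub>R S1 n \<omega> = (\<Sum>i<m n. exp (- lam * (s + t - T n i)) *\<^sub>R ?D n i \<omega>)"
        unfolding S1_def scaleR_sum_right e by simp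
      ultimately show ?thesis by simp
    qed
    note diff = this
    have sp: "w \<bullet> S1 n \<omega> + z \<bullet> (S n \<omega> - a *\<^sub>R S1 n \<omega>) = (\<Sum>i<m n + n. c i \<bullet> ?D n i \<omega>)" for \<omega>
    proof -
      have "(\<Sum>i<m n + n. c i \<bullet> ?D n i \<omega>) = (\<Sum>i<m n. c i \<bullet> ?D n i \<omega>) + (\<Sum>j<n. c (m n + j) \<bullet> ?D n (m n + j) \<omega>)"
        by (rule sum_lessThan_add)
      then show ?thesis
        unfolding diff by (simp add: c_def S1_def inner_sum_right)
    qed
    have w1: "w \<bullet> S1 n \<omega> = (\<Sum>i<m n. c i \<bullet> ?D n i \<omega>)" for \<omega> by (simp add: c_def S1_def inner_sum_right)
    have z3: "z \<bullet> S3 n \<omega> = (\<Sum>i<n. (exp (- lam * (t - T3 n i)) *\<^sub>R z) \<bullet> (Z (T3 n (Suc i)) \<omega> - Z (T3 n i) \<omega>))" for \<omega>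
      by (simp add: S3_def inner_sum_right)
    let ?E = "\<lambda>i. CLINT \<omega>|M. iexp (c i \<bullet> ?D n i \<omega>)"
    have "(CLINT \<omega>|M. iexp (v \<bullet> Y 0 \<omega> + (w \<bullet> S1 n \<omega> + z \<bullet> (S n \<omega> - a *\<^sub>R S1 n \<omega>)))) = (CLINT \<omega>|M. iexp (v \<bullet> Y 0 \<omega>)) * (\<Prod>i<m n + n. ?E i)"
      unfolding sp by (rule OU_increments_char[where \<tau>="T n" and n="m n + n", OF OU T0 inc])
    also have "(\<Prod>i<m n + n. ?E i) = (\<Prod>i<m n. ?E i) * (\<Prod>j<n. ?E (m n + j))"
      by (rule prod_lessThan_add)
    also have "(\<Prod>j<n. ?E (m n + j)) = (CLINT \<omega>|M. iexp (z \<bullet> S3 n \<omega>))"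
    proof -
      \<comment> \<open>The frequency 0 in front of \<open>Y 0\<close> turns the joint formula into
        one for the increments alone.\<close>
      have "(CLINT \<omega>|M. iexp (0 \<bullet> Y 0 \<omega> + z \<bullet> S3 n \<omega>)) = (CLINT \<omega>|M. iexp (0 \<bullet> Y 0 \<omega>)) *
         (\<Prod>i<n. CLINT \<omega>|M. iexp ((exp (- lam * (t - T3 n i)) *\<^sub>R z) \<bullet> (Z (T3 n (Suc i)) \<omega> - Z (T3 n i) \<omega>)))"
        unfolding z3 by (rule OU_increments_char[where \<tau>="T3 n" and n=n, OF OU _ inc3]) (simp add: T3_def)
      moreover have "?E (m n + j) = (CLINT \<omega>|M. iexp ((exp (- lam * (t - T3 n j)) *\<^sub>R z) \<bullet> (Z (T3 n (Suc j)) \<omega> - Z (T3 n j) \<omega>)))" for j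
      proof -
        have 1: "T n (m n + j) = s + t * real j / real n" by (rule simps(2)[OF n])
        have 2: "T n (Suc (m n + j)) = (s + t * real j / real n) + t / real n"
          using simps(2)[OF n, of "Suc j"] by (simp add: distrib_left add_divide_distrib)
        have 3: "T3 n (Suc j) = T3 n j + t / real n" by (simp add: T3_def distrib_left add_divide_distrib)
        have 4: "c (m n + j) = exp (- lam * (t - T3 n j)) *\<^sub>R z" by (simp add: c_def 1 T3_def)
        have p: "0 \<le> T3 n j" "0 \<le> s + t * real j / real n" "0 \<le> t / real n" using s t by (auto simp: T3_def)
        show ?thesis unfolding 4 unfolding 1 2 3
          by (simp only: levy_increment_char[OF L p(2,3)] levy_increment_char[OF L p(1,3)])
      qed
      ultimately show ?thesis by (simp add: prob_space)
    qed
    also have "(CLINT \<omega>|M. iexp (v \<bullet> Y 0 \<omega>)) * ((\<Prod>i<m n. ?E i) * (CLINT \<omega>|M. iexp (z \<bullet> S3 n \<omega>))) =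
       (CLINT \<omega>|M. iexp (v \<bullet> Y 0 \<omega> + w \<bullet> S1 n \<omega>)) * (CLINT \<omega>|M. iexp (z \<bullet> S3 n \<omega>))"
      unfolding w1 using OU_increments_char[where \<tau>="T n" and n="m n" and v=v and c=c, OF OU T0] inc by simp
    finally show ?thesis .
  qed
  have "(CLINT \<omega>|M. iexp (v \<bullet> Y 0 \<omega> + (w \<bullet> Is \<omega> + z \<bullet> (Ist \<omega> - a *\<^sub>R Is \<omega>)))) =
     (CLINT \<omega>|M. iexp (v \<bullet> Y 0 \<omega> + w \<bullet> Is \<omega>)) * (CLINT \<omega>|M. iexp (z \<bullet> I \<omega>))"
  proof (rule LIMSEQ_unique[OF lim2])
    show "(\<lambda>n. CLINT \<omega>|M. iexp (v \<bullet> Y 0 \<omega> + (w \<bullet> S1 n \<omega> + z \<bullet> (S n \<omega> - a *\<^sub>R S1 n \<omega>))))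
      \<longlonglongrightarrow> (CLINT \<omega>|M. iexp (v \<bullet> Y 0 \<omega> + w \<bullet> Is \<omega>)) * (CLINT \<omega>|M. iexp (z \<bullet> I \<omega>))"
      by (rule Lim_transform_eventually[OF tendsto_mult[OF lim1 lim3]])
        (use fact in \<open>auto simp: eventually_sequentially intro!: exI[of _ 1]\<close>)
  qed
  moreover have "(CLINT \<omega>|M. iexp (w \<bullet> Y s \<omega>)) = (CLINT \<omega>|M. iexp (v \<bullet> Y 0 \<omega> + w \<bullet> Is \<omega>))"
    using Ys Ym[OF s] by (intro integral_cong_AE) (auto simp: v_def inner_add_right)
  moreover have "(CLINT \<omega>|M. iexp (w \<bullet> Y s \<omega> + z \<bullet> (Y (s + t) \<omega> - a *\<^sub>R Y s \<omega>))) =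
     (CLINT \<omega>|M. iexp (v \<bullet> Y 0 \<omega> + (w \<bullet> Is \<omega> + z \<bullet> (Ist \<omega> - a *\<^sub>R Is \<omega>))))"
  proof (rule integral_cong_AE)
    have "a * exp (- lam * s) = exp (- lam * (s + t))" by (simp add: a_def algebra_simps flip: exp_add)
    then have *: "(a *\<^sub>R exp (- lam * s) *\<^sub>R y) = exp (- lam * (s + t)) *\<^sub>R (y :: real^'d)" for y by simp
    show "AE \<omega> in M. iexp (w \<bullet> Y s \<omega> + z \<bullet> (Y (s + t) \<omega> - a *\<^sub>R Y s \<omega>)) =
      iexp (v \<bullet> Y 0 \<omega> + (w \<bullet> Is \<omega> + z \<bullet> (Ist \<omega> - a *\<^sub>R Is \<omega>)))"
      using Ys Yst
    proof eventually_elim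
      case (elim \<omega>)
      have "Y (s + t) \<omega> - a *\<^sub>R Y s \<omega> = Ist \<omega> - a *\<^sub>R Is \<omega>" unfolding elim scaleR_add_right * by simp
      then show ?case unfolding elim(1) v_def by (simp add: inner_add_right add.assoc)
    qed
  qed (use Ym[of s] Ym[of "s + t"] s t in auto)
  ultimately show ?thesis by (simp add: a_def)
qed

section \<open>The increment law from the limiting distribution\<close>

text \<open>Weak convergence is stated for real test functions, so \<open>iexp\<close> is tested
  through cosine and sine.\<close>

lemma limiting_distribution_char:
  fixes Y :: "real \<Rightarrow> 'w \<Rightarrow> real^'d"
  assumes lim: "limiting_distribution M Y \<mu>" and M: "prob_space M" and Y: "\<And>t. 0 \<le> t \<Longrightarrow> Y t \<in> borel_measurable M"
  shows "((\<lambda>t. CLINT \<omega>|M. iexp (z \<bullet> Y t \<omega>)) \<longlongrightarrow> char_vec \<mu> z) at_top"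
proof -
  interpret M: prob_space M by fact
  interpret \<mu>: prob_space \<mu> using lim by (simp add: limiting_distribution_def)
  have s\<mu>[measurable_cong]: "sets \<mu> = sets borel" using lim by (simp add: limiting_distribution_def)
  have c: "((\<lambda>t. \<integral>x. f x \<partial>(distr M borel (Y t))) \<longlongrightarrow> (\<integral>x. f x \<partial>\<mu>)) at_top"
    if "continuous_on UNIV f" "bounded (range f)" for f :: "real^'d \<Rightarrow> real" using lim that by (simp add: limiting_distribution_def)
  have bd: "bounded (range (\<lambda>x. cos (z \<bullet> x)))" "bounded (range (\<lambda>x. sin (z \<bullet> x)))"
    by (auto intro!: boundedI[where B=1])
  have cosl: "((\<lambda>t. \<integral>x. cos (z \<bullet> x) \<partial>(distr M borel (Y t))) \<longlongrightarrow> (\<integral>x. cos (z \<bullet> x) \<partial>\<mu>)) at_top"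
    and sinl: "((\<lambda>t. \<integral>x. sin (z \<bullet> x) \<partial>(distr M borel (Y t))) \<longlongrightarrow> (\<integral>x. sin (z \<bullet> x) \<partial>\<mu>)) at_top"
    by (intro c bd continuous_intros)+
  have split: "(CLINT x|N. iexp (z \<bullet> x)) = complex_of_real (\<integral>x. cos (z \<bullet> x) \<partial>N) + \<i> * complex_of_real (\<integral>x. sin (z \<bullet> x) \<partial>N)"
    if N: "prob_space N" and [measurable_cong]: "sets N = sets borel" for N
  proof -
    interpret N: prob_space N by fact
    have i: "integrable N (\<lambda>x. cos (z \<bullet> x))" "integrable N (\<lambda>x. sin (z \<bullet> x))"
      by (auto intro!: N.integrable_const_bound[where B=1])
    have "iexp (z \<bullet> x) = complex_of_real (cos (z \<bullet> x)) + \<i> * complex_of_real (sin (z \<bullet> x))" for x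
      by (simp add: exp_Euler cos_of_real sin_of_real)
    then show ?thesis using i by simp
  qed
  have "((\<lambda>t. CLINT x|distr M borel (Y t). iexp (z \<bullet> x)) \<longlongrightarrow> char_vec \<mu> z) at_top"
  proof (rule Lim_transform_eventually)
    show "((\<lambda>t. complex_of_real (\<integral>x. cos (z \<bullet> x) \<partial>(distr M borel (Y t))) + \<i> * complex_of_real (\<integral>x. sin (z \<bullet> x) \<partial>(distr M borel (Y t)))) \<longlongrightarrow> char_vec \<mu> z) at_top"
      unfolding char_vec_def split[OF \<mu>.prob_space_axioms s\<mu>] by (intro tendsto_intros cosl sinl)
    show "\<forall>\<^sub>F t in at_top. complex_of_real (\<integral>x. cos (z \<bullet> x) \<partial>(distr M borel (Y t))) + \<i> * complex_of_real (\<integral>x. sin (z \<bullet> x) \<partial>(distr M borel (Y t)))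
      = (CLINT x|distr M borel (Y t). iexp (z \<bullet> x))"
      using eventually_ge_at_top[of 0]
    proof eventually_elim
      case (elim t)
      then show ?case by (subst split) (auto intro: M.prob_space_distr Y)
    qed
  qed
  then show ?thesis
  proof (rule Lim_transform_eventually)
    show "\<forall>\<^sub>F t in at_top. (CLINT x|distr M borel (Y t). iexp (z \<bullet> x)) = (CLINT \<omega>|M. iexp (z \<bullet> Y t \<omega>))"
      using eventually_ge_at_top[of 0]
    proof eventually_elim
      case (elim t)
      then show ?case using Y[of t] by (simp add: integral_distr)
    qed
  qed
qed

text \<open>For \<open>w\<close> equal to a z the joint characteristic function becomes that of
  \<open>Y (r + t)\<close> at z. Letting r tend to infinity determines the factor
  \<open>?\<psi>\<close> of the stochastic integral, which does not involve s. The result is kept as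
  a product; the division follows once \<open>char_vec \<mu>\<close> is known to be an
  exponential.\<close>

lemma OU_transition_char:
  fixes Z Y :: "real \<Rightarrow> 'w \<Rightarrow> real^'d"
  assumes OU: "OU_process M lam Z Y" and lim: "limiting_distribution M Y \<mu>" and s: "0 \<le> s" and t: "0 < t"
  shows "(CLINT \<omega>|M. iexp (w \<bullet> Y s \<omega> + z \<bullet> (Y (s + t) \<omega> - exp (- lam * t) *\<^sub>R Y s \<omega>))) * char_vec \<mu> (exp (- lam * t) *\<^sub>R z)
    = (CLINT \<omega>|M. iexp (w \<bullet> Y s \<omega>)) * char_vec \<mu> z"
proof -
  let ?a = "exp (- lam * t)"
  have M: "prob_space M" and Y: "\<And>t. 0 \<le> t \<Longrightarrow> Y t \<in> borel_measurable M"
    using OU by (auto simp: OU_process_def levy_process_def)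
  obtain I where I: "has_stoch_integral M Z (\<lambda>u. exp (- lam * (t - u))) 0 t I"
    using OU t unfolding OU_process_def by (meson less_imp_le)
  let ?\<psi> = "CLINT \<omega>|M. iexp (z \<bullet> I \<omega>)"
  have "char_vec \<mu> z = char_vec \<mu> (?a *\<^sub>R z) * ?\<psi>"
  proof (rule tendsto_unique[OF trivial_limit_at_top_linorder])
    have "filterlim (\<lambda>r::real. t + r) at_top at_top" by (rule filterlim_tendsto_add_at_top[OF tendsto_const filterlim_ident])
    from filterlim_compose[OF limiting_distribution_char[OF lim M Y, of z] this]
    show "((\<lambda>r. CLINT \<omega>|M. iexp (z \<bullet> Y (t + r) \<omega>)) \<longlongrightarrow> char_vec \<mu> z) at_top" .
    show "((\<lambda>r. CLINT \<omega>|M. iexp (z \<bullet> Y (t + r) \<omega>)) \<longlongrightarrow> char_vec \<mu> (?a *\<^sub>R z) * ?\<psi>) at_top"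
    proof (rule Lim_transform_eventually)
      show "((\<lambda>r. (CLINT \<omega>|M. iexp ((?a *\<^sub>R z) \<bullet> Y r \<omega>)) * ?\<psi>) \<longlongrightarrow> char_vec \<mu> (?a *\<^sub>R z) * ?\<psi>) at_top"
        by (intro tendsto_mult tendsto_const limiting_distribution_char[OF lim M Y])
      show "\<forall>\<^sub>F r in at_top. (CLINT \<omega>|M. iexp ((?a *\<^sub>R z) \<bullet> Y r \<omega>)) * ?\<psi> = (CLINT \<omega>|M. iexp (z \<bullet> Y (t + r) \<omega>))"
        using eventually_ge_at_top[of 0]
      proof eventually_elim
        case (elim r)
        have "(CLINT \<omega>|M. iexp ((?a *\<^sub>R z) \<bullet> Y r \<omega> + z \<bullet> (Y (r + t) \<omega> - ?a *\<^sub>R Y r \<omega>))) = (CLINT \<omega>|M. iexp ((?a *\<^sub>R z) \<bullet> Y r \<omega>)) * ?\<psi>"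
          by (rule OU_joint_char[OF OU elim t I])
        moreover have "(?a *\<^sub>R z) \<bullet> Y r \<omega> + z \<bullet> (Y (r + t) \<omega> - ?a *\<^sub>R Y r \<omega>) = z \<bullet> Y (t + r) \<omega>" for \<omega>
          by (simp add: inner_diff_right add.commute)
        ultimately show ?case by (simp only:)
      qed
    qed
  qed
  then show ?thesis using OU_joint_char[OF OU s t I, of w z] by simp
qed

section \<open>From a factorised characteristic function to a conditional law\<close>

text \<open>The hypothesis says that (T, X - a T) has the characteristic function of a product law,
  and uniqueness on the product space turns this into independence. The conditional law is read off
  by Fubini after the event for (T, X) is rewritten as the event \<open>F\<close> for (T, X - a
  T).\<close>

lemma conditional_distribution_affine:
  fixes X T :: "'w \<Rightarrow> real^'d" and U :: "'q \<Rightarrow> real^'d"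
  assumes M: "prob_space M" and Q: "prob_space Q" and [measurable]: "X \<in> borel_measurable M" "T \<in> borel_measurable M" "U \<in> borel_measurable Q"
    and ch: "\<And>w z. (CLINT \<omega>|M. iexp (w \<bullet> T \<omega> + z \<bullet> (X \<omega> - a *\<^sub>R T \<omega>))) = (CLINT \<omega>|M. iexp (w \<bullet> T \<omega>)) * (CLINT \<omega>|Q. iexp (z \<bullet> U \<omega>))"
  shows "conditional_distribution M X T (\<lambda>y. distr Q borel (\<lambda>\<omega>. a *\<^sub>R y + U \<omega>))"
proof -
  interpret M: prob_space M by fact
  interpret Q: prob_space Q by fact
  interpret D: prob_space "distr M borel T" by (rule M.prob_space_distr) simp
  interpret E: prob_space "distr Q borel U" by (rule Q.prob_space_distr) simp
  interpret P: pair_prob_space "distr M borel T" "distr Q borel U" ..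
  let ?J = "distr M borel (\<lambda>\<omega>. (T \<omega>, X \<omega> - a *\<^sub>R T \<omega>))" and ?P = "distr M borel T \<Otimes>\<^sub>M distr Q borel U"
  have sP: "sets ?P = sets borel"
  proof -
    have "sets ?P = sets (borel \<Otimes>\<^sub>M borel :: ((real^'d) \<times> (real^'d)) measure)" by (rule sets_pair_measure_cong) simp_all
    then show ?thesis unfolding borel_prod .
  qed
  have eq: "?J = ?P"
  proof (rule char_unique)
    show "prob_space ?J" by (rule M.prob_space_distr) simp
    show "prob_space ?P" by (rule P.prob_space_axioms)
    show "sets ?P = sets borel" by (rule sP)
    fix zz :: "(real^'d) \<times> (real^'d)"
    obtain w z where zz: "zz = (w, z)" by force
    have "(CLINT x|?J. iexp (zz \<bullet> x)) = (CLINT \<omega>|M. iexp (w \<bullet> T \<omega> + z \<bullet> (X \<omega> - a *\<^sub>R T \<omega>)))"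
    proof -
      have "(CLINT x|?J. iexp (zz \<bullet> x)) = (CLINT \<omega>|M. iexp (zz \<bullet> (T \<omega>, X \<omega> - a *\<^sub>R T \<omega>)))"
        by (rule integral_distr) simp_all
      then show ?thesis by (simp add: zz)
    qed
    also have "\<dots> = (CLINT \<omega>|M. iexp (w \<bullet> T \<omega>)) * (CLINT \<omega>|Q. iexp (z \<bullet> U \<omega>))" by (rule ch)
    also have "\<dots> = (CLINT x|distr M borel T. iexp (w \<bullet> x)) * (CLINT y|distr Q borel U. iexp (z \<bullet> y))"
      by (simp add: integral_distr)
    also have "\<dots> = (CLINT x|distr M borel T. CLINT y|distr Q borel U. iexp (w \<bullet> x) * iexp (z \<bullet> y))"
      by simp
    also have "\<dots> = (CLINT p|?P. iexp (w \<bullet> fst p) * iexp (z \<bullet> snd p))"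
    proof -
      have "(\<lambda>p. iexp (w \<bullet> fst p) * iexp (z \<bullet> snd p)) \<in> borel_measurable ?P" by measurable
      then have "complex_integrable ?P (\<lambda>p. iexp (w \<bullet> fst p) * iexp (z \<bullet> snd p))"
        by (intro P.integrable_const_bound[where B=1]) (auto simp: norm_mult)
      from P.integral_fst'[OF this] show ?thesis by simp
    qed
    also have "\<dots> = (CLINT p|?P. iexp (zz \<bullet> p))"
      by (simp add: zz inner_prod_def distrib_left exp_add)
    finally show "(CLINT x|?J. iexp (zz \<bullet> x)) = (CLINT p|?P. iexp (zz \<bullet> p))" .
  qed simp
  have k[measurable]: "(\<lambda>y. distr Q borel (\<lambda>\<omega>. a *\<^sub>R y + U \<omega>)) \<in> measurable borel (prob_algebra borel)"
  proof (rule measurable_distr_prob_space2[where M=Q])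
    show "(\<lambda>_. Q) \<in> borel \<rightarrow>\<^sub>M prob_algebra Q" by (rule measurable_const) (simp add: space_prob_algebra Q)
    show "(\<lambda>(x, y). a *\<^sub>R x + U y) \<in> borel \<Otimes>\<^sub>M Q \<rightarrow>\<^sub>M borel" by measurable
  qed
  have "emeasure M {\<omega> \<in> space M. T \<omega> \<in> A \<and> X \<omega> \<in> B} = (\<integral>\<^sup>+y\<in>A. emeasure (distr Q borel (\<lambda>\<omega>. a *\<^sub>R y + U \<omega>)) B \<partial>(distr M borel T))"
    if [measurable]: "A \<in> sets borel" "B \<in> sets borel" for A B
  proof -
    define F where "F = {p :: (real^'d) \<times> (real^'d). fst p \<in> A \<and> a *\<^sub>R fst p + snd p \<in> B}"
    have "F = {p \<in> space (borel \<Otimes>\<^sub>M borel). fst p \<in> A \<and> a *\<^sub>R fst p + snd p \<in> B}"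
      by (simp add: F_def space_pair_measure)
    also have "\<dots> \<in> sets (borel \<Otimes>\<^sub>M borel)" by measurable
    finally have F: "F \<in> sets borel" unfolding borel_prod .
    have "emeasure M {\<omega> \<in> space M. T \<omega> \<in> A \<and> X \<omega> \<in> B} = emeasure ?J F"
      using F by (subst emeasure_distr) (auto simp: F_def intro!: arg_cong[where f="emeasure M"])
    also have "\<dots> = emeasure ?P F" by (simp only: eq)
    also have "\<dots> = (\<integral>\<^sup>+y. emeasure (distr Q borel U) (Pair y -` F) \<partial>distr M borel T)"
      by (rule E.emeasure_pair_measure_alt) (simp only: sP F)
    also have "\<dots> = (\<integral>\<^sup>+y\<in>A. emeasure (distr Q borel (\<lambda>\<omega>. a *\<^sub>R y + U \<omega>)) B \<partial>(distr M borel T))"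
    proof (rule nn_integral_cong)
      fix y
      have "Pair y -` F = (if y \<in> A then {u. a *\<^sub>R y + u \<in> B} else {})" by (auto simp: F_def)
      moreover have "emeasure (distr Q borel U) {u. a *\<^sub>R y + u \<in> B} = emeasure (distr Q borel (\<lambda>\<omega>. a *\<^sub>R y + U \<omega>)) B"
        by (subst (1 2) emeasure_distr) (auto simp: vimage_def)
      ultimately show "emeasure (distr Q borel U) (Pair y -` F) = emeasure (distr Q borel (\<lambda>\<omega>. a *\<^sub>R y + U \<omega>)) B * indicator A y"
        by auto
    qed
    finally show ?thesis .
  qed
  with k show ?thesis by (simp add: conditional_distribution_def)
qed

section \<open>Existence of infinitely divisible distributions\<close>

lemma indep_vars_PiM_coordinates:
  assumes "\<And>i. prob_space (M i)"
  shows "prob_space.indep_vars (PiM UNIV M) M (\<lambda>i \<omega>. \<omega> i) (UNIV :: 'i set)"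
proof -
  interpret prob_space "PiM UNIV M" by (rule prob_space_PiM) (rule assms)
  have "distr (PiM UNIV M) (PiM UNIV M) (\<lambda>x. \<lambda>i\<in>UNIV. x i) = PiM UNIV M"
    by (simp add: restrict_UNIV distr_id2)
  also have "\<dots> = PiM UNIV (\<lambda>i. distr (PiM UNIV M) (M i) (\<lambda>\<omega>. \<omega> i))"
    by (simp add: distr_PiM_component assms)
  finally show ?thesis
    by (subst indep_vars_iff_distr_eq_PiM') auto
qed

lemma integral_PiM_prod:
  fixes h :: "'i \<Rightarrow> 'b \<Rightarrow> complex"
  assumes M: "\<And>i. prob_space (M i)" and h[measurable]: "\<And>i. h i \<in> borel_measurable (M i)"
    and b: "\<And>i x. norm (h i x) \<le> 1" and J: "finite J"
  shows "(CLINT \<omega>|PiM UNIV M. \<Prod>i\<in>J. h i (\<omega> i)) = (\<Prod>i\<in>J. CLINT x|M i. h i x)"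
proof -
  interpret prob_space "PiM UNIV M" by (rule prob_space_PiM) (rule M)
  have "indep_vars (\<lambda>_. borel) (\<lambda>i \<omega>. h i (\<omega> i)) J"
    by (rule indep_vars_compose2[where Y=h and M'=M and X="\<lambda>i \<omega>. \<omega> i"])
      (auto intro: indep_vars_subset[OF indep_vars_PiM_coordinates[OF M]])
  then have "(CLINT \<omega>|PiM UNIV M. \<Prod>i\<in>J. h i (\<omega> i)) = (\<Prod>i\<in>J. CLINT \<omega>|PiM UNIV M. h i (\<omega> i))"
    by (intro indep_vars_lebesgue_integral J) (auto intro!: integrable_const_bound[where B=1] b)
  also have "\<dots> = (\<Prod>i\<in>J. CLINT x|distr (PiM UNIV M) (M i) (\<lambda>\<omega>. \<omega> i). h i x)"
    by (intro prod.cong refl integral_distr[symmetric]) auto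
  finally show ?thesis by (simp add: distr_PiM_component M)
qed

text \<open>Splitting along the values of \<open>N\<close> gives c exp(-m) times the exponential
  series of m \<phi>. The factor \<open>c\<close> carries along variables independent of the random
  sum: it is 1 for a compound Poisson law, and later the product of the characteristic functions of
  the X_n.\<close>

lemma poisson_mixture:
  fixes F :: "'q \<Rightarrow> complex"
  assumes Q: "prob_space Q" and [measurable]: "N \<in> measurable Q (count_space UNIV)"
    and dN: "distr Q (count_space UNIV) N = measure_pmf (poisson_pmf m)" and m: "0 < m"
    and [measurable]: "F \<in> borel_measurable Q" and F1: "\<And>\<omega>. norm (F \<omega>) \<le> 1"
    and F: "\<And>n. (CLINT \<omega>|Q. indicator {n} (N \<omega>) * F \<omega>) = c * complex_of_real (pmf (poisson_pmf m) n) * \<phi> ^ n"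
  shows "(CLINT \<omega>|Q. F \<omega>) = c * exp (m * (\<phi> - 1))"
proof -
  interpret prob_space Q by fact
  let ?f = "\<lambda>n \<omega>. indicator {n} (N \<omega>) * F \<omega>"
  have int: "complex_integrable Q (?f n)" for n
    by (rule integrable_const_bound[where B=1]) (auto simp: indicator_def F1)
  have "?f n \<omega> = (if n = N \<omega> then F \<omega> else 0)" for n \<omega> by (simp add: indicator_def)
  then have sm: "(\<lambda>n. ?f n \<omega>) sums F \<omega>" for \<omega>
    using sums_single[of "N \<omega>" "\<lambda>_. F \<omega>"] by simp
  \<comment> \<open>The Poisson probabilities dominate the terms, which justifies exchanging sum and
    expectation.\<close>
  have "norm (\<integral>\<omega>. norm (?f n \<omega>) \<partial>Q) \<le> pmf (poisson_pmf m) n" for n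
  proof -
    have "(\<integral>\<omega>. norm (?f n \<omega>) \<partial>Q) \<le> (\<integral>\<omega>. indicator {\<omega>\<in>space Q. N \<omega> = n} \<omega> \<partial>Q)"
    proof (rule integral_mono)
      show "integrable Q (indicat_real {\<omega>\<in>space Q. N \<omega> = n})"
        by (intro integrable_real_indicator) (auto simp: emeasure_eq_measure)
      show "integrable Q (\<lambda>\<omega>. norm (?f n \<omega>))" using int by (rule integrable_norm)
      show "norm (?f n \<omega>) \<le> indicat_real {\<omega>\<in>space Q. N \<omega> = n} \<omega>" if "\<omega> \<in> space Q" for \<omega>
        using that F1[of \<omega>] by (cases "N \<omega> = n") auto
    qed
    also have "\<dots> = prob {\<omega>\<in>space Q. N \<omega> = n}" by simp
    also have "\<dots> = measure (distr Q (count_space UNIV) N) {n}"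
    proof -
      have "N -` {n} \<inter> space Q = {\<omega>\<in>space Q. N \<omega> = n}" by auto
      then show ?thesis by (simp add: measure_distr)
    qed
    also have "\<dots> = pmf (poisson_pmf m) n" by (simp add: dN measure_pmf_single)
    finally show ?thesis by (simp add: integral_nonneg_AE)
  qed
  moreover have "summable (\<lambda>n. pmf (poisson_pmf m) n)"
    using summable_mult2[OF summable_exp[of m], of "exp (- m)"] m by (simp add: field_simps)
  ultimately have sI: "summable (\<lambda>n. \<integral>\<omega>. norm (?f n \<omega>) \<partial>Q)"
    by (rule summable_comparison_test'[where N=0, rotated])
  have "(CLINT \<omega>|Q. F \<omega>) = (CLINT \<omega>|Q. (\<Sum>n. ?f n \<omega>))"
    using sm by (intro Bochner_Integration.integral_cong refl) (simp add: sums_iff)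
  also have "\<dots> = (\<Sum>n. CLINT \<omega>|Q. ?f n \<omega>)"
  proof (rule integral_suminf[OF int _ sI])
    show "AE \<omega> in Q. summable (\<lambda>n. norm (?f n \<omega>))"
    proof (intro always_eventually allI)
      show "summable (\<lambda>n. norm (?f n \<omega>))" for \<omega>
        by (rule summable_finite[of "{N \<omega>}"]) auto
    qed
  qed
  also have "\<dots> = (\<Sum>n. c * exp (- complex_of_real m) * ((m * \<phi>) ^ n /\<^sub>R fact n))"
    unfolding F using m by (simp add: exp_of_real[symmetric] scaleR_conv_of_real power_mult_distrib field_simps)
  also have "\<dots> = c * exp (- complex_of_real m) * exp (m * \<phi>)"
    by (rule sums_unique[OF sums_mult[OF exp_converges], symmetric])
  also have "\<dots> = c * exp (m * (\<phi> - 1))"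
    by (simp add: right_diff_distrib exp_diff exp_minus divide_inverse)
  finally show ?thesis .
qed

text \<open>The sum of a Poisson number, with mean the total mass m, of independent variables with
  law L / m: then m (\<phi> - 1) is the integral of \<open>iexp (z \<bullet> x) - 1\<close> against
  L. The null measure is represented by the point mass at 0.\<close>

lemma exists_compound_poisson:
  fixes L :: "'a::euclidean_space measure"
  assumes L: "finite_measure L" and s[measurable_cong]: "sets L = sets borel"
  shows "\<exists>\<mu>. prob_space \<mu> \<and> sets \<mu> = sets borel \<and>
    (\<forall>z. (CLINT x|\<mu>. iexp (z \<bullet> x)) = exp (CLINT x|L. iexp (z \<bullet> x) - 1))"
proof (cases "measure L (space L) = 0")
  case True
  interpret finite_measure L by fact
  have "emeasure L (space L) = 0" using True by (simp add: emeasure_eq_measure)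
  then have "AE x in L. iexp (z \<bullet> x) - 1 = 0" for z
    by (intro AE_I[of _ _ "space L"]) auto
  then have "(CLINT x|L. iexp (z \<bullet> x) - 1) = 0" for z
    by (rule integral_eq_zero_AE)
  then show ?thesis
    by (intro exI[of _ "return borel 0"]) (auto simp: integral_return prob_space_return)
next
  case False
  interpret finite_measure L by fact
  define m where "m = measure L (space L)"
  have m: "0 < m" using False by (simp add: m_def zero_less_measure_iff)
  define P where "P = density L (\<lambda>_. ennreal (1 / m))"
  have sP[measurable_cong]: "sets P = sets borel" by (simp add: P_def s)
  have "emeasure P (space P) = 1"
    using m by (simp add: P_def emeasure_density nn_integral_cmult emeasure_eq_measure ennreal_mult'[symmetric]) (simp add: m_def)
  then have P: "prob_space P" by (rule prob_spaceI)
  define Q where "Q = measure_pmf (poisson_pmf m) \<Otimes>\<^sub>M PiM UNIV (\<lambda>_::nat. P)"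
  interpret P: prob_space P by fact
  interpret PP: prob_space "PiM UNIV (\<lambda>_::nat. P)" by (rule prob_space_PiM) (rule P)
  interpret Q: pair_prob_space "measure_pmf (poisson_pmf m)" "PiM UNIV (\<lambda>_::nat. P)" ..
  define S :: "nat \<times> (nat \<Rightarrow> 'a) \<Rightarrow> 'a" where "S = (\<lambda>(n, \<omega>). \<Sum>j<n. \<omega> j)"
  have [measurable]: "fst \<in> measurable Q (count_space UNIV)" unfolding Q_def
    by (rule measurable_compose[OF measurable_fst]) simp
  have [measurable]: "S \<in> borel_measurable Q"
  proof -
    have "S = (\<lambda>q. (\<lambda>n q. \<Sum>j<n. snd q j) (fst q) q)" by (auto simp: S_def)
    also have "\<dots> \<in> borel_measurable Q"
      by (rule measurable_compose_countable) (simp_all add: Q_def)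
    finally show ?thesis .
  qed
  have [measurable]: "(\<lambda>q. snd q j) \<in> borel_measurable Q" for j
    by (simp add: Q_def)
  define \<phi> where "\<phi> z = (CLINT x|P. iexp (z \<bullet> x))" for z :: 'a
  have Qp: "prob_space Q" unfolding Q_def by (rule Q.prob_space_axioms)
  interpret QQ: prob_space Q by fact
  have "(CLINT x|distr Q borel S. iexp (z \<bullet> x)) = exp (CLINT x|L. iexp (z \<bullet> x) - 1)" for z
  proof -
    have "(CLINT q|Q. iexp (z \<bullet> S q)) = 1 * exp (m * (\<phi> z - 1))"
    proof (rule poisson_mixture[where N=fst, OF Qp])
      show "distr Q (count_space UNIV) fst = measure_pmf (poisson_pmf m)"
      proof -
        have "distr Q (count_space UNIV) fst = distr Q (measure_pmf (poisson_pmf m)) fst"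
          by (intro distr_cong) auto
        also have "\<dots> = measure_pmf (poisson_pmf m)" unfolding Q_def
          by (rule PP.distr_pair_fst)
        finally show ?thesis .
      qed
      fix n
      have "(CLINT q|Q. indicator {n} (fst q) * iexp (z \<bullet> S q)) = (CLINT q|Q. indicator {n} (fst q) * (\<Prod>j<n. iexp (z \<bullet> snd q j)))"
        by (intro Bochner_Integration.integral_cong refl)
          (auto simp: indicator_def S_def inner_sum_right sum_distrib_left exp_sum split: prod.splits)
      also have "\<dots> = (CLINT k|measure_pmf (poisson_pmf m). CLINT \<omega>|PiM UNIV (\<lambda>_. P). indicator {n} k * (\<Prod>j<n. iexp (z \<bullet> \<omega> j)))"
      proof -
        define f where "f q = indicator {n} (fst q) * (\<Prod>j<n. iexp (z \<bullet> snd q j))" for q :: "nat \<times> (nat \<Rightarrow> 'a)"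
        have "norm (f q) \<le> 1" for q
          by (cases "fst q = n") (simp_all add: f_def norm_mult flip: prod_norm)
        moreover have "f \<in> borel_measurable Q"
        proof -
          have "(\<lambda>q. iexp (z \<bullet> snd q j)) \<in> borel_measurable Q" for j
            by (rule measurable_compose[of "\<lambda>q. snd q j" _ borel]) measurable
          moreover have "(\<lambda>q. indicator {n} (fst q) :: complex) \<in> borel_measurable Q"
            by (rule measurable_compose[of fst Q "count_space UNIV"]) simp_all
          ultimately show ?thesis unfolding f_def
            by (intro borel_measurable_times borel_measurable_prod)
        qed
        ultimately have "complex_integrable Q f"
          by (intro QQ.integrable_const_bound[where B=1]) auto
        from Q.integral_fst'[OF this[unfolded Q_def]] show ?thesis
          unfolding f_def Q_def fst_conv snd_conv by (rule sym)
      qed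
      also have "\<dots> = (CLINT k|measure_pmf (poisson_pmf m). indicator {n} k * \<phi> z ^ n)"
        using integral_PiM_prod[of "\<lambda>_. P" "\<lambda>_ x. iexp (z \<bullet> x)" "{..<n}"] P by (simp add: \<phi>_def)
      also have "\<dots> = (CLINT k|measure_pmf (poisson_pmf m). complex_of_real (indicator {n} k)) * \<phi> z ^ n"
        by (simp add: of_real_indicator)
      also have "\<dots> = complex_of_real (pmf (poisson_pmf m) n) * \<phi> z ^ n"
        unfolding integral_complex_of_real by (simp add: measure_pmf_single)
      finally show "(CLINT q|Q. indicator {n} (fst q) * iexp (z \<bullet> S q)) = 1 * complex_of_real (pmf (poisson_pmf m) n) * \<phi> z ^ n"
        by simp
    qed (use m in auto)
    moreover have "m * (\<phi> z - 1) = (CLINT x|L. iexp (z \<bullet> x) - 1)"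
    proof -
      have i: "complex_integrable L (\<lambda>x. iexp (z \<bullet> x))"
        by (rule integrable_const_bound[where B=1]) auto
      have "\<phi> z = (CLINT x|L. iexp (z \<bullet> x)) / m"
        unfolding \<phi>_def P_def using m
        by (subst integral_density) (auto simp: scaleR_conv_of_real)
      then show ?thesis using i m
        by (simp add: field_simps) (simp add: m_def scaleR_conv_of_real)
    qed
    ultimately show ?thesis by (simp add: integral_distr)
  qed
  then show ?thesis
    by (intro exI[of _ "distr Q borel S"]) (auto intro: QQ.prob_space_distr)
qed

section \<open>The compensated kernel and its integrability weight\<close>

text \<open>The Levy-Khintchine integrand for a constant truncation function. The type is any
  Euclidean space because the kernel is also used on the real line, for the radial variable.\<close>

definition ID_kernel :: "real \<Rightarrow> 'a::euclidean_space \<Rightarrow> 'a \<Rightarrow> complex" where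
  "ID_kernel c z x = iexp (z \<bullet> x) - 1 - \<i> * complex_of_real (c * (z \<bullet> x))"

text \<open>The order of the kernel at 0 and at infinity: linear and bounded for c = 0, quadratic
  and linear for c = 1.\<close>

definition levy_weight :: "real \<Rightarrow> 'a::euclidean_space \<Rightarrow> real" where
  "levy_weight c x = (if c = 0 then min (norm x) 1 else min ((norm x)\<^sup>2) (norm x))"

lemma levy_weight_nonneg [simp]: "0 \<le> levy_weight c x"
  by (simp add: levy_weight_def)

lemma levy_weight_pos: "x \<noteq> 0 \<Longrightarrow> 0 < levy_weight c x"
  by (simp add: levy_weight_def)

lemma borel_measurable_levy_weight [measurable]: "levy_weight c \<in> borel_measurable borel"
  unfolding levy_weight_def by measurable

lemma borel_measurable_ID_kernel [measurable]: "ID_kernel c z \<in> borel_measurable borel"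
  unfolding ID_kernel_def by measurable

text \<open>Taylor bounds: |exp(iy) - 1| \<le> min(|y|, 2) and |exp(iy) - 1 - iy| \<le> min(y^2,
  2|y|). With |z| \<le> 1 + |z|^2 both values of c get the same quadratic growth in z, the form that
  \<open>char_tail_bound\<close> averages against a Gaussian.\<close>

lemma norm_ID_kernel_le:
  fixes z x :: "'a::euclidean_space"
  assumes "c = 0 \<or> c = 1"
  shows "norm (ID_kernel c z x) \<le> 2 * (1 + (norm z)\<^sup>2) * levy_weight c x"
proof -
  have zx: "\<bar>z \<bullet> x\<bar> \<le> norm z * norm x" by (rule Cauchy_Schwarz_ineq2)
  have z1: "norm z \<le> 1 + (norm z)\<^sup>2"
    using zero_le_power2[of "norm z - 1/2"] by (simp add: power2_eq_square field_simps)
  show ?thesis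
  proof (cases "c = 0")
    case True
    have 1: "norm (ID_kernel c z x) \<le> \<bar>z \<bullet> x\<bar>"
      using iexp_approx1[of "z \<bullet> x" 0] True by (simp add: ID_kernel_def)
    have 2: "norm (ID_kernel c z x) \<le> 2"
      using iexp_approx2[of "z \<bullet> x" 0] True by (simp add: ID_kernel_def)
    have "norm (ID_kernel c z x) \<le> (1 + (norm z)\<^sup>2) * norm x"
      using 1 zx mult_right_mono[OF z1, of "norm x"] by simp
    moreover define A where "A = 1 + (norm z)\<^sup>2"
    ultimately have 3: "norm (ID_kernel c z x) \<le> A * norm x" by simp
    have A: "1 \<le> A" by (simp add: A_def)
    have "A * norm x \<le> 2 * A * norm x" using A by simp
    with 3 have 3: "norm (ID_kernel c z x) \<le> 2 * A * norm x" by linarith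
    have "norm (ID_kernel c z x) \<le> 2 * A * levy_weight c x"
      using 2 3 A True by (cases "norm x \<le> 1") (simp_all add: levy_weight_def)
    then show ?thesis by (simp add: A_def)
  next
    case False
    with assms have c: "c = 1" by simp
    have 1: "norm (ID_kernel c z x) \<le> (z \<bullet> x)\<^sup>2"
    proof -
      have "2 * norm (ID_kernel c z x) \<le> (z \<bullet> x)\<^sup>2"
        using iexp_approx1[of "z \<bullet> x" 1] c by (simp add: ID_kernel_def power2_eq_square algebra_simps)
      moreover have "0 \<le> (z \<bullet> x)\<^sup>2" by simp
      ultimately show ?thesis by linarith
    qed
    have 2: "norm (ID_kernel c z x) \<le> 2 * \<bar>z \<bullet> x\<bar>"
      using iexp_approx2[of "z \<bullet> x" 1] c by (simp add: ID_kernel_def algebra_simps)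
    have "(z \<bullet> x)\<^sup>2 \<le> (norm z * norm x)\<^sup>2"
      using power_mono[OF zx, of 2] by simp
    also have "\<dots> \<le> (1 + (norm z)\<^sup>2) * (norm x)\<^sup>2"
      by (simp add: power_mult_distrib mult_right_mono)
    finally have 3: "norm (ID_kernel c z x) \<le> (1 + (norm z)\<^sup>2) * (norm x)\<^sup>2" using 1 by linarith
    have 4: "norm (ID_kernel c z x) \<le> 2 * ((1 + (norm z)\<^sup>2) * norm x)"
      using 2 zx mult_right_mono[OF z1, of "norm x"] by simp
    have 5: "0 \<le> (1 + (norm z)\<^sup>2) * (norm x)\<^sup>2" by simp
    show ?thesis
    proof (cases "(norm x)\<^sup>2 \<le> norm x")
      case True
      then have "levy_weight c x = (norm x)\<^sup>2" using c by (simp add: levy_weight_def)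
      moreover have "norm (ID_kernel c z x) \<le> 2 * ((1 + (norm z)\<^sup>2) * (norm x)\<^sup>2)" using 3 5 by linarith
      ultimately show ?thesis by (simp only: mult.assoc)
    next
      case False
      then have "levy_weight c x = norm x" using c by (simp add: levy_weight_def)
      then show ?thesis using 4 by (simp only: mult.assoc)
    qed
  qed
qed

lemma integrable_levy_weight_bound:
  fixes f :: "'a::euclidean_space \<Rightarrow> 'b::{banach, second_countable_topology}"
  assumes [measurable_cong]: "sets L = sets borel" and w: "(\<integral>\<^sup>+x. ennreal (levy_weight c x) \<partial>L) < \<infinity>"
    and [measurable]: "f \<in> borel_measurable borel" and b: "\<And>x. norm (f x) \<le> K * levy_weight c x"
  shows "integrable L f"
proof -
  have "integrable L (\<lambda>x. K * levy_weight c x)"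
    using w by (intro integrable_mult_right integrableI_bounded) auto
  then show ?thesis
  proof (rule Bochner_Integration.integrable_bound)
    show "AE x in L. norm (f x) \<le> norm (K * levy_weight c x)"
      by (intro always_eventually allI order_trans[OF b]) simp
  qed simp
qed

text \<open>A compound Poisson law translated by -c times the first moment of L, which adds the
  compensating term to the exponent. For c = 1 that moment exists, since the norm is at most 1 plus
  the weight and L is finite.\<close>

lemma exists_ID_finite:
  fixes L :: "'a::euclidean_space measure"
  assumes L: "finite_measure L" and s[measurable_cong]: "sets L = sets borel"
    and w: "(\<integral>\<^sup>+x. ennreal (levy_weight c x) \<partial>L) < \<infinity>" and c: "c = 0 \<or> c = 1"
  shows "\<exists>\<mu>. prob_space \<mu> \<and> sets \<mu> = sets borel \<and>
    (\<forall>z. (CLINT x|\<mu>. iexp (z \<bullet> x)) = exp (CLINT x|L. ID_kernel c z x))"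
proof -
  interpret finite_measure L by fact
  obtain \<mu> where \<mu>: "prob_space \<mu>" and s\<mu>[measurable_cong]: "sets \<mu> = sets borel"
    and ch: "\<And>z. (CLINT x|\<mu>. iexp (z \<bullet> x)) = exp (CLINT x|L. iexp (z \<bullet> x) - 1)"
    using exists_compound_poisson[OF L s] by blast
  interpret \<mu>: prob_space \<mu> by fact
  define v where "v = c *\<^sub>R (\<integral>x. x \<partial>L)"
  define \<nu> where "\<nu> = distr \<mu> borel (\<lambda>x. x - v)"
  have ie: "complex_integrable L (\<lambda>x. iexp (z \<bullet> x) - 1)" for z
    by (intro Bochner_Integration.integrable_diff integrable_const_bound[where B=1]) auto
  have zv: "complex_integrable L (\<lambda>x. \<i> * complex_of_real (c * (z \<bullet> x))) \<and>
     (CLINT x|L. \<i> * complex_of_real (c * (z \<bullet> x))) = \<i> * (z \<bullet> v)" for z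
  proof (cases "c = 0")
    case False
    with c have c1: "c = 1" by simp
    have "integrable L (\<lambda>x. levy_weight c x)"
      using w by (intro integrableI_bounded) auto
    then have "integrable L (\<lambda>x. 1 + levy_weight c x)" by simp
    moreover have "norm x \<le> 1 + (norm x)\<^sup>2" for x :: 'a
      using zero_le_power2[of "norm x - 1/2"] by (simp add: power2_eq_square field_simps)
    ultimately have i: "integrable L (\<lambda>x. x)"
      by (intro Bochner_Integration.integrable_bound[of L "\<lambda>x. 1 + levy_weight c x" "\<lambda>x. x"])
        (auto simp: c1 levy_weight_def min_def)
    then show ?thesis by (simp add: c1 v_def)
  qed (simp add: v_def)
  have "(CLINT x|\<nu>. iexp (z \<bullet> x)) = exp (CLINT x|L. ID_kernel c z x)" for z
  proof -
    have "(CLINT x|\<nu>. iexp (z \<bullet> x)) = (CLINT x|\<mu>. iexp (z \<bullet> x) * iexp (- (z \<bullet> v)))"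
    proof -
      have "iexp (z \<bullet> (x - v)) = iexp (z \<bullet> x) * iexp (- (z \<bullet> v))" for x
        by (simp add: inner_diff_right right_diff_distrib exp_diff exp_minus divide_inverse)
      then show ?thesis by (simp add: \<nu>_def integral_distr)
    qed
    also have "\<dots> = exp (CLINT x|L. iexp (z \<bullet> x) - 1) * iexp (- (z \<bullet> v))"
      by (simp only: ch integral_mult_left_zero)
    also have "\<dots> = exp ((CLINT x|L. iexp (z \<bullet> x) - 1) - \<i> * (z \<bullet> v))"
      by (simp add: exp_diff exp_minus divide_inverse)
    also have "(CLINT x|L. iexp (z \<bullet> x) - 1) - \<i> * (z \<bullet> v) = (CLINT x|L. ID_kernel c z x)"

      by (simp only: ID_kernel_def Bochner_Integration.integral_diff[OF ie conjunct1[OF zv]] zv)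
    finally show ?thesis .
  qed
  then show ?thesis
    by (intro exI[of _ \<nu>]) (auto simp: \<nu>_def intro: \<mu>.prob_space_distr)
qed

section \<open>Tail estimates from characteristic functions\<close>

text \<open>Turns a small Levy exponent into a characteristic function close to 1. For |w| \<le> 1
  the factor e of the Taylor estimate is rounded up to 3; for larger w already 2 < 3 |w|.\<close>

lemma one_minus_exp_le:
  fixes w :: complex
  assumes "norm (exp w) \<le> 1"
  shows "norm (1 - exp w) \<le> 3 * norm w"
proof (cases "norm w \<le> 1")
  case True
  have "norm (exp w - (\<Sum>i\<le>0. w ^ i / fact i)) \<le> exp (norm w) * (norm w ^ Suc 0) / fact 0"
    by (rule Taylor_exp_field)
  then have "norm (1 - exp w) \<le> exp (norm w) * norm w" by (simp add: norm_minus_commute)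
  also have "\<dots> \<le> exp 1 * norm w" using True by (intro mult_right_mono) auto
  also have "\<dots> \<le> 3 * norm w" by (intro mult_right_mono exp_le) auto
  finally show ?thesis .
next
  case False
  have "norm (1 - exp w) \<le> 1 + norm (exp w)" using norm_triangle_ineq4[of 1 "exp w"] by simp
  with assms False show ?thesis by linarith
qed

text \<open>The Gaussian average of \<open>1 - cos (r u)\<close> over the frequency \<open>u\<close> is \<open>1 - exp (-r\<^sup>2/2)\<close>, which is
  bounded below once \<open>\<bar>r\<bar> \<ge> 1\<close>.\<close>

lemma char_tail_bound:
  fixes \<mu> :: "'a::euclidean_space measure"
  assumes \<mu>: "prob_space \<mu>" and s[measurable_cong]: "sets \<mu> = sets borel"
    and ch: "\<And>z. norm (1 - (CLINT x|\<mu>. iexp (z \<bullet> x))) \<le> K * (1 + (norm z)\<^sup>2)"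
    and e: "norm e = 1" and d: "0 < d"
  shows "measure \<mu> {x. d \<le> \<bar>x \<bullet> e\<bar>} \<le> 3 * K * (1 + 1 / d\<^sup>2)"
proof -
  interpret \<mu>: prob_space \<mu> by fact
  interpret N: real_distribution std_normal_distribution by (rule real_dist_normal_dist)
  interpret P: pair_prob_space \<mu> std_normal_distribution ..
  define r where "r x = (x \<bullet> e) / d" for x
  have [measurable]: "r \<in> borel_measurable borel" unfolding r_def by measurable
  have spm: "space \<mu> = UNIV" using sets_eq_imp_space_eq[OF s] by simp
  define f where "f q = 1 - cos (snd q * r (fst q))" for q
  have f2: "\<bar>f q\<bar> \<le> 2" for q using cos_ge_minus_one[of "snd q * r (fst q)"] cos_le_one[of "snd q * r (fst q)"]
    unfolding f_def by linarith
  have "f \<in> borel_measurable (borel \<Otimes>\<^sub>M borel)" unfolding f_def by measurable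
  moreover have "sets (\<mu> \<Otimes>\<^sub>M std_normal_distribution) = sets (borel \<Otimes>\<^sub>M borel)"
    by (intro sets_pair_measure_cong) (simp_all add: s)
  ultimately have [measurable]: "f \<in> borel_measurable (\<mu> \<Otimes>\<^sub>M std_normal_distribution)"
    by (simp cong: measurable_cong_sets)
  have fi: "integrable (\<mu> \<Otimes>\<^sub>M std_normal_distribution) f"
    by (rule P.integrable_const_bound[where B=2]) (use f2 in auto)
  have inner1: "(\<integral>u. f (x, u) \<partial>std_normal_distribution) = 1 - exp (- (r x)\<^sup>2 / 2)" for x
  proof -
    have ii: "complex_integrable std_normal_distribution (\<lambda>u. iexp (r x * u))"
      by (rule N.integrable_iexp) auto
    have "(\<integral>u. cos (u * r x) \<partial>std_normal_distribution) = (\<integral>u. Re (iexp (r x * u)) \<partial>std_normal_distribution)"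
      by (intro Bochner_Integration.integral_cong refl) (simp add: Re_exp mult.commute)
    also have "\<dots> = Re (char std_normal_distribution (r x))"
      unfolding char_def by (rule integral_Re[OF ii])
    finally have "(\<integral>u. cos (u * r x) \<partial>std_normal_distribution) = exp (- (r x)\<^sup>2 / 2)"
      by (simp add: char_std_normal_distribution)
    moreover have "integrable std_normal_distribution (\<lambda>u. cos (u * r x))"
      by (rule N.integrable_const_bound[where B=1]) auto
    ultimately show ?thesis using N.prob_space by (simp add: f_def)
  qed
  \<comment> \<open>The hypothesis is used at the frequency (u / d) e, whose inner product with x is
    u times \<open>r x\<close>.\<close>
  have inner2: "(\<integral>x. f (x, u) \<partial>\<mu>) \<le> K * (1 + u\<^sup>2 / d\<^sup>2)" for u
  proof -
    have ii: "complex_integrable \<mu> (\<lambda>x. iexp (((u / d) *\<^sub>R e) \<bullet> x))"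
      by (rule \<mu>.integrable_const_bound[where B=1]) auto
    have "(\<integral>x. f (x, u) \<partial>\<mu>) = (\<integral>x. Re (1 - iexp (((u / d) *\<^sub>R e) \<bullet> x)) \<partial>\<mu>)"
      by (intro Bochner_Integration.integral_cong refl) (simp add: f_def r_def Re_exp inner_commute)
    also have "\<dots> = Re (1 - (CLINT x|\<mu>. iexp (((u / d) *\<^sub>R e) \<bullet> x)))"
      using ii \<mu>.prob_space by (subst integral_Re) auto
    also have "\<dots> \<le> norm (1 - (CLINT x|\<mu>. iexp (((u / d) *\<^sub>R e) \<bullet> x)))" by (rule complex_Re_le_cmod)
    also have "\<dots> \<le> K * (1 + (norm ((u / d) *\<^sub>R e))\<^sup>2)" by (rule ch)
    finally show ?thesis by (simp add: e power_divide)
  qed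
  have "measure \<mu> {x. d \<le> \<bar>x \<bullet> e\<bar>} / 3 = (\<integral>x. indicator {x. d \<le> \<bar>x \<bullet> e\<bar>} x / 3 \<partial>\<mu>)"
    by simp
  also have "\<dots> \<le> (\<integral>x. 1 - exp (- (r x)\<^sup>2 / 2) \<partial>\<mu>)"
  proof (rule integral_mono)
    show "integrable \<mu> (\<lambda>x. indicator {x. d \<le> \<bar>x \<bullet> e\<bar>} x / (3::real))"
      by (rule \<mu>.integrable_const_bound[where B=1]) (auto simp: indicator_def)
    show "integrable \<mu> (\<lambda>x. 1 - exp (- (r x)\<^sup>2 / 2))"
      by (rule \<mu>.integrable_const_bound[where B=1]) auto
    show "indicator {x. d \<le> \<bar>x \<bullet> e\<bar>} x / 3 \<le> 1 - exp (- (r x)\<^sup>2 / 2)" for x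
    proof (cases "d \<le> \<bar>x \<bullet> e\<bar>")
      case True
      then have "1 \<le> \<bar>r x\<bar>" using d by (simp add: r_def)
      then have "1 \<le> (r x)\<^sup>2" by (metis one_le_power power2_abs)
      \<comment> \<open>Since exp(-1/2) \<le> 2/3, at least 1/3 of the indicator is recovered; this
        is the origin of the factor 3.\<close>
      then have "exp (- (r x)\<^sup>2 / 2) \<le> exp (- (1 / 2))" by simp
      also have "\<dots> \<le> 1 / (1 + 1 / 2)"
        using exp_ge_add_one_self[of "1/2"] by (simp add: exp_minus field_simps)
      finally show ?thesis using True by simp
    qed simp
  qed
  also have "\<dots> = (\<integral>x. (\<integral>u. f (x, u) \<partial>std_normal_distribution) \<partial>\<mu>)" by (simp add: inner1)
  also have "\<dots> = (\<integral>u. (\<integral>x. f (x, u) \<partial>\<mu>) \<partial>std_normal_distribution)"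
    using P.Fubini_integral[of "\<lambda>x u. f (x, u)"] fi by simp
  also have "\<dots> \<le> (\<integral>u. K * (1 + u\<^sup>2 / d\<^sup>2) \<partial>std_normal_distribution)"
  proof (rule integral_mono[OF _ _ inner2])
    show "integrable std_normal_distribution (\<lambda>u. \<integral>x. f (x, u) \<partial>\<mu>)"
      using P.integrable_snd[of "\<lambda>x u. f (x, u)"] fi by simp
    show "integrable std_normal_distribution (\<lambda>u. K * (1 + u\<^sup>2 / d\<^sup>2))"
      using integrable_std_normal_distribution_moment[of 2] by simp
  qed
  \<comment> \<open>The second moment of the standard normal law is 1.\<close>
  also have "\<dots> = K * (1 + 1 / d\<^sup>2)"
    using integrable_std_normal_distribution_moment[of 2] std_normal_distribution_even_moments(1)[of 1] N.prob_space
    by (simp add: fact_numeral)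
  finally have "measure \<mu> {x. d \<le> \<bar>x \<bullet> e\<bar>} \<le> K * (1 + 1 / d\<^sup>2) * 3" by simp
  then show ?thesis by (simp only: mult.assoc mult.commute mult.left_commute)
qed

section \<open>Cutting a Levy measure into finite pieces\<close>

text \<open>Dominated convergence: the sets where the weight is below 1 / (n + 1) shrink to its zero
  set, where the integrand vanishes.\<close>

lemma ex_small_levy_weight:
  fixes L :: "'a::euclidean_space measure"
  assumes s[measurable_cong]: "sets L = sets borel" and w: "(\<integral>\<^sup>+x. ennreal (levy_weight c x) \<partial>L) < \<infinity>" and d: "0 < d"
  shows "\<exists>e>0. (\<integral>x. indicator {x. levy_weight c x < e} x * levy_weight c x \<partial>L) \<le> d"
proof -
  have iw: "integrable L (levy_weight c)" using w by (intro integrableI_bounded) auto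
  let ?g = "\<lambda>n x. indicator {x. levy_weight c x < 1 / real (Suc n)} x * levy_weight c x"
  have "(\<lambda>n. \<integral>x. ?g n x \<partial>L) \<longlonglongrightarrow> (\<integral>x. 0 \<partial>L)"
  proof (rule integral_dominated_convergence[OF _ _ iw])
    show "AE x in L. (\<lambda>n. ?g n x) \<longlonglongrightarrow> 0"
    proof (rule always_eventually, intro allI tendsto_eventually)
      fix x
      show "\<forall>\<^sub>F n in sequentially. ?g n x = 0"
      proof (cases "levy_weight c x = 0")
        case False
        then have "0 < levy_weight c x" using levy_weight_nonneg[of c x] by linarith
        then obtain N where N: "1 / real (Suc N) < levy_weight c x" using nat_approx_posE by blast
        have "\<not> levy_weight c x < 1 / real (Suc n)" if "N \<le> n" for n
        proof -
          have "1 / real (Suc n) \<le> 1 / real (Suc N)" using that by (simp add: frac_le)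
          then show ?thesis using N by linarith
        qed
        then show ?thesis unfolding eventually_sequentially by (intro exI[of _ N]) simp
      qed simp
    qed
    show "AE x in L. norm (?g n x) \<le> levy_weight c x" for n
      by (intro always_eventually) (auto simp: indicator_def)
  qed simp_all
  then have "(\<lambda>n. \<integral>x. ?g n x \<partial>L) \<longlonglongrightarrow> 0" by simp
  from order_tendstoD(2)[OF this d] obtain n where "(\<integral>x. ?g n x \<partial>L) < d"
    using eventually_happens by force
  then show ?thesis by (intro exI[of _ "1 / real (Suc n)"]) auto
qed

lemma tendsto_integral_partition:
  fixes f :: "'a \<Rightarrow> 'b::{banach, second_countable_topology}"
  assumes f: "integrable L f" and B[measurable]: "\<And>k::nat. B k \<in> sets L" and dj: "disjoint_family B"
    and f0: "\<And>x. x \<notin> (\<Union>k. B k) \<Longrightarrow> f x = 0"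
  shows "(\<lambda>n. \<Sum>k<n. \<integral>x. indicator (B k) x *\<^sub>R f x \<partial>L) \<longlonglongrightarrow> (\<integral>x. f x \<partial>L)"
proof -
  have int: "integrable L (\<lambda>x. indicator (B k) x *\<^sub>R f x)" for k
    by (rule integrable_mult_indicator[OF B f])
  have eq: "(\<Sum>k<n. indicator (B k) x *\<^sub>R f x) = indicator (\<Union>k<n. B k) x *\<^sub>R f x" for n x
  proof -
    have "indicat_real (\<Union>k<n. B k) x = (\<Sum>k<n. indicator (B k) x)"
      using dj by (intro indicator_UN_disjoint) (auto intro: disjoint_family_on_mono)
    then show ?thesis by (simp add: scaleR_sum_left)
  qed
  have "(\<lambda>n. \<integral>x. indicator (\<Union>k<n. B k) x *\<^sub>R f x \<partial>L) \<longlonglongrightarrow> (\<integral>x. f x \<partial>L)"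
  proof (rule integral_dominated_convergence[OF _ _ integrable_norm[OF f]])
    show "AE x in L. (\<lambda>n. indicator (\<Union>k<n. B k) x *\<^sub>R f x) \<longlonglongrightarrow> f x"
    proof (rule always_eventually, intro allI tendsto_eventually)
      fix x
      show "\<forall>\<^sub>F n in sequentially. indicator (\<Union>k<n. B k) x *\<^sub>R f x = f x"
      proof (cases "x \<in> (\<Union>k. B k)")
        case True
        then obtain k where k: "x \<in> B k" by auto
        then show ?thesis unfolding eventually_sequentially
          by (intro exI[of _ "Suc k"]) (auto simp: indicator_def)
      qed (simp add: f0)
    qed
    show "AE x in L. norm (indicator (\<Union>k<n. B k) x *\<^sub>R f x) \<le> norm (f x)" for n
      by (intro always_eventually) (auto simp: indicator_def)
  qed (use f in auto)
  then show ?thesis by (simp only: eq[symmetric] Bochner_Integration.integral_sum[OF int])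
qed

text \<open>The level sets \<open>A k\<close> of the weight have finite mass by Markov's inequality,
  and their successive differences form the partition. The piece with index \<open>Suc k\<close>
  avoids \<open>A k\<close> and so meets small weights only; the piece with index 0 gets no bound.
  The rate 16^-k survives the loss of a factor 4^k in the tail estimate at distance 2^-k and is
  still summable.\<close>

lemma ex_levy_partition:
  fixes L :: "'a::euclidean_space measure"
  assumes s[measurable_cong]: "sets L = sets borel" and w: "(\<integral>\<^sup>+x. ennreal (levy_weight c x) \<partial>L) < \<infinity>"
  shows "\<exists>B::nat \<Rightarrow> 'a set. (\<forall>k. B k \<in> sets borel) \<and> disjoint_family B \<and> (\<Union>k. B k) = - {0} \<and>
    (\<forall>k. emeasure L (B k) < \<infinity>) \<and> (\<forall>k. (\<integral>x. indicator (B (Suc k)) x * levy_weight c x \<partial>L) \<le> 1 / 16 ^ k)"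
proof -
  have iw: "integrable L (levy_weight c)" using w by (intro integrableI_bounded) auto
  have "\<exists>e. 0 < e \<and> (\<integral>x. indicator {x. levy_weight c x < e} x * levy_weight c x \<partial>L) \<le> 1 / 16 ^ k" for k :: nat
    using ex_small_levy_weight[OF s w, of "1 / 16 ^ k"] by auto
  then obtain e where e: "\<And>k. 0 < e k"
    "\<And>k::nat. (\<integral>x. indicator {x. levy_weight c x < e k} x * levy_weight c x \<partial>L) \<le> 1 / 16 ^ k" by metis
  \<comment> \<open>The bound 1 / (k + 1) drives the thresholds to 0, so the level sets exhaust
    everything but the origin.\<close>
  define e' where "e' k = min (e k) (1 / real (Suc k))" for k
  have e': "0 < e' k" for k using e by (simp add: e'_def)
  define A where "A k = {x::'a. e' k \<le> levy_weight c x}" for k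
  have [measurable]: "A k \<in> sets borel" for k unfolding A_def by measurable
  have "disjointed A k \<in> sets borel" for k
  proof -
    have "range A \<subseteq> sets borel" by auto
    then show ?thesis using sets.range_disjointed_sets[of A borel] by blast
  qed
  moreover have "(\<Union>k. disjointed A k) = - {0}"
  proof -
    have "x \<in> (\<Union>k. A k)" if "x \<noteq> 0" for x
    proof -
      have "0 < levy_weight c x" by (rule levy_weight_pos[OF that])
      then obtain N where N: "1 / real (Suc N) < levy_weight c x" using nat_approx_posE by blast
      then have "x \<in> A N" by (simp add: A_def e'_def min_le_iff_disj)
      then show ?thesis by blast
    qed
    moreover have "0 \<notin> A k" for k using e'[of k] by (simp add: A_def levy_weight_def not_le)
    ultimately show ?thesis unfolding UN_disjointed_eq by auto
  qed
  moreover have fin: "emeasure L (A k) < \<infinity>" for k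
  proof -
    have "emeasure L (A k) = (\<integral>\<^sup>+x. indicator (A k) x \<partial>L)" by simp
    also have "\<dots> \<le> (\<integral>\<^sup>+x. ennreal (1 / e' k) * ennreal (levy_weight c x) \<partial>L)"
      using e'[of k] by (intro nn_integral_mono)
        (auto simp: indicator_def A_def ennreal_mult'[symmetric] field_simps simp flip: ennreal_1 intro!: ennreal_leI)
    also have "\<dots> < \<infinity>" using w by (simp add: nn_integral_cmult ennreal_mult_less_top)
    finally show ?thesis .
  qed
  moreover have "emeasure L (disjointed A k) < \<infinity>" for k
    using emeasure_mono[of "disjointed A k" "A k" L] fin[of k] disjointed_subset[of A k] by (auto simp: s intro: le_less_trans)
  moreover have "(\<integral>x. indicator (disjointed A (Suc k)) x * levy_weight c x \<partial>L) \<le> 1 / 16 ^ k" for k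
  proof -
    have [measurable]: "disjointed A (Suc k) \<in> sets borel" by fact
    have "(\<integral>x. indicator (disjointed A (Suc k)) x * levy_weight c x \<partial>L) \<le>
       (\<integral>x. indicator {x. levy_weight c x < e k} x * levy_weight c x \<partial>L)"
    proof (rule integral_mono)
      show "integrable L (\<lambda>x. indicator (disjointed A (Suc k)) x * levy_weight c x)"
        "integrable L (\<lambda>x. indicator {x. levy_weight c x < e k} x * levy_weight c x)"
        using integrable_mult_indicator[OF _ iw] by simp_all
      fix x
      have "levy_weight c x < e k" if "x \<in> disjointed A (Suc k)"
      proof -
        have "x \<notin> A k" using that by (auto simp: disjointed_def)
        then show ?thesis by (simp add: A_def e'_def)
      qed
      then show "indicator (disjointed A (Suc k)) x * levy_weight c x \<le> indicator {x. levy_weight c x < e k} x * levy_weight c x"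
        by (auto simp: indicator_def)
    qed
    also have "\<dots> \<le> 1 / 16 ^ k" by (rule e)
    finally show ?thesis .
  qed
  ultimately show ?thesis by (intro exI[of _ "disjointed A"]) (auto simp: disjoint_family_disjointed)
qed

text \<open>The Levy measure is cut into finite pieces so small that the associated compensated compound
  Poisson variables are almost surely absolutely summable.\<close>

theorem exists_ID:
  fixes L :: "'a::euclidean_space measure"
  assumes s[measurable_cong]: "sets L = sets borel"
    and w: "(\<integral>\<^sup>+x. ennreal (levy_weight c x) \<partial>L) < \<infinity>" and c: "c = 0 \<or> c = 1"
  shows "\<exists>\<mu>. prob_space \<mu> \<and> sets \<mu> = sets borel \<and>
    (\<forall>z. (CLINT x|\<mu>. iexp (z \<bullet> x)) = exp (CLINT x|L. ID_kernel c z x))"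
proof -
  obtain B :: "nat \<Rightarrow> 'a set" where B[measurable]: "\<And>k. B k \<in> sets borel" and dj: "disjoint_family B"
    and UB: "(\<Union>k. B k) = - {0}" and fin: "\<And>k. emeasure L (B k) < \<infinity>"
    and small: "\<And>k. (\<integral>x. indicator (B (Suc k)) x * levy_weight c x \<partial>L) \<le> 1 / 16 ^ k"
    using ex_levy_partition[OF s w] by blast
  have iw: "integrable L (levy_weight c)" using w by (intro integrableI_bounded) auto
  have ik: "complex_integrable L (ID_kernel c z)" for z
    by (rule integrable_levy_weight_bound[OF s w _ norm_ID_kernel_le[OF c]]) simp
  define Lk where "Lk k = density L (indicator (B k))" for k
  have sLk: "sets (Lk k) = sets borel" for k by (simp add: Lk_def s)
  define \<psi> where "\<psi> k z = (CLINT x|L. indicator (B k) x *\<^sub>R ID_kernel c z x)" for k z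
  have "\<exists>\<mu>. prob_space \<mu> \<and> sets \<mu> = sets borel \<and> (\<forall>z. (CLINT x|\<mu>. iexp (z \<bullet> x)) = exp (\<psi> k z))" for k
  proof -
    have "finite_measure (Lk k)"
      using fin[of k] by (intro finite_measureI) (simp add: Lk_def emeasure_density cong: nn_integral_cong)
    moreover have "(\<integral>\<^sup>+x. ennreal (levy_weight c x) \<partial>Lk k) < \<infinity>"
    proof -
      have "(\<integral>\<^sup>+x. ennreal (levy_weight c x) \<partial>Lk k) \<le> (\<integral>\<^sup>+x. ennreal (levy_weight c x) \<partial>L)"
        unfolding Lk_def by (subst nn_integral_density) (auto intro!: nn_integral_mono simp: indicator_def)
      then show ?thesis using w by (rule le_less_trans)
    qed
    moreover have "(CLINT x|Lk k. ID_kernel c z x) = \<psi> k z" for z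
    proof -
      have "Lk k = density L (\<lambda>x. ennreal (indicator (B k) x))" by (simp add: Lk_def ennreal_indicator)
      then show ?thesis by (simp add: \<psi>_def integral_density)
    qed
    ultimately show ?thesis using exists_ID_finite[OF _ sLk _ c, of k] by simp
  qed
  then obtain \<mu> where \<mu>: "\<And>k. prob_space (\<mu> k)" and s\<mu>[measurable_cong]: "\<And>k. sets (\<mu> k) = sets borel"
    and ch: "\<And>k z. (CLINT x|\<mu> k. iexp (z \<bullet> x)) = exp (\<psi> k z)" by metis
  interpret \<mu>: prob_space "\<mu> k" for k by (rule \<mu>)
  define \<Omega> where "\<Omega> = PiM UNIV \<mu>"
  interpret \<Omega>: prob_space \<Omega> unfolding \<Omega>_def by (rule prob_space_PiM) (rule \<mu>)
  have co[measurable]: "(\<lambda>\<omega>. \<omega> k) \<in> borel_measurable \<Omega>" for k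
    unfolding \<Omega>_def using measurable_component_singleton[of k UNIV \<mu>] by (simp add: measurable_cong_sets[OF refl s\<mu>])
  \<comment> \<open>The exponent of piece \<open>Suc k\<close> is at most 2 (1 + |z|^2) / 16^k,
    which \<open>one_minus_exp_le\<close> multiplies by 3. At distance 2^-k the tail bound becomes
    18 (1 + 4^k) / 16^k \<le> 36 / 4^k.\<close>
  have tail: "measure (\<mu> (Suc k)) {x. 1 / 2 ^ k \<le> \<bar>x \<bullet> e\<bar>} \<le> 36 / 4 ^ k" if e: "e \<in> Basis" for e k
  proof -
    have "norm (1 - (CLINT x|\<mu> (Suc k). iexp (z \<bullet> x))) \<le> (6 / 16 ^ k) * (1 + (norm z)\<^sup>2)" for z
    proof -
      \<comment> \<open>This exponential is the value of a characteristic function.\<close>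
      have "norm (exp (\<psi> (Suc k) z)) \<le> 1"
        unfolding ch[symmetric]
        by (rule order_trans[OF integral_norm_bound]) (simp add: \<mu>.prob_space)
      then have "norm (1 - exp (\<psi> (Suc k) z)) \<le> 3 * norm (\<psi> (Suc k) z)" by (rule one_minus_exp_le)
      also have "norm (\<psi> (Suc k) z) \<le> (\<integral>x. 2 * (1 + (norm z)\<^sup>2) * (indicator (B (Suc k)) x * levy_weight c x) \<partial>L)"
        unfolding \<psi>_def
      proof (rule order_trans[OF integral_norm_bound], rule integral_mono)
        show "integrable L (\<lambda>x. norm (indicator (B (Suc k)) x *\<^sub>R ID_kernel c z x))"
          by (intro integrable_norm integrable_mult_indicator ik) (simp add: s)
        show "integrable L (\<lambda>x. 2 * (1 + (norm z)\<^sup>2) * (indicator (B (Suc k)) x * levy_weight c x))"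
          using integrable_mult_indicator[OF _ iw, of "B (Suc k)"] by (intro integrable_mult_right) (simp add: s)
        show "norm (indicator (B (Suc k)) x *\<^sub>R ID_kernel c z x) \<le> 2 * (1 + (norm z)\<^sup>2) * (indicator (B (Suc k)) x * levy_weight c x)" for x
          using norm_ID_kernel_le[OF c, of z x] by (cases "x \<in> B (Suc k)") simp_all
      qed
      also have "\<dots> = 2 * (1 + (norm z)\<^sup>2) * (\<integral>x. indicator (B (Suc k)) x * levy_weight c x \<partial>L)"
        by (rule integral_mult_right_zero)
      also have "\<dots> \<le> 2 * (1 + (norm z)\<^sup>2) * (1 / 16 ^ k)"
        by (intro mult_left_mono small) simp
      finally show ?thesis unfolding ch by (simp add: field_simps)
    qed
    from char_tail_bound[OF \<mu> s\<mu> this, of e "1 / 2 ^ k"] e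
    have "measure (\<mu> (Suc k)) {x. 1 / 2 ^ k \<le> \<bar>x \<bullet> e\<bar>} \<le> 3 * (6 / 16 ^ k) * (1 + 1 / (1 / 2 ^ k)\<^sup>2)"
      by simp
    also have "\<dots> = 18 / 16 ^ k + 18 * (4 ^ k / 16 ^ k)"
      by (simp add: power_divide field_simps power2_eq_square flip: power_mult_distrib)
    also have "(4::real) ^ k / 16 ^ k = 1 / 4 ^ k"
      by (simp add: field_simps flip: power_mult_distrib)
    also have "18 / (16::real) ^ k \<le> 18 / 4 ^ k"
      by (intro divide_left_mono power_mono) auto
    finally show ?thesis by simp
  qed
  \<comment> \<open>Borel-Cantelli in each of the finitely many coordinate directions.\<close>
  have ev: "AE \<omega> in \<Omega>. \<forall>e\<in>Basis. \<forall>\<^sub>F k in sequentially. \<bar>\<omega> (Suc k) \<bullet> e\<bar> < 1 / 2 ^ k"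
  proof (rule AE_ball_countable')
    fix e :: 'a assume e: "e \<in> Basis"
    let ?A = "\<lambda>k. {\<omega>\<in>space \<Omega>. 1 / 2 ^ k \<le> \<bar>\<omega> (Suc k) \<bullet> e\<bar>}"
    have mA: "measure \<Omega> (?A k) \<le> 36 / 4 ^ k" for k
    proof -
      have "measure (\<mu> (Suc k)) {x. 1 / 2 ^ k \<le> \<bar>x \<bullet> e\<bar>} = measure (distr \<Omega> (\<mu> (Suc k)) (\<lambda>\<omega>. \<omega> (Suc k))) {x. 1 / 2 ^ k \<le> \<bar>x \<bullet> e\<bar>}"
        unfolding \<Omega>_def by (simp add: distr_PiM_component \<mu>)
      also have "\<dots> = measure \<Omega> ((\<lambda>\<omega>. \<omega> (Suc k)) -` {x. 1 / 2 ^ k \<le> \<bar>x \<bullet> e\<bar>} \<inter> space \<Omega>)"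
        by (rule measure_distr) (simp_all add: measurable_cong_sets[OF refl s\<mu>] s\<mu>)
      also have "(\<lambda>\<omega>. \<omega> (Suc k)) -` {x. 1 / 2 ^ k \<le> \<bar>x \<bullet> e\<bar>} \<inter> space \<Omega> = ?A k" by auto
      finally show ?thesis using tail[OF e, of k] by simp
    qed
    have "summable (\<lambda>k. 36 * (1/4::real) ^ k)" by (intro summable_mult summable_geometric) simp
    then have "summable (\<lambda>k. measure \<Omega> (?A k))"
      by (rule summable_comparison_test'[where N=0]) (use mA in \<open>simp add: power_divide\<close>)
    then have "AE \<omega> in \<Omega>. \<forall>\<^sub>F k in sequentially. \<omega> \<in> space \<Omega> - ?A k"
      by (intro borel_cantelli_AE1) (auto simp: \<Omega>.emeasure_eq_measure)
    then show "AE \<omega> in \<Omega>. \<forall>\<^sub>F k in sequentially. \<bar>\<omega> (Suc k) \<bullet> e\<bar> < 1 / 2 ^ k"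
    proof eventually_elim
      case (elim \<omega>)
      then show ?case by eventually_elim auto
    qed
  qed (rule countable_finite, simp)
  have conv: "AE \<omega> in \<Omega>. convergent (\<lambda>n. \<Sum>k<n. \<omega> k)"
    using ev
  proof eventually_elim
    case (elim \<omega>)
    then have "\<forall>\<^sub>F k in sequentially. \<forall>e\<in>Basis. \<bar>\<omega> (Suc k) \<bullet> e\<bar> < 1 / 2 ^ k"
      by (simp add: eventually_ball_finite_distrib)
    then have "\<forall>\<^sub>F k in sequentially. norm (\<omega> (Suc k)) \<le> real DIM('a) * (1 / 2) ^ k"
    proof eventually_elim
      case (elim k)
      have "norm (\<omega> (Suc k)) \<le> (\<Sum>e\<in>Basis. \<bar>\<omega> (Suc k) \<bullet> e\<bar>)" by (rule norm_le_l1)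
      also have "\<dots> \<le> (\<Sum>e\<in>(Basis::'a set). 1 / 2 ^ k)" using elim by (intro sum_mono) auto
      finally show ?case by (simp add: power_divide)
    qed
    \<comment> \<open>Only the shifted sequence is estimated; the variable of piece 0 is a single
      term and does not affect convergence.\<close>
    then have "summable (\<lambda>k. \<omega> (Suc k))"
      by (rule summable_comparison_test_ev) (intro summable_mult summable_geometric, simp)
    then have "summable \<omega>" by (simp add: summable_Suc_iff)
    then show ?case by (simp add: summable_iff_convergent)
  qed
  define S where "S \<omega> = lim (\<lambda>n. \<Sum>k<n. \<omega> k)" for \<omega> :: "nat \<Rightarrow> 'a"
  have [measurable]: "S \<in> borel_measurable \<Omega>" unfolding S_def by measurable
  have "(CLINT x|distr \<Omega> borel S. iexp (z \<bullet> x)) = exp (CLINT x|L. ID_kernel c z x)" for z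
  proof (rule LIMSEQ_unique)
    have "(\<lambda>n. CLINT \<omega>|\<Omega>. iexp (z \<bullet> (\<Sum>k<n. \<omega> k))) \<longlonglongrightarrow> (CLINT \<omega>|\<Omega>. iexp (z \<bullet> S \<omega>))"
    proof (rule integral_dominated_convergence)
      show "AE \<omega> in \<Omega>. (\<lambda>n. iexp (z \<bullet> (\<Sum>k<n. \<omega> k))) \<longlonglongrightarrow> iexp (z \<bullet> S \<omega>)"
        using conv
      proof eventually_elim
        case (elim \<omega>)
        then have "(\<lambda>n. \<Sum>k<n. \<omega> k) \<longlonglongrightarrow> S \<omega>" by (simp add: convergent_LIMSEQ_iff S_def)
        then show ?case by (intro tendsto_intros)
      qed
      show "integrable \<Omega> (\<lambda>_. 1::real)" by simp
    qed simp_all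
    moreover have "(CLINT \<omega>|\<Omega>. iexp (z \<bullet> (\<Sum>k<n. \<omega> k))) = exp (\<Sum>k<n. \<psi> k z)" for n
    proof -
      have "(CLINT \<omega>|\<Omega>. iexp (z \<bullet> (\<Sum>k<n. \<omega> k))) = (CLINT \<omega>|PiM UNIV \<mu>. \<Prod>k<n. iexp (z \<bullet> \<omega> k))"
        by (simp add: \<Omega>_def inner_sum_right sum_distrib_left exp_sum)
      also have "\<dots> = (\<Prod>k<n. exp (\<psi> k z))"
        by (subst integral_PiM_prod[where h="\<lambda>_ x. iexp (z \<bullet> x)"]) (auto simp: \<mu> ch measurable_cong_sets[OF s\<mu> refl])
      finally show ?thesis by (simp add: exp_sum)
    qed
    ultimately show "(\<lambda>n. exp (\<Sum>k<n. \<psi> k z)) \<longlonglongrightarrow> (CLINT x|distr \<Omega> borel S. iexp (z \<bullet> x))"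
      by (simp add: integral_distr)
    \<comment> \<open>The pieces cover everything except the origin, where the kernel is 0.\<close>
    have "(\<lambda>n. \<Sum>k<n. \<psi> k z) \<longlonglongrightarrow> (CLINT x|L. ID_kernel c z x)"
      unfolding \<psi>_def
      by (rule tendsto_integral_partition[OF ik _ dj]) (auto simp: UB s ID_kernel_def)
    then show "(\<lambda>n. exp (\<Sum>k<n. \<psi> k z)) \<longlonglongrightarrow> exp (CLINT x|L. ID_kernel c z x)"
      by (rule tendsto_exp)
  qed
  then show ?thesis
    by (intro exI[of _ "distr \<Omega> borel S"]) (auto intro: \<Omega>.prob_space_distr)
qed

section \<open>Stretched exponentials and the incomplete gamma distribution\<close>

text \<open>With c = -1 - \<beta> this is the radial density of \<open>TS_levy p \<beta> R\<close>,
  extended by 0 so that integrals and affine substitutions run over all of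
  \<open>lborel\<close>.\<close>

definition stretched_exp :: "real \<Rightarrow> real \<Rightarrow> real \<Rightarrow> real" where
  "stretched_exp p c u = indicator {0<..} u * (u powr c * exp (- (u powr p)))"

lemma stretched_exp_nonneg [simp]: "0 \<le> stretched_exp p c u"
  by (simp add: stretched_exp_def)

lemma borel_measurable_stretched_exp [measurable]: "stretched_exp p c \<in> borel_measurable borel"
  unfolding stretched_exp_def by measurable

lemma stretched_exp_mult_powr: "u powr d * stretched_exp p c u = stretched_exp p (c + d) u"
  by (simp add: stretched_exp_def powr_add)

lemma stretched_exp_mult_self: "u * stretched_exp p c u = stretched_exp p (c + 1) u"
  by (simp add: stretched_exp_def powr_add indicator_def)

text \<open>The substitution t = u^p turns the Gamma integral at s = (c + 1) / p into p times this
  one.\<close>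

lemma has_bochner_integral_stretched_exp:
  assumes p: "0 < p" and c: "-1 < c"
  shows "has_bochner_integral lborel (stretched_exp p c) (Gamma ((c + 1) / p) / p)"
proof -
  define s where "s = (c + 1) / p"
  have s: "0 < s" using p c by (simp add: s_def)
  define f where "f t = t powr (s - 1) / exp t" for t :: real
  \<comment> \<open>The endpoint 0 is removed because the substitution is made on the open
    half-line, where it is differentiable.\<close>
  have fi: "(f has_integral Gamma s) {0<..}"
    unfolding f_def using Gamma_integral_real[OF s]
  proof (rule has_integral_spike_set_eq[THEN iffD1, rotated 2])
    show "negligible {x \<in> {0..} - {0<..}. x powr (s - 1) / exp x \<noteq> 0}"
      by (rule negligible_subset[of "{0}"]) auto
    show "negligible {x \<in> {0<..} - {0..}. x powr (s - 1) / exp x \<noteq> 0}"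
      by (rule negligible_subset[of "{0}"]) auto
  qed
  have fa: "f absolutely_integrable_on {0<..}"
    by (rule nonnegative_absolutely_integrable_1) (use fi in \<open>auto simp: f_def intro: has_integral_integrable\<close>)
  have im: "(\<lambda>u. u powr p) ` {0<..} = {0<..}"
  proof -
    have "v \<in> (\<lambda>u. u powr p) ` {0<..}" if "0 < v" for v :: real
      using that p by (intro image_eqI[of _ _ "v powr (1 / p)"]) (auto simp: powr_powr)
    then show ?thesis by auto
  qed
  have inj: "inj_on (\<lambda>u. u powr p) {0<..}"
  proof (rule inj_onI)
    fix x y :: real assume "x \<in> {0<..}" "y \<in> {0<..}" "x powr p = y powr p"
    then have "(x powr p) powr (1 / p) = (y powr p) powr (1 / p)" "0 < x" "0 < y" by simp_all
    then show "x = y" using p by (simp add: powr_powr)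
  qed
  have h: "(\<lambda>x. \<bar>p * x powr (p - 1)\<bar> * f (x powr p)) absolutely_integrable_on {0<..} \<and>
    integral {0<..} (\<lambda>x. \<bar>p * x powr (p - 1)\<bar> * f (x powr p)) = Gamma s"
  proof (subst has_absolute_integral_change_of_variables_1'[where g="\<lambda>u. u powr p" and f=f and g'="\<lambda>x. p * x powr (p - 1)"])
    show "((\<lambda>u. u powr p) has_real_derivative p * x powr (p - 1)) (at x within {0<..})" if "x \<in> {0<..}" for x
      using that by (auto intro!: derivative_eq_intros)
    show "f absolutely_integrable_on (\<lambda>u. u powr p) ` {0<..} \<and> integral ((\<lambda>u. u powr p) ` {0<..}) f = Gamma s"
      unfolding im using fa fi by (simp add: integral_unique)
  qed (use inj in auto)
  have *: "\<bar>p * x powr (p - 1)\<bar> * f (x powr p) = p * (x powr c * exp (- (x powr p)))" if "x \<in> {0<..}" for x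
  proof -
    have "p - 1 + p * (s - 1) = c" using p by (simp add: s_def field_simps)
    then have "x powr (p - 1) * (x powr p) powr (s - 1) = x powr c"
      by (simp add: powr_powr powr_add[symmetric])
    then show ?thesis using p by (simp add: f_def exp_minus field_simps)
  qed
  have c1: "(\<lambda>x. \<bar>p * x powr (p - 1)\<bar> * f (x powr p)) absolutely_integrable_on {0<..} \<longleftrightarrow>
      (\<lambda>x. p * (x powr c * exp (- (x powr p)))) absolutely_integrable_on {0<..}"
    by (rule set_integrable_cong[OF refl refl *])
  have c2: "integral {0<..} (\<lambda>x. \<bar>p * x powr (p - 1)\<bar> * f (x powr p)) = integral {0<..} (\<lambda>x. p * (x powr c * exp (- (x powr p))))"
    by (rule Henstock_Kurzweil_Integration.integral_cong[OF *])
  have A: "(\<lambda>x. p * (x powr c * exp (- (x powr p)))) absolutely_integrable_on {0<..}"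
    "integral {0<..} (\<lambda>x. p * (x powr c * exp (- (x powr p)))) = Gamma s"
    by (rule c1[THEN iffD1, OF conjunct1[OF h]], rule trans[OF c2[symmetric] conjunct2[OF h]])
  have eq: "indicator {0<..} x *\<^sub>R (p * (x powr c * exp (- (x powr p)))) = p * stretched_exp p c x" for x
    by (simp add: stretched_exp_def)
  \<comment> \<open>The change of variables speaks of the completed measure; Borel measurability of
    the integrand brings the result back to \<open>lborel\<close>.\<close>
  have "integrable lebesgue (\<lambda>x. p * stretched_exp p c x)"
    using A(1) unfolding set_integrable_def eq .
  then have i: "integrable lborel (stretched_exp p c)"
    using p by (simp add: integrable_completion)
  have "p * (\<integral>x. stretched_exp p c x \<partial>lborel) = (\<integral>x. p * stretched_exp p c x \<partial>lebesgue)"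
    by (simp add: integral_completion)
  also have "\<dots> = set_lebesgue_integral lebesgue {0<..} (\<lambda>x. p * (x powr c * exp (- (x powr p))))"
    unfolding set_lebesgue_integral_def eq ..
  also have "\<dots> = Gamma s"
    by (rule trans[OF set_lebesgue_integral_eq_integral(2)[OF A(1)] A(2)])
  finally have "(\<integral>x. stretched_exp p c x \<partial>lborel) = Gamma s / p" using p by (simp add: field_simps)
  with i show ?thesis by (simp add: has_bochner_integral_iff s_def)
qed

lemma integrable_stretched_exp: "0 < p \<Longrightarrow> -1 < c \<Longrightarrow> integrable lborel (stretched_exp p c)"
  and integral_stretched_exp: "0 < p \<Longrightarrow> -1 < c \<Longrightarrow> (\<integral>u. stretched_exp p c u \<partial>lborel) = Gamma ((c + 1) / p) / p"
  using has_bochner_integral_stretched_exp by (auto simp: has_bochner_integral_iff)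

section \<open>The gamma distribution with integer shape\<close>

lemma erlang_density_conv:
  assumes "0 < v" "0 < x" "0 < \<zeta>"
  shows "\<zeta> powr real (Suc k) / Gamma (real (Suc k)) * (x powr (real (Suc k) - 1) * exp (- x * \<zeta>)) = erlang_density k \<zeta> x"
proof -
  have "Gamma (1 + real k) = fact k" using Gamma_fact[of k, where 'a=real] by simp
  moreover have "\<zeta> powr (1 + real k) = \<zeta> ^ Suc k" using assms powr_realpow[of \<zeta> "Suc k"] by simp
  moreover have "x powr real k = x ^ k" using assms by (simp add: powr_realpow)
  ultimately show ?thesis using assms by (simp add: erlang_density_def mult.commute)
qed

text \<open>Shape \<open>Suc k\<close> is the Erlang law with parameter k, whose distribution
  function is a finite exponential sum. For the second claim the exponential is bounded by 1 and x^k
  by v^k under the integral; the resulting order v^(k+1) at 0 makes the incomplete gamma weight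
  integrable.\<close>

lemma gamma_cdf_eq_erlang:
  assumes \<zeta>: "0 < \<zeta>" and v: "0 < v"
  shows "gamma_cdf (real (Suc k)) \<zeta> v = erlang_CDF k \<zeta> v"
    and "gamma_cdf (real (Suc k)) \<zeta> v \<le> \<zeta> ^ Suc k / fact k * v ^ Suc k"
proof -
  let ?h = "\<lambda>x. indicator {0<..<v} x * erlang_density k \<zeta> x"
  have eq: "gamma_cdf (real (Suc k)) \<zeta> v = (\<integral>x. ?h x \<partial>lborel)"
  proof -
    have "gamma_cdf (real (Suc k)) \<zeta> v = (\<integral>x. \<zeta> powr real (Suc k) / Gamma (real (Suc k)) *
        (indicator {0<..<v} x * (x powr (real (Suc k) - 1) * exp (- x * \<zeta>))) \<partial>lborel)"
      unfolding gamma_cdf_def set_lebesgue_integral_def by (subst integral_mult_right_zero) simp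
    also have "\<dots> = (\<integral>x. ?h x \<partial>lborel)"
    proof (rule Bochner_Integration.integral_cong[OF refl])
      fix x
      show "\<zeta> powr real (Suc k) / Gamma (real (Suc k)) *
        (indicator {0<..<v} x * (x powr (real (Suc k) - 1) * exp (- x * \<zeta>))) = ?h x"
        using erlang_density_conv[OF v _ \<zeta>, of x k] by (cases "x \<in> {0<..<v}") simp_all
    qed
    finally show ?thesis .
  qed
  have nn: "(\<integral>\<^sup>+x. ennreal (?h x) \<partial>lborel) = ennreal (erlang_CDF k \<zeta> v)"
  proof -
    have "(\<integral>\<^sup>+x. ennreal (?h x) \<partial>lborel) = (\<integral>\<^sup>+ x. ennreal (erlang_density k \<zeta> x) * indicator {..v} x \<partial>lborel)"
    proof (rule nn_integral_cong_AE)
      have "AE x in lborel. x \<noteq> 0 \<and> x \<noteq> v" by (simp add: AE_lborel_singleton)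
      then show "AE x in lborel. ennreal (?h x) = ennreal (erlang_density k \<zeta> x) * indicator {..v} x"
        by eventually_elim (auto simp: indicator_def erlang_density_def)
    qed
    then show ?thesis using nn_integral_erlang_density[OF \<zeta>, of k v] by simp
  qed
  have h0: "0 \<le> ?h x" for x using \<zeta> by simp
  have h[measurable]: "?h \<in> borel_measurable lborel" by measurable
  show 1: "gamma_cdf (real (Suc k)) \<zeta> v = erlang_CDF k \<zeta> v"
    unfolding eq by (subst integral_eq_nn_integral) (use h0 nn \<zeta> in auto)
  have "ennreal (erlang_CDF k \<zeta> v) \<le> (\<integral>\<^sup>+x. ennreal (\<zeta> ^ Suc k / fact k * v ^ k) * indicator {0<..<v} x \<partial>lborel)"
    unfolding nn[symmetric]
  proof (rule nn_integral_mono)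
    fix x
    have "erlang_density k \<zeta> x \<le> \<zeta> ^ Suc k / fact k * v ^ k" if "0 < x" "x < v"
    proof -
      have "x ^ k * exp (- \<zeta> * x) \<le> v ^ k * 1"
        using that \<zeta> by (intro mult_mono power_mono) auto
      then have "\<zeta> ^ Suc k / fact k * (x ^ k * exp (- \<zeta> * x)) \<le> \<zeta> ^ Suc k / fact k * (v ^ k * 1)"
        using \<zeta> by (intro mult_left_mono) auto
      then show ?thesis using that by (simp add: erlang_density_def)
    qed
    then show "ennreal (?h x) \<le> ennreal (\<zeta> ^ Suc k / fact k * v ^ k) * indicator {0<..<v} x"
      by (auto simp: indicator_def intro!: ennreal_leI)
  qed
  also have "\<dots> = ennreal (\<zeta> ^ Suc k / fact k * v ^ k * v)"
    using v \<zeta> by (subst nn_integral_cmult_indicator) (auto simp: ennreal_mult''[symmetric])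
  finally have "erlang_CDF k \<zeta> v \<le> \<zeta> ^ Suc k / fact k * v ^ k * v"
    using v \<zeta> by (subst (asm) ennreal_le_iff) auto
  then show "gamma_cdf (real (Suc k)) \<zeta> v \<le> \<zeta> ^ Suc k / fact k * v ^ Suc k"
    unfolding 1 by (simp add: ac_simps)
qed

text \<open>The partial sum of the exponential series up to k lies strictly below the one with a
  further positive term, hence strictly below the exponential.\<close>

lemma erlang_CDF_pos:
  assumes "0 < \<zeta>" "0 < v"
  shows "0 < erlang_CDF k \<zeta> v"
proof -
  let ?x = "\<zeta> * v"
  have x: "0 < ?x" using assms by simp
  have s: "summable (\<lambda>n. ?x ^ n / fact n)" using summable_exp[of ?x] by (simp add: field_simps)
  have "(\<Sum>n<Suc k. ?x ^ n / fact n) < (\<Sum>n<Suc (Suc k). ?x ^ n / fact n)" using x by simp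
  also have "\<dots> \<le> (\<Sum>n. ?x ^ n / fact n)" using x s by (intro sum_le_suminf) auto
  also have "\<dots> = exp ?x" unfolding exp_def by (simp add: field_simps scaleR_conv_of_real)
  finally have "(\<Sum>n\<le>k. ?x ^ n / fact n) * exp (- ?x) < 1"
    by (simp add: lessThan_Suc_atMost exp_minus field_simps)
  moreover have "(\<Sum>n\<le>k. ?x ^ n * exp (- \<zeta> * v) / fact n) = (\<Sum>n\<le>k. ?x ^ n / fact n) * exp (- ?x)"
    by (simp add: sum_distrib_right)
  ultimately show ?thesis using assms unfolding erlang_CDF_def by simp
qed

section \<open>The incomplete gamma density\<close>

definition IGa_kernel :: "real \<Rightarrow> nat \<Rightarrow> real \<Rightarrow> real \<Rightarrow> real \<Rightarrow> real" where
  "IGa_kernel \<beta> g p \<eta> u = indicator {0<..} u * IGa_weight \<beta> (real g) p \<eta> u"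

lemma IGa_kernel_eq:
  assumes "1 < \<eta>"
  shows "IGa_kernel \<beta> (Suc k) p \<eta> u = erlang_CDF k (\<eta> - 1) (u powr p) * stretched_exp p (-1 - \<beta>) u"
  using gamma_cdf_eq_erlang(1)[of "\<eta> - 1" "u powr p" k] assms
  by (cases "0 < u") (auto simp: IGa_kernel_def IGa_weight_def stretched_exp_def)

lemma borel_measurable_IGa_kernel [measurable]:
  assumes "1 < \<eta>"
  shows "IGa_kernel \<beta> (Suc k) p \<eta> \<in> borel_measurable borel"
proof -
  have "IGa_kernel \<beta> (Suc k) p \<eta> = (\<lambda>u. erlang_CDF k (\<eta> - 1) (u powr p) * stretched_exp p (-1 - \<beta>) u)"
    using IGa_kernel_eq[OF assms] by auto
  then show ?thesis by (simp add: erlang_CDF_def)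
qed

lemma IGa_kernel_nonneg: "1 < \<eta> \<Longrightarrow> 0 \<le> IGa_kernel \<beta> (Suc k) p \<eta> u"
  by (simp add: IGa_kernel_eq)

text \<open>Near 0 the distribution function contributes u^(p (k+1)), which lifts the exponent -1 -
  \<beta> above -1 precisely when \<beta> < p (k+1). At infinity the stretched exponential
  decides.\<close>

lemma integrable_IGa_kernel:
  assumes p: "0 < p" and \<eta>: "1 < \<eta>" and \<beta>: "\<beta> < p * real (Suc k)"
  shows "integrable lborel (IGa_kernel \<beta> (Suc k) p \<eta>)"
proof (rule Bochner_Integration.integrable_bound)
  let ?C = "(\<eta> - 1) ^ Suc k / fact k"
  show "integrable lborel (\<lambda>u. ?C * stretched_exp p (-1 - \<beta> + p * real (Suc k)) u)"
    using p \<beta> by (intro integrable_mult_right integrable_stretched_exp) auto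
  show "IGa_kernel \<beta> (Suc k) p \<eta> \<in> borel_measurable lborel" using \<eta> by simp
  show "AE u in lborel. norm (IGa_kernel \<beta> (Suc k) p \<eta> u) \<le> norm (?C * stretched_exp p (-1 - \<beta> + p * real (Suc k)) u)"
  proof (rule always_eventually, rule allI)
    fix u
    show "norm (IGa_kernel \<beta> (Suc k) p \<eta> u) \<le> norm (?C * stretched_exp p (-1 - \<beta> + p * real (Suc k)) u)"
    proof (cases "0 < u")
      case True
      then have "0 < u powr p" by simp
      from gamma_cdf_eq_erlang[of "\<eta> - 1", OF _ this, of k] \<eta>
      have "erlang_CDF k (\<eta> - 1) (u powr p) \<le> ?C * (u powr p) ^ Suc k" by simp
      also have "(u powr p) ^ Suc k = u powr (p * real (Suc k))"
        using True by (subst powr_realpow[symmetric]) (auto simp: powr_powr)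
      finally have "erlang_CDF k (\<eta> - 1) (u powr p) * stretched_exp p (-1 - \<beta>) u \<le> ?C * u powr (p * real (Suc k)) * stretched_exp p (-1 - \<beta>) u"
        by (intro mult_right_mono) auto
      also have "\<dots> = ?C * stretched_exp p (-1 - \<beta> + p * real (Suc k)) u"
        by (simp only: mult.assoc stretched_exp_mult_powr)
      finally have 1: "IGa_kernel \<beta> (Suc k) p \<eta> u \<le> ?C * stretched_exp p (-1 - \<beta> + p * real (Suc k)) u"
        by (simp only: IGa_kernel_eq[OF \<eta>])
      have "0 \<le> ?C * stretched_exp p (-1 - \<beta> + p * real (Suc k)) u" using \<eta> by simp
      from abs_of_nonneg[OF this] abs_of_nonneg[OF IGa_kernel_nonneg[OF \<eta>, of \<beta> k p u]] 1 show ?thesis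
        unfolding real_norm_def by (simp only:)
    qed (simp add: IGa_kernel_def)
  qed
qed

lemma IGa_K_eq: "IGa_K \<beta> (real g) p \<eta> = (\<integral>u. IGa_kernel \<beta> g p \<eta> u \<partial>lborel)"
  by (simp add: IGa_K_def IGa_kernel_def set_lebesgue_integral_def)

text \<open>This is how the normalising constant with parameter \<alpha> - 1 enters b_0: it is the
  first moment of the jump density with parameter \<alpha>.\<close>

lemma IGa_kernel_mult_self: "u * IGa_kernel \<beta> g p \<eta> u = IGa_kernel (\<beta> - 1) g p \<eta> u"
proof -
  have "u * u powr (-1 - \<beta>) = u powr (-1 - (\<beta> - 1))" if "0 < u"
  proof -
    have "u * u powr (-1 - \<beta>) = u powr 1 * u powr (-1 - \<beta>)" using that by simp
    also have "\<dots> = u powr (-1 - (\<beta> - 1))" by (simp only: powr_add[symmetric]) simp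
    finally show ?thesis .
  qed
  then show ?thesis by (simp add: IGa_kernel_def IGa_weight_def indicator_def)
qed

lemma IGa_K_pos:
  assumes p: "0 < p" and \<eta>: "1 < \<eta>" and \<beta>: "\<beta> < p * real (Suc k)"
  shows "0 < IGa_K \<beta> (real (Suc k)) p \<eta>"
proof (rule ccontr)
  let ?f = "IGa_kernel \<beta> (Suc k) p \<eta>"
  assume "\<not> 0 < IGa_K \<beta> (real (Suc k)) p \<eta>"
  moreover have "0 \<le> (\<integral>u. ?f u \<partial>lborel)" by (intro integral_nonneg_AE always_eventually allI IGa_kernel_nonneg \<eta>)
  ultimately have "(\<integral>u. ?f u \<partial>lborel) = 0" by (simp only: IGa_K_eq)
  then have ae: "AE u in lborel. ?f u = 0"
    by (subst (asm) integral_nonneg_eq_0_iff_AE[OF integrable_IGa_kernel[OF p \<eta> \<beta>]]) (auto intro: IGa_kernel_nonneg \<eta>)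
  have nz: "?f u \<noteq> 0" if "0 < u" for u
    using that erlang_CDF_pos[of "\<eta> - 1" "u powr p" k] \<eta> by (simp add: IGa_kernel_eq stretched_exp_def)
  from ae have "AE u in lborel. \<not> (0::real) < u" by (rule eventually_mono) (use nz in auto)
  then have "emeasure lborel {u::real. 0 < u} = 0" by (subst (asm) AE_iff_measurable[OF _ refl]) auto
  moreover have "emeasure lborel {0<..<1::real} \<le> emeasure lborel {u::real. 0 < u}" by (intro emeasure_mono) auto
  ultimately show False by simp
qed

lemma prob_space_IGa:
  assumes p: "0 < p" and \<eta>: "1 < \<eta>" and \<beta>: "\<beta> < p * real (Suc k)"
  shows "prob_space (IGa \<beta> (real (Suc k)) p \<eta>)"
proof
  let ?f = "IGa_kernel \<beta> (Suc k) p \<eta>" and ?K = "IGa_K \<beta> (real (Suc k)) p \<eta>"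
  have K: "0 < ?K" by (rule IGa_K_pos[OF assms])
  have eq: "IGa \<beta> (real (Suc k)) p \<eta> = density lborel (\<lambda>u. ennreal (?f u / ?K))"
    by (simp add: IGa_def IGa_kernel_def)
  have "emeasure (IGa \<beta> (real (Suc k)) p \<eta>) (space lborel) = (\<integral>\<^sup>+u. ennreal (?f u / ?K) \<partial>lborel)"
    unfolding eq using \<eta> by (subst emeasure_density) (auto cong: nn_integral_cong)
  also have "\<dots> = ennreal (\<integral>u. ?f u / ?K \<partial>lborel)"
    using integrable_IGa_kernel[OF assms] IGa_kernel_nonneg[OF \<eta>] K by (intro nn_integral_eq_integral) auto
  also have "\<dots> = 1" using K by (simp add: IGa_K_eq[symmetric])
  finally show "emeasure (IGa \<beta> (real (Suc k)) p \<eta>) (space (IGa \<beta> (real (Suc k)) p \<eta>)) = 1"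
    by (simp add: IGa_def)
qed

lemma integral_IGa:
  fixes f :: "real \<Rightarrow> 'b::{banach, second_countable_topology}"
  assumes p: "0 < p" and \<eta>: "1 < \<eta>" and \<beta>: "\<beta> < p * real (Suc k)" and [measurable]: "f \<in> borel_measurable borel"
  shows "(\<integral>u. f u \<partial>IGa \<beta> (real (Suc k)) p \<eta>) = (1 / IGa_K \<beta> (real (Suc k)) p \<eta>) *\<^sub>R (\<integral>u. IGa_kernel \<beta> (Suc k) p \<eta> u *\<^sub>R f u \<partial>lborel)"
proof -
  let ?f = "IGa_kernel \<beta> (Suc k) p \<eta>" and ?K = "IGa_K \<beta> (real (Suc k)) p \<eta>"
  have K: "0 < ?K" by (rule IGa_K_pos[OF p \<eta> \<beta>])
  have eq: "IGa \<beta> (real (Suc k)) p \<eta> = density lborel (\<lambda>u. ennreal (?f u / ?K))"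
    by (simp add: IGa_def IGa_kernel_def)
  have "(\<integral>u. f u \<partial>IGa \<beta> (real (Suc k)) p \<eta>) = (\<integral>u. (?f u / ?K) *\<^sub>R f u \<partial>lborel)"
    unfolding eq using \<eta> K IGa_kernel_nonneg[OF \<eta>, of \<beta> k p] by (intro integral_density) auto
  also have "\<dots> = (\<integral>u. (1 / ?K) *\<^sub>R (?f u *\<^sub>R f u) \<partial>lborel)" by simp
  finally show ?thesis by (simp only: integral_scaleR_right)
qed

section \<open>Tempered stable distributions\<close>

text \<open>\<open>TS_levy\<close> is built by \<open>measure_of\<close> from a set function.
  Recognising that function as the image of a weighted product measure under (x, u) -> u x shows
  that it is a measure and reduces its integrals to Fubini. Finiteness of R makes the product
  sigma-finite.\<close>

lemma TS_levy_eq_distr: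
  fixes R :: "(real^'d) measure"
  assumes R: "finite_measure R" and s[measurable_cong]: "sets R = sets borel"
  shows "(\<lambda>q. snd q *\<^sub>R fst q) \<in> borel_measurable (density (R \<Otimes>\<^sub>M lborel) (\<lambda>q. ennreal (stretched_exp p (-1 - \<beta>) (snd q))))"
    (is "_ \<in> borel_measurable ?D")
    and "TS_levy p \<beta> R = distr (density (R \<Otimes>\<^sub>M lborel) (\<lambda>q. ennreal (stretched_exp p (-1 - \<beta>) (snd q)))) borel (\<lambda>q. snd q *\<^sub>R fst q)"
proof -
  define D where "D = ?D"
  interpret R: finite_measure R by fact
  interpret pair_sigma_finite R lborel ..
  let ?T = "\<lambda>q. snd q *\<^sub>R fst q"
  have "(\<lambda>q. snd q *\<^sub>R (fst q :: real^'d)) \<in> R \<Otimes>\<^sub>M lborel \<rightarrow>\<^sub>M borel" by measurable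
  then show "?T \<in> borel_measurable ?D" by simp
  then have m: "?T \<in> borel_measurable D" by (simp add: D_def)
  have em: "emeasure (distr D borel ?T) B = (\<integral>\<^sup>+x. (\<integral>\<^sup>+u\<in>{0<..}. indicator B (u *\<^sub>R x) *
              ennreal (u powr (-1 - \<beta>) * exp (- (u powr p))) \<partial>lborel) \<partial>R)"
    if B[measurable]: "B \<in> sets borel" for B
  proof -
    have "emeasure (distr D borel ?T) B = (\<integral>\<^sup>+y. indicator B y \<partial>distr D borel ?T)" using B by simp
    also have "\<dots> = (\<integral>\<^sup>+q. indicator B (?T q) \<partial>D)" by (rule nn_integral_distr[OF m]) simp
    also have "\<dots> = (\<integral>\<^sup>+q. ennreal (stretched_exp p (-1 - \<beta>) (snd q)) * indicator B (?T q) \<partial>(R \<Otimes>\<^sub>M lborel))"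
      unfolding D_def by (rule nn_integral_density) measurable
    also have "\<dots> = (\<integral>\<^sup>+x. (\<integral>\<^sup>+u. ennreal (stretched_exp p (-1 - \<beta>) u) * indicator B (u *\<^sub>R x) \<partial>lborel) \<partial>R)"
      by (subst lborel.nn_integral_fst[symmetric]) simp_all
    also have "\<dots> = (\<integral>\<^sup>+x. (\<integral>\<^sup>+u\<in>{0<..}. indicator B (u *\<^sub>R x) *
              ennreal (u powr (-1 - \<beta>) * exp (- (u powr p))) \<partial>lborel) \<partial>R)"
      by (intro nn_integral_cong) (auto simp: stretched_exp_def indicator_def)
    finally show ?thesis .
  qed
  have "TS_levy p \<beta> R = measure_of UNIV (sets borel) (emeasure (distr D borel ?T))"
    unfolding TS_levy_def by (rule measure_of_eq) (auto simp: em sets.sigma_sets_eq[of borel, simplified])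
  also have "\<dots> = distr D borel ?T"
    using measure_of_of_measure[of "distr D borel ?T"] by simp
  finally show "TS_levy p \<beta> R = distr ?D borel ?T" by (simp only: D_def)
qed

lemma sets_TS_levy [measurable_cong]: "sets (TS_levy p \<beta> R) = sets borel"
  unfolding TS_levy_def by (subst sets_measure_of) (auto simp: sets.sigma_sets_eq[of borel, simplified])

lemma nn_integral_TS_levy:
  fixes R :: "(real^'d) measure"
  assumes R: "finite_measure R" and s[measurable_cong]: "sets R = sets borel" and [measurable]: "f \<in> borel_measurable borel"
  shows "(\<integral>\<^sup>+y. f y \<partial>TS_levy p \<beta> R) = (\<integral>\<^sup>+x. \<integral>\<^sup>+u. ennreal (stretched_exp p (-1 - \<beta>) u) * f (u *\<^sub>R x) \<partial>lborel \<partial>R)"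
proof -
  interpret R: finite_measure R by fact
  interpret pair_sigma_finite R lborel ..
  let ?T = "\<lambda>q. snd q *\<^sub>R fst q" and ?D = "density (R \<Otimes>\<^sub>M lborel) (\<lambda>q. ennreal (stretched_exp p (-1 - \<beta>) (snd q)))"
  have "(\<integral>\<^sup>+y. f y \<partial>TS_levy p \<beta> R) = (\<integral>\<^sup>+q. f (?T q) \<partial>?D)"
    unfolding TS_levy_eq_distr(2)[OF R s] by (rule nn_integral_distr[OF TS_levy_eq_distr(1)[OF R s]]) simp
  also have "\<dots> = (\<integral>\<^sup>+q. ennreal (stretched_exp p (-1 - \<beta>) (snd q)) * f (?T q) \<partial>(R \<Otimes>\<^sub>M lborel))"
    by (rule nn_integral_density) measurable
  also have "\<dots> = (\<integral>\<^sup>+x. (\<integral>\<^sup>+u. ennreal (stretched_exp p (-1 - \<beta>) u) * f (u *\<^sub>R x) \<partial>lborel) \<partial>R)"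
    by (subst lborel.nn_integral_fst[symmetric]) simp_all
  finally show ?thesis .
qed

lemma integral_TS_levy:
  fixes R :: "(real^'d) measure" and f :: "real^'d \<Rightarrow> complex"
  assumes R: "finite_measure R" and s[measurable_cong]: "sets R = sets borel" and [measurable]: "f \<in> borel_measurable borel"
    and i: "complex_integrable (TS_levy p \<beta> R) f"
  shows "complex_integrable R (\<lambda>x. CLINT u|lborel. stretched_exp p (-1 - \<beta>) u *\<^sub>R f (u *\<^sub>R x))"
    and "(CLINT y|TS_levy p \<beta> R. f y) = (CLINT x|R. CLINT u|lborel. stretched_exp p (-1 - \<beta>) u *\<^sub>R f (u *\<^sub>R x))"
proof -
  interpret R: finite_measure R by fact
  interpret pair_sigma_finite R lborel ..
  let ?T = "\<lambda>q. snd q *\<^sub>R fst q" and ?D = "density (R \<Otimes>\<^sub>M lborel) (\<lambda>q. ennreal (stretched_exp p (-1 - \<beta>) (snd q)))"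
  let ?g = "\<lambda>q. stretched_exp p (-1 - \<beta>) (snd q) *\<^sub>R f (?T q)"
  note T = TS_levy_eq_distr[OF R s, of p \<beta>]
  have fm: "(\<lambda>q. f (snd q *\<^sub>R fst q)) \<in> borel_measurable (R \<Otimes>\<^sub>M lborel)" by measurable
  have "complex_integrable ?D (\<lambda>q. f (?T q))"
    using i unfolding T(2) by (subst (asm) integrable_distr_eq[OF T(1)]) simp_all
  then have g: "complex_integrable (R \<Otimes>\<^sub>M lborel) ?g"
    by (subst (asm) integrable_density[OF fm]) simp_all
  have "(CLINT y|TS_levy p \<beta> R. f y) = (CLINT q|?D. f (?T q))"
    unfolding T(2) by (rule integral_distr[OF T(1)]) simp
  also have "\<dots> = (CLINT q|(R \<Otimes>\<^sub>M lborel). ?g q)"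
    by (rule integral_density[OF fm]) simp_all
  also have "\<dots> = (CLINT x|R. CLINT u|lborel. stretched_exp p (-1 - \<beta>) u *\<^sub>R f (u *\<^sub>R x))"
    using integral_fst'[OF g] by simp
  finally show "(CLINT y|TS_levy p \<beta> R. f y) = (CLINT x|R. CLINT u|lborel. stretched_exp p (-1 - \<beta>) u *\<^sub>R f (u *\<^sub>R x))" .
  show "complex_integrable R (\<lambda>x. CLINT u|lborel. stretched_exp p (-1 - \<beta>) u *\<^sub>R f (u *\<^sub>R x))"
    using integrable_fst'[OF g] by simp
qed

section \<open>Radial integrals of the Levy weight\<close>

text \<open>The integral is split at u = 1 / r, where the minimum changes branch, and the
  exponential is bounded by 1. The two parts contribute r^\<beta> / (1 - \<beta>) and r^\<beta> /
  \<beta>.\<close>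

lemma nn_integral_min_powr_le:
  assumes \<beta>: "0 < \<beta>" "\<beta> < 1" and r: "0 < r"
  shows "(\<integral>\<^sup>+u. ennreal (stretched_exp p (-1 - \<beta>) u * min (u * r) 1) \<partial>lborel) \<le> ennreal ((1 / (1 - \<beta>) + 1 / \<beta>) * r powr \<beta>)"
proof -
  have "(\<integral>\<^sup>+u. ennreal (stretched_exp p (-1 - \<beta>) u * min (u * r) 1) \<partial>lborel) \<le>
     (\<integral>\<^sup>+u. ennreal r * (ennreal (u powr (-\<beta>)) * indicator {0..1/r} u) + ennreal (u powr (-1 - \<beta>)) * indicator {1/r..} u \<partial>lborel)"
  proof (rule nn_integral_mono)
    fix u
    show "ennreal (stretched_exp p (-1 - \<beta>) u * min (u * r) 1) \<le>
      ennreal r * (ennreal (u powr (-\<beta>)) * indicator {0..1/r} u) + ennreal (u powr (-1 - \<beta>)) * indicator {1/r..} u"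
    proof (cases "0 < u")
      case u: True
      have e: "u powr (-1 - \<beta>) * exp (- (u powr p)) \<le> u powr (-1 - \<beta>)" by (simp add: mult_left_le)
      have up: "u * u powr (-1 - \<beta>) = u powr (-\<beta>)"
      proof -
        have "u * u powr (-1 - \<beta>) = u powr 1 * u powr (-1 - \<beta>)" using u by simp
        also have "\<dots> = u powr (-\<beta>)" by (simp only: powr_add[symmetric]) simp
        finally show ?thesis .
      qed
      show ?thesis
      proof (cases "u \<le> 1 / r")
        case True
        then have "u * r \<le> 1" using r by (simp add: field_simps)
        then have "stretched_exp p (-1 - \<beta>) u * min (u * r) 1 \<le> u powr (-1 - \<beta>) * (u * r)"
          using u r e by (auto simp: stretched_exp_def intro!: mult_right_mono)
        also have "\<dots> = r * u powr (-\<beta>)" by (simp add: up[symmetric])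
        finally have "ennreal (stretched_exp p (-1 - \<beta>) u * min (u * r) 1) \<le> ennreal (r * u powr (-\<beta>))" by (rule ennreal_leI)
        then show ?thesis using True u r by (auto simp: ennreal_mult intro: order_trans)
      next
        case False
        have "stretched_exp p (-1 - \<beta>) u * min (u * r) 1 \<le> stretched_exp p (-1 - \<beta>) u * 1" by (intro mult_left_mono) auto
        also have "\<dots> \<le> u powr (-1 - \<beta>)" using u e by (simp add: stretched_exp_def)
        finally have "ennreal (stretched_exp p (-1 - \<beta>) u * min (u * r) 1) \<le> ennreal (u powr (-1 - \<beta>))" by (rule ennreal_leI)
        then show ?thesis using False u by simp
      qed
    qed (simp add: stretched_exp_def)
  qed
  also have "\<dots> = ennreal r * (\<integral>\<^sup>+u. ennreal (u powr (-\<beta>)) * indicator {0..1/r} u \<partial>lborel) + (\<integral>\<^sup>+u. ennreal (u powr (-1 - \<beta>)) * indicator {1/r..} u \<partial>lborel)"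
    by (simp add: nn_integral_add nn_integral_cmult)
  also have "(\<integral>\<^sup>+u. ennreal (u powr (-\<beta>)) * indicator {0..1/r} u \<partial>lborel) = ennreal ((1/r) powr (-\<beta> + 1) / (-\<beta> + 1))"
    using \<beta> r by (intro nn_integral_has_integral_lebesgue' has_integral_powr_from_0) auto
  also have "(\<integral>\<^sup>+u. ennreal (u powr (-1 - \<beta>)) * indicator {1/r..} u \<partial>lborel) = ennreal (- ((1/r) powr (-1 - \<beta> + 1)) / (-1 - \<beta> + 1))"
    using \<beta> r by (intro nn_integral_has_integral_lebesgue' has_integral_powr_to_inf) auto
  also have "ennreal r * ennreal ((1/r) powr (-\<beta> + 1) / (-\<beta> + 1)) + ennreal (- ((1/r) powr (-1 - \<beta> + 1)) / (-1 - \<beta> + 1))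
     = ennreal (r * ((1/r) powr (-\<beta> + 1) / (-\<beta> + 1)) + (- ((1/r) powr (-1 - \<beta> + 1)) / (-1 - \<beta> + 1)))"
  proof -
    have "ennreal r * ennreal ((1/r) powr (-\<beta> + 1) / (-\<beta> + 1)) = ennreal (r * ((1/r) powr (-\<beta> + 1) / (-\<beta> + 1)))"
      using \<beta> r by (intro ennreal_mult[symmetric]) auto
    then show ?thesis using \<beta> r by (simp only:) (intro ennreal_plus[symmetric], auto)
  qed
  also have "r * ((1/r) powr (-\<beta> + 1) / (-\<beta> + 1)) + (- ((1/r) powr (-1 - \<beta> + 1)) / (-1 - \<beta> + 1)) = (1 / (1 - \<beta>) + 1 / \<beta>) * r powr \<beta>"
  proof -
    have "(1/r) powr (-\<beta>) = r powr \<beta>" using r by (simp add: powr_divide powr_minus field_simps)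
    moreover have "r * (1/r) powr (-\<beta> + 1) = r powr \<beta>"
    proof -
      have "(1/r) powr (-\<beta> + 1) = (1/r) powr (-\<beta>) * (1/r)" using r powr_add[of "1/r" "-\<beta>" 1] by simp
      then show ?thesis using r \<open>(1/r) powr (-\<beta>) = r powr \<beta>\<close> by simp
    qed
    ultimately show ?thesis using \<beta> by (simp add: field_simps)
  qed
  finally show ?thesis .
qed

text \<open>In the limiting case of index 0 the power 1/u is not integrable at infinity, so the
  exponential is retained beyond 1. With m = \<open>max 1 r\<close> the ranges up to 1 / m, from
  there to 1, and beyond 1 contribute 1, ln m and Gamma(1/p) / p. The logarithm is the source of the
  logarithmic moments in \<open>TS_admissible\<close> for \<alpha> = 0 and \<alpha> = 1.\<close>

lemma nn_integral_min_log_le: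
  assumes p: "0 < p" and r: "0 < r"
  shows "(\<integral>\<^sup>+u. ennreal (stretched_exp p (-1) u * min (u * r) 1) \<partial>lborel) \<le> ennreal (1 + Gamma (1 / p) / p + ln (max 1 r))"
proof -
  define m where "m = max 1 r"
  have m: "1 \<le> m" "r \<le> m" by (auto simp: m_def)
  have G: "0 \<le> Gamma (1 / p) / p" using p by (simp add: Gamma_real_pos less_imp_le)
  have "(\<integral>\<^sup>+u. ennreal (stretched_exp p (-1) u * min (u * r) 1) \<partial>lborel) \<le>
     (\<integral>\<^sup>+u. (ennreal m * indicator {0..1/m} u + ennreal (1 / u) * indicator {1/m..1} u) + ennreal (stretched_exp p 0 u) \<partial>lborel)"
  proof (rule nn_integral_mono)
    fix u
    show "ennreal (stretched_exp p (-1) u * min (u * r) 1) \<le>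
      (ennreal m * indicator {0..1/m} u + ennreal (1 / u) * indicator {1/m..1} u) + ennreal (stretched_exp p 0 u)"
    proof (cases "0 < u")
      case u: True
      have s: "stretched_exp p (-1) u = exp (- (u powr p)) / u" using u by (simp add: stretched_exp_def powr_minus divide_inverse)
      have e: "exp (- (u powr p)) \<le> 1" by simp
      consider "u \<le> 1 / m" | "1 / m \<le> u" "u \<le> 1" | "1 < u" by linarith
      then show ?thesis
      proof cases
        case 1
        have "stretched_exp p (-1) u * min (u * r) 1 \<le> (1 / u) * (u * m)"
          unfolding s using u m r e by (intro mult_mono divide_right_mono) (auto simp: min_le_iff_disj)
        also have "\<dots> = m" using u by simp
        finally have "ennreal (stretched_exp p (-1) u * min (u * r) 1) \<le> ennreal m" by (rule ennreal_leI)
        then show ?thesis using 1 u by (auto intro: order_trans add_increasing2)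
      next
        case 2
        have "stretched_exp p (-1) u * min (u * r) 1 \<le> (1 / u) * 1"
          unfolding s using u r e by (intro mult_mono divide_right_mono) auto
        then have "ennreal (stretched_exp p (-1) u * min (u * r) 1) \<le> ennreal (1 / u)" by (intro ennreal_leI) simp
        then show ?thesis using 2 by (auto intro: order_trans add_increasing add_increasing2)
      next
        case 3
        have "stretched_exp p (-1) u * min (u * r) 1 \<le> (exp (- (u powr p)) / 1) * 1"
          unfolding s using 3 r by (intro mult_mono divide_left_mono) auto
        also have "\<dots> = stretched_exp p 0 u" using u by (simp add: stretched_exp_def)
        finally have "ennreal (stretched_exp p (-1) u * min (u * r) 1) \<le> ennreal (stretched_exp p 0 u)" by (rule ennreal_leI)
        then show ?thesis by (auto intro: order_trans add_increasing)
      qed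
    qed (simp add: stretched_exp_def)
  qed
  also have "\<dots> = ((\<integral>\<^sup>+u. ennreal m * indicator {0..1/m} u \<partial>lborel) + (\<integral>\<^sup>+u. ennreal (1 / u) * indicator {1/m..1} u \<partial>lborel)) + (\<integral>\<^sup>+u. ennreal (stretched_exp p 0 u) \<partial>lborel)"
    by (simp add: nn_integral_add)
  also have "(\<integral>\<^sup>+u. ennreal m * indicator {0..1/m} u \<partial>lborel) = ennreal 1"
    using m by (subst nn_integral_cmult_indicator) (auto simp: ennreal_mult''[symmetric])
  also have "(\<integral>\<^sup>+u. ennreal (1 / u) * indicator {1/m..1} u \<partial>lborel) = ennreal (ln m)"
  proof (rule nn_integral_has_integral_lebesgue')
    have "((\<lambda>u. 1 / u) has_integral ln 1 - ln (1 / m)) {1/m..1}"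
    proof (rule fundamental_theorem_of_calculus)
      show "(ln has_vector_derivative 1 / u) (at u within {1/m..1})" if "u \<in> {1/m..1}" for u
      proof -
        have "0 < u" using that m by (auto intro: less_le_trans[of 0 "1/m"])
        then have "(ln has_real_derivative 1 / u) (at u)" by (auto intro!: derivative_eq_intros)
        then show ?thesis by (simp add: has_real_derivative_iff_has_vector_derivative has_vector_derivative_at_within)
      qed
    qed (use m in simp)
    then show "((\<lambda>u. 1 / u) has_integral ln m) {1/m..1}" using m by (simp add: ln_div)
    show "0 \<le> 1 / u" if "u \<in> {1/m..1}" for u using that m by (auto intro: order_trans[of 0 "1/m"])
  qed
  also have "(\<integral>\<^sup>+u. ennreal (stretched_exp p 0 u) \<partial>lborel) = ennreal (Gamma (1 / p) / p)"
    using integrable_stretched_exp[OF p, of 0] integral_stretched_exp[OF p, of 0] by (subst nn_integral_eq_integral) auto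
  also have "(ennreal 1 + ennreal (ln m)) + ennreal (Gamma (1 / p) / p) = ennreal (1 + Gamma (1 / p) / p + ln m)"
    using G m by (simp add: ennreal_plus[symmetric] del: ennreal_plus ennreal_1)
  finally show ?thesis by (simp add: m_def)
qed

section \<open>Admissibility of lower indices\<close>

lemma TS_admissible_moment:
  fixes R :: "(real^'d) measure"
  assumes "TS_admissible \<alpha> R" "0 < \<alpha>" "\<alpha> < 2"
  shows "(\<integral>\<^sup>+x. ennreal (norm x powr \<alpha>) \<partial>R) < \<infinity>"
  using assms by (simp add: TS_admissible_def)

lemma nn_integral_const_add_less_top:
  assumes "finite_measure R" and [measurable]: "f \<in> borel_measurable R" and "(\<integral>\<^sup>+x. ennreal (f x) \<partial>R) < \<infinity>"
    and "\<And>x. 0 \<le> f x" "0 \<le> c" "0 \<le> d" and le: "\<And>x. g x \<le> c + d * f x"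
  shows "(\<integral>\<^sup>+x. ennreal (g x) \<partial>R) < \<infinity>"
proof -
  interpret finite_measure R by fact
  have "(\<integral>\<^sup>+x. ennreal (g x) \<partial>R) \<le> (\<integral>\<^sup>+x. ennreal c + ennreal d * ennreal (f x) \<partial>R)"
    using assms by (intro nn_integral_mono) (simp add: ennreal_mult[symmetric] ennreal_plus[symmetric] ennreal_leI del: ennreal_plus)
  also have "\<dots> = ennreal c * emeasure R (space R) + ennreal d * (\<integral>\<^sup>+x. ennreal (f x) \<partial>R)"
    by (simp add: nn_integral_add nn_integral_cmult)
  also have "\<dots> < \<infinity>" using assms(3) by (simp add: ennreal_mult_less_top emeasure_eq_measure)
  finally show ?thesis .
qed

lemma nn_integral_indicator_mult:
  "(\<integral>\<^sup>+x\<in>A. ennreal (f x) \<partial>R) = (\<integral>\<^sup>+x. ennreal (indicator A x * f x) \<partial>R)"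
  by (intro nn_integral_cong) (auto simp: indicator_def)

text \<open>Since R is finite, only large |x| matters. There |x|^\<beta>, ln |x| and, for \<beta> =
  1 < \<alpha>, also |x| ln |x| are dominated by multiples of |x|^\<alpha>, by ln r \<le> r^\<delta>
  / \<delta>. Applied to the indices \<alpha> - n p.\<close>

lemma TS_admissible_lower:
  fixes R :: "(real^'d) measure"
  assumes R: "finite_measure R" and ad: "TS_admissible \<alpha> R" and \<beta>: "0 \<le> \<beta>" "\<beta> < \<alpha>" and \<alpha>: "\<alpha> < 2"
  shows "TS_admissible \<beta> R"
proof -
  interpret finite_measure R by fact
  have s[measurable_cong]: "sets R = sets borel" and R0: "emeasure R {0} = 0" using ad by (auto simp: TS_admissible_def)
  have a0: "0 < \<alpha>" using \<beta> by simp
  note M = TS_admissible_moment[OF ad a0 \<alpha>]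
  have bound: "(\<integral>\<^sup>+x. ennreal (g x) \<partial>R) < \<infinity>" if "0 \<le> c" "0 \<le> d" "\<And>x. g x \<le> c + d * norm x powr \<alpha>" for g :: "real^'d \<Rightarrow> real" and c d
    by (rule nn_integral_const_add_less_top[OF R _ M _ that(1,2,3)]) auto
  have "(\<integral>\<^sup>+x. ennreal (norm x powr \<beta>) \<partial>R) < \<infinity>"
  proof (rule bound[of 1 1])
    fix x :: "real^'d"
    show "norm x powr \<beta> \<le> 1 + 1 * norm x powr \<alpha>"
    proof (cases "norm x \<le> 1")
      case True
      have "norm x powr \<beta> \<le> 1 powr \<beta>" using True \<beta> by (intro powr_mono2) auto
      then show ?thesis by (simp add: add_increasing2)
    next
      case False
      have "norm x powr \<beta> \<le> norm x powr \<alpha>" using False \<beta> by (intro powr_mono) auto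
      then show ?thesis by simp
    qed
  qed auto
  moreover have "emeasure R {x. norm x \<le> 2} + (\<integral>\<^sup>+x\<in>{x. norm x > 2}. ennreal (ln (norm x)) \<partial>R) < \<infinity>"
  proof -
    have "(\<integral>\<^sup>+x\<in>{x. norm x > 2}. ennreal (ln (norm x)) \<partial>R) < \<infinity>"
      unfolding nn_integral_indicator_mult
    proof (rule bound[of 0 "1 / \<alpha>"])
      show "indicator {x. 2 < norm x} x * ln (norm x) \<le> 0 + 1 / \<alpha> * norm x powr \<alpha>" for x :: "real^'d"
        using ln_powr_bound[of "norm x" \<alpha>] a0 by (cases "2 < norm x") auto
    qed (use a0 in auto)
    then show ?thesis by (simp add: emeasure_eq_measure)
  qed
  moreover have "(\<integral>\<^sup>+x\<in>{x. norm x \<le> 2}. ennreal (norm x) \<partial>R) + (\<integral>\<^sup>+x\<in>{x. norm x > 2}. ennreal (norm x * ln (norm x)) \<partial>R) < \<infinity>"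
    if "\<beta> = 1"
  proof -
    have a1: "0 < \<alpha> - 1" using that \<beta> by simp
    have "(\<integral>\<^sup>+x\<in>{x. norm x \<le> 2}. ennreal (norm x) \<partial>R) < \<infinity>"
      unfolding nn_integral_indicator_mult by (rule bound[of 2 0]) (auto simp: indicator_def)
    moreover have "(\<integral>\<^sup>+x\<in>{x. norm x > 2}. ennreal (norm x * ln (norm x)) \<partial>R) < \<infinity>"
      unfolding nn_integral_indicator_mult
    proof (rule bound[of 0 "1 / (\<alpha> - 1)"])
      fix x :: "real^'d"
      show "indicator {x. 2 < norm x} x * (norm x * ln (norm x)) \<le> 0 + 1 / (\<alpha> - 1) * norm x powr \<alpha>"
      proof (cases "2 < norm x")
        case True
        have "norm x * ln (norm x) \<le> norm x * (norm x powr (\<alpha> - 1) / (\<alpha> - 1))"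
          using True ln_powr_bound[of "norm x" "\<alpha> - 1"] a1 by (intro mult_left_mono) auto
        also have "norm x * norm x powr (\<alpha> - 1) = norm x powr \<alpha>"
          using True powr_add[of "norm x" 1 "\<alpha> - 1"] by simp
        then have "norm x * (norm x powr (\<alpha> - 1) / (\<alpha> - 1)) = 1 / (\<alpha> - 1) * norm x powr \<alpha>" by simp
        finally show ?thesis using True by simp
      qed (use a1 in simp)
    qed (use a1 in auto)
    ultimately show ?thesis by simp
  qed
  ultimately show ?thesis using s R0 by (simp add: TS_admissible_def)
qed

lemma TS_admissible_scale:
  fixes R :: "(real^'d) measure"
  assumes "TS_admissible \<alpha> R"
  shows "TS_admissible \<alpha> (scale_measure (ennreal c) R)"
  using assms
  by (auto simp: TS_admissible_def nn_integral_scale_measure ennreal_mult_less_top distrib_left[symmetric])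

lemma finite_measure_scale:
  assumes "finite_measure R"
  shows "finite_measure (scale_measure (ennreal c) R)"
proof -
  interpret finite_measure R by fact
  show ?thesis by (rule finite_measureI) (simp add: space_scale_measure ennreal_mult_eq_top_iff)
qed

definition TS_drift :: "real \<Rightarrow> real" where
  "TS_drift \<beta> = (if \<beta> < 1 then 0 else 1)"

lemma ID_integrand_TS_h: "ID_integrand (TS_h \<beta>) = ID_kernel (TS_drift \<beta>)"
  by (auto simp: fun_eq_iff ID_integrand_def ID_kernel_def TS_h_def TS_drift_def)

text \<open>For \<beta> \<ge> 1 one factor u of the weight is absorbed by the density and one factor
  |x| comes out. Both centerings thus lead to the same truncated integral with an index \<beta> -
  \<open>TS_drift \<beta>\<close> in [0, 1) whenever \<beta> < 2.\<close>

lemma stretched_exp_mult_levy_weight: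
  assumes "0 \<le> \<beta>"
  shows "stretched_exp p (-1 - \<beta>) u * levy_weight (TS_drift \<beta>) (u *\<^sub>R x) =
    norm x powr TS_drift \<beta> * (stretched_exp p (-1 - (\<beta> - TS_drift \<beta>)) u * min (u * norm x) 1)"
proof (cases "0 < u \<and> x \<noteq> 0")
  case True
  show ?thesis
  proof (cases "\<beta> < 1")
    case False
    have "levy_weight 1 (u *\<^sub>R x) = u * (norm x * min (u * norm x) 1)"
      using True by (simp add: levy_weight_def power2_eq_square min_mult_distrib_left ac_simps)
    then have "stretched_exp p (-1 - \<beta>) u * levy_weight 1 (u *\<^sub>R x) = (u * stretched_exp p (-1 - \<beta>) u) * (norm x * min (u * norm x) 1)"
      by simp
    also have "u * stretched_exp p (-1 - \<beta>) u = stretched_exp p (-1 - (\<beta> - 1)) u"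
      using stretched_exp_mult_self[of u p "-1 - \<beta>"] by (simp add: algebra_simps)
    finally show ?thesis using False True by (simp add: TS_drift_def)
  qed (use True in \<open>simp add: TS_drift_def levy_weight_def\<close>)
qed (auto simp: stretched_exp_def levy_weight_def)

text \<open>With c the centering and \<delta> = \<beta> - c in [0, 1), the power bound handles
  \<delta> > 0 and recombines |x|^c |x|^\<delta> to |x|^\<beta>. The remaining cases \<beta> = 0 and
  \<beta> = 1 use the logarithmic bound together with the moments of ln |x| and |x| ln |x|.\<close>

lemma nn_integral_levy_weight_TS_levy:
  fixes R :: "(real^'d) measure"
  assumes R: "finite_measure R" and ad: "TS_admissible \<beta> R" and \<beta>: "0 \<le> \<beta>" "\<beta> < 2" and p: "0 < p"
  shows "(\<integral>\<^sup>+y. ennreal (levy_weight (TS_drift \<beta>) y) \<partial>TS_levy p \<beta> R) < \<infinity>"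
proof -
  interpret finite_measure R by fact
  have s[measurable_cong]: "sets R = sets borel" using ad by (auto simp: TS_admissible_def)
  define c where "c = TS_drift \<beta>"
  define \<delta> where "\<delta> = \<beta> - c"
  have c: "c = 0 \<or> c = 1" and \<delta>: "0 \<le> \<delta>" "\<delta> < 1" using \<beta> by (auto simp: c_def \<delta>_def TS_drift_def)
  define J where "J x = (\<integral>\<^sup>+u. ennreal (stretched_exp p (-1 - \<delta>) u * min (u * norm x) 1) \<partial>lborel)" for x :: "real^'d"
  have eq: "(\<integral>\<^sup>+y. ennreal (levy_weight c y) \<partial>TS_levy p \<beta> R) = (\<integral>\<^sup>+x. ennreal (norm x powr c) * J x \<partial>R)"
  proof -
    have m: "(\<lambda>u. ennreal (stretched_exp p (-1 - \<delta>) u * min (u * norm x) 1)) \<in> borel_measurable lborel" for x :: "real^'d"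
      by measurable
    have "(\<integral>\<^sup>+y. ennreal (levy_weight c y) \<partial>TS_levy p \<beta> R) =
      (\<integral>\<^sup>+x. \<integral>\<^sup>+u. ennreal (stretched_exp p (-1 - \<beta>) u) * ennreal (levy_weight c (u *\<^sub>R x)) \<partial>lborel \<partial>R)"
      by (rule nn_integral_TS_levy[OF R s]) simp
    also have "\<dots> = (\<integral>\<^sup>+x. \<integral>\<^sup>+u. ennreal (norm x powr c) * ennreal (stretched_exp p (-1 - \<delta>) u * min (u * norm x) 1) \<partial>lborel \<partial>R)"
      by (intro nn_integral_cong)
        (simp add: ennreal_mult'[symmetric] stretched_exp_mult_levy_weight[OF \<beta>(1), folded c_def, folded \<delta>_def])
    also have "\<dots> = (\<integral>\<^sup>+x. ennreal (norm x powr c) * J x \<partial>R)"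
      unfolding J_def by (subst nn_integral_cmult[OF m]) simp
    finally show ?thesis .
  qed
  show ?thesis
  proof (cases "\<delta> = 0")
    case False
    define C where "C = 1 / (1 - \<delta>) + 1 / \<delta>"
    have C: "0 \<le> C" using False \<delta> by (simp add: C_def)
    have b0: "0 < \<beta>" using False \<delta> c by (auto simp: \<delta>_def)
    have "(\<integral>\<^sup>+x. ennreal (norm x powr c) * J x \<partial>R) \<le> (\<integral>\<^sup>+x. ennreal (C * norm x powr \<beta>) \<partial>R)"
    proof (rule nn_integral_mono)
      fix x :: "real^'d"
      show "ennreal (norm x powr c) * J x \<le> ennreal (C * norm x powr \<beta>)"
      proof (cases "x = 0")
        case x: False
        have "J x \<le> ennreal (C * norm x powr \<delta>)"
          unfolding J_def C_def using False \<delta> x by (intro nn_integral_min_powr_le) auto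
        then have "ennreal (norm x powr c) * J x \<le> ennreal (norm x powr c) * ennreal (C * norm x powr \<delta>)"
          by (intro mult_left_mono) auto
        also have "\<dots> = ennreal (C * norm x powr \<beta>)"
          by (simp add: ennreal_mult'[symmetric] \<delta>_def powr_diff x)
        finally show ?thesis .
      qed simp
    qed
    also have "\<dots> = ennreal C * (\<integral>\<^sup>+x. ennreal (norm x powr \<beta>) \<partial>R)"
      using C by (simp add: ennreal_mult nn_integral_cmult)
    also have "\<dots> < \<infinity>" using TS_admissible_moment[OF ad b0 \<beta>(2)] by (simp add: ennreal_mult_less_top)
    finally show ?thesis unfolding c_def[symmetric] eq .
  next
    case True
    define C where "C = 1 + Gamma (1 / p) / p"
    have C: "0 \<le> C" using p by (simp add: C_def Gamma_real_pos less_imp_le)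
    have J: "J x \<le> ennreal (C + ln (max 1 (norm x)))" for x
    proof (cases "x = 0")
      case False
      then show ?thesis using nn_integral_min_log_le[OF p, of "norm x"] True by (simp add: J_def C_def)
    qed (simp add: J_def)
    have lnb: "ln (max 1 (norm x)) \<le> 1 + indicator {x. norm x > 2} x * ln (norm x)" for x :: "real^'d"
    proof (cases "norm x > 2")
      case False
      then have "ln (max 1 (norm x)) \<le> ln 2" by simp
      also have "ln (2::real) \<le> 1" using ln_le_minus_one[of 2] by simp
      finally show ?thesis using False by simp
    qed (simp add: max_def)
    have ln0: "0 \<le> indicator {x. norm x > 2} x * ln (norm x)" for x :: "real^'d" by (auto simp: indicator_def)
    define e where "e x = indicator {x. norm x > 2} x * ln (norm x)" for x :: "real^'d"
    have [measurable]: "e \<in> borel_measurable borel" unfolding e_def by measurable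
    show ?thesis
    proof (cases "c = 0")
      case c0: True
      then have b: "\<beta> = 0" using True by (simp add: \<delta>_def)
      have "(\<integral>\<^sup>+x. ennreal (norm x powr c) * J x \<partial>R) \<le> (\<integral>\<^sup>+x. ennreal ((C + 1) + 1 * e x) \<partial>R)"
      proof (rule nn_integral_mono)
        fix x :: "real^'d"
        have "ennreal (norm x powr c) * J x \<le> 1 * J x" unfolding c0 by (intro mult_right_mono) auto
        also have "\<dots> \<le> ennreal ((C + 1) + 1 * e x)" using J[of x] lnb[of x]
          by (auto simp: e_def intro!: order_trans[OF J] ennreal_leI)
        finally show "ennreal (norm x powr c) * J x \<le> ennreal ((C + 1) + 1 * e x)" .
      qed
      also have "\<dots> < \<infinity>"
      proof (rule nn_integral_const_add_less_top[OF R, where f=e and c="C + 1" and d=1])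
        show "(\<integral>\<^sup>+x. ennreal (e x) \<partial>R) < \<infinity>"
          unfolding e_def using ad b by (simp add: TS_admissible_def nn_integral_indicator_mult)
      qed (use C ln0 in \<open>auto simp: e_def\<close>)
      finally show ?thesis unfolding c_def[symmetric] eq .
    next
      case False
      then have c1: "c = 1" and b: "\<beta> = 1" using c True by (auto simp: \<delta>_def)
      have fin1: "(\<integral>\<^sup>+x. ennreal (norm x) \<partial>R) < \<infinity>"
        using TS_admissible_moment[OF ad] b by simp
      have fin2: "(\<integral>\<^sup>+x. ennreal (norm x * e x) \<partial>R) < \<infinity>"
      proof -
        have "(\<integral>\<^sup>+x. ennreal (norm x * e x) \<partial>R) = (\<integral>\<^sup>+x\<in>{x. norm x > 2}. ennreal (norm x * ln (norm x)) \<partial>R)"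
          unfolding nn_integral_indicator_mult e_def by (intro nn_integral_cong) (simp add: mult.left_commute)
        then show ?thesis using ad b by (simp add: TS_admissible_def)
      qed
      have "(\<integral>\<^sup>+x. ennreal (norm x powr c) * J x \<partial>R) \<le> (\<integral>\<^sup>+x. ennreal (C + 1) * ennreal (norm x) + ennreal (norm x * e x) \<partial>R)"
      proof (rule nn_integral_mono)
        fix x :: "real^'d"
        have "ennreal (norm x powr c) * J x \<le> ennreal (norm x) * ennreal ((C + 1) + e x)"
          unfolding c1 using J[of x] lnb[of x]
          by (intro mult_mono) (auto simp: e_def intro!: order_trans[OF J] ennreal_leI)
        also have "\<dots> = ennreal (C + 1) * ennreal (norm x) + ennreal (norm x * e x)"
          using C ln0[of x] by (simp add: e_def ennreal_mult[symmetric] ennreal_plus[symmetric] algebra_simps del: ennreal_plus)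
        finally show "ennreal (norm x powr c) * J x \<le> ennreal (C + 1) * ennreal (norm x) + ennreal (norm x * e x)" .
      qed
      also have "\<dots> = ennreal (C + 1) * (\<integral>\<^sup>+x. ennreal (norm x) \<partial>R) + (\<integral>\<^sup>+x. ennreal (norm x * e x) \<partial>R)"
        by (simp add: nn_integral_add nn_integral_cmult)
      also have "\<dots> < \<infinity>" using fin1 fin2 by (simp add: ennreal_mult_less_top)
      finally show ?thesis unfolding c_def[symmetric] eq .
    qed
  qed
qed

text \<open>\<open>exists_ID\<close> gives the law, and the remaining work is to check that
  \<open>TS_levy\<close> is a Levy measure. It has no mass at 0 because u x = 0 with u > 0 forces x
  = 0, an R-null event.\<close>

lemma exists_TS:
  fixes R :: "(real^'d) measure"
  assumes R: "finite_measure R" and ad: "TS_admissible \<beta> R" and \<beta>: "0 \<le> \<beta>" "\<beta> < 2" and p: "0 < p"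
  shows "\<exists>\<mu>. is_TS \<mu> p \<beta> R 0"
proof -
  have s[measurable_cong]: "sets R = sets borel" and R0: "emeasure R {0} = 0" using ad by (auto simp: TS_admissible_def)
  let ?L = "TS_levy p \<beta> R" and ?c = "TS_drift \<beta>"
  note w = nn_integral_levy_weight_TS_levy[OF assms]
  have c: "?c = 0 \<or> ?c = 1" by (simp add: TS_drift_def)
  obtain \<mu> where \<mu>: "prob_space \<mu>" "sets \<mu> = sets borel" "\<And>z. (CLINT x|\<mu>. iexp (z \<bullet> x)) = exp (CLINT x|?L. ID_kernel ?c z x)"
    using exists_ID[OF sets_TS_levy w c] by blast
  have "emeasure ?L {0} = 0"
  proof -
    have "emeasure ?L {0} = (\<integral>\<^sup>+y. indicator {0} y \<partial>?L)" by (simp add: sets_TS_levy)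
    also have "\<dots> = (\<integral>\<^sup>+x. \<integral>\<^sup>+u. ennreal (stretched_exp p (-1 - \<beta>) u) * indicator {0} (u *\<^sub>R x) \<partial>lborel \<partial>R)"
      by (rule nn_integral_TS_levy[OF R s]) simp
    also have "\<dots> = (\<integral>\<^sup>+x. 0 \<partial>R)"
    proof (rule nn_integral_cong_AE)
      have "AE x in R. x \<noteq> 0" by (rule AE_I[of _ _ "{0}"]) (use R0 s in auto)
      then show "AE x in R. (\<integral>\<^sup>+u. ennreal (stretched_exp p (-1 - \<beta>) u) * indicator {0} (u *\<^sub>R x) \<partial>lborel) = 0"
      proof eventually_elim
        case (elim x)
        then have "ennreal (stretched_exp p (-1 - \<beta>) u) * indicator {0} (u *\<^sub>R x) = 0" for u
          by (auto simp: stretched_exp_def indicator_def)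
        then show ?case by (simp only: nn_integral_const mult_zero_left)
      qed
    qed
    finally show ?thesis by simp
  qed
  moreover have "(\<integral>\<^sup>+x. ennreal (min ((norm x)\<^sup>2) 1) \<partial>?L) < \<infinity>"
  proof (rule le_less_trans[OF nn_integral_mono w])
    fix x :: "real^'d"
    have A: "(norm x \<le> 1 \<and> (norm x)\<^sup>2 \<le> norm x) \<or> (1 \<le> norm x \<and> 1 \<le> (norm x)\<^sup>2)"
      using mult_left_le[of "norm x" "norm x"] one_le_power[of "norm x" 2]
      by (cases "norm x \<le> 1") (auto simp: power2_eq_square)
    have "min ((norm x)\<^sup>2) 1 \<le> min (norm x) 1" "min ((norm x)\<^sup>2) 1 \<le> min ((norm x)\<^sup>2) (norm x)"
      using A by (auto simp: min_def)
    then show "ennreal (min ((norm x)\<^sup>2) 1) \<le> ennreal (levy_weight ?c x)"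
      by (auto simp: levy_weight_def intro!: ennreal_leI)
  qed
  moreover have "complex_integrable ?L (ID_kernel ?c z)" for z
    by (rule integrable_levy_weight_bound[OF sets_TS_levy w _ norm_ID_kernel_le[OF c]]) simp
  moreover have "(TS_h \<beta> :: real^'d \<Rightarrow> real) \<in> borel_measurable borel" by (simp add: TS_h_def)
  moreover have "transpose (0 :: real^'d^'d) = 0" by (simp add: transpose_def vec_eq_iff)
  ultimately have "is_ID \<mu> 0 ?L 0 (TS_h \<beta>)"
    using \<mu> by (simp add: is_ID_def levy_measure_def sets_TS_levy ID_integrand_TS_h ID_exponent_def char_vec_def)
  then show ?thesis using p \<beta> ad by (auto simp: is_TS_def)
qed

section \<open>Decomposition of the tempered stable exponent\<close>

text \<open>Along a ray the kernel sees z and x through their inner product only, so the exponents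
  reduce to functions of one real frequency.\<close>

lemma ID_kernel_scaleR: "ID_kernel c z (u *\<^sub>R x) = ID_kernel c (z \<bullet> x) (u::real)"
  by (simp add: ID_kernel_def mult.commute)

lemma ID_kernel_scale: "ID_kernel c (a * w) u = ID_kernel c w (a * u :: real)"
  by (simp add: ID_kernel_def mult.commute mult.left_commute)

text \<open>The contribution of a single direction. The centering \<open>c\<close> is a parameter
  separate from \<beta>, because exponents of the indices \<alpha> - n p are compared under the
  centering of \<alpha>.\<close>

definition TS_exponent :: "real \<Rightarrow> real \<Rightarrow> real \<Rightarrow> real \<Rightarrow> complex" where
  "TS_exponent p \<beta> c w = (CLINT u|lborel. stretched_exp p (-1 - \<beta>) u *\<^sub>R ID_kernel c w u)"

text \<open>At 0 the kernel is of order u^(1+c), so the exponent of u becomes c - \<beta>, which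
  exceeds -1 exactly when \<beta> < 1 + c.\<close>

lemma integrable_TS_exponent:
  assumes p: "0 < p" and c: "(c = 0 \<and> \<beta> < 1) \<or> (c = 1 \<and> \<beta> < 2)"
  shows "complex_integrable lborel (\<lambda>u. stretched_exp p (-1 - \<beta>) u *\<^sub>R ID_kernel c w u)"
proof (rule Bochner_Integration.integrable_bound)
  let ?C = "2 * (1 + (norm w)\<^sup>2)"
  have c': "c = 0 \<or> c = 1" using c by auto
  show "integrable lborel (\<lambda>u. ?C * stretched_exp p (-1 - \<beta> + (1 + c)) u)"
    using p c by (intro integrable_mult_right integrable_stretched_exp) auto
  show "AE u in lborel. norm (stretched_exp p (-1 - \<beta>) u *\<^sub>R ID_kernel c w u) \<le> norm (?C * stretched_exp p (-1 - \<beta> + (1 + c)) u)"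
  proof (rule always_eventually, rule allI)
    fix u
    show "norm (stretched_exp p (-1 - \<beta>) u *\<^sub>R ID_kernel c w u) \<le> norm (?C * stretched_exp p (-1 - \<beta> + (1 + c)) u)"
    proof (cases "0 < u")
      case True
      have "levy_weight c u \<le> u powr (1 + c)"
        using True c' by (auto simp: levy_weight_def)
      then have "norm (ID_kernel c w u) \<le> ?C * u powr (1 + c)"
        by (intro order_trans[OF norm_ID_kernel_le[OF c']] mult_left_mono) auto
      then have "stretched_exp p (-1 - \<beta>) u * norm (ID_kernel c w u) \<le> stretched_exp p (-1 - \<beta>) u * (?C * u powr (1 + c))"
        by (intro mult_left_mono) auto
      also have "\<dots> = ?C * (u powr (1 + c) * stretched_exp p (-1 - \<beta>) u)" by (simp only: ac_simps)
      also have "\<dots> = ?C * stretched_exp p (-1 - \<beta> + (1 + c)) u" by (simp only: stretched_exp_mult_powr)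
      finally have 1: "norm (stretched_exp p (-1 - \<beta>) u *\<^sub>R ID_kernel c w u) \<le> ?C * stretched_exp p (-1 - \<beta> + (1 + c)) u"
        by simp
      show ?thesis by (rule order_trans[OF 1]) (simp only: real_norm_def abs_ge_self)
    qed (simp add: stretched_exp_def)
  qed
qed simp

section \<open>Scaling and decomposition of the radial density\<close>

text \<open>The density of the image of the radial measure with index \<beta> under multiplication
  by \<open>a\<close>.\<close>

definition scaled_stretched_exp :: "real \<Rightarrow> real \<Rightarrow> real \<Rightarrow> real \<Rightarrow> real" where
  "scaled_stretched_exp a p \<beta> u = a powr \<beta> * (indicator {0<..} u * (u powr (-1 - \<beta>) * exp (- (a powr (- p) * u powr p))))"

lemma scaled_stretched_exp_eq:
  assumes a: "0 < a"
  shows "(1 / a) * stretched_exp p (-1 - \<beta>) (u / a) = scaled_stretched_exp a p \<beta> u"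
proof (cases "0 < u")
  case True
  have h1: "(1 / a) * (u / a) powr (-1 - \<beta>) = a powr \<beta> * u powr (-1 - \<beta>)"
  proof -
    have "(u / a) powr (-1 - \<beta>) = u powr (-1 - \<beta>) / a powr (-1 - \<beta>)" using True a by (simp add: powr_divide)
    also have "a powr (-1 - \<beta>) = 1 / (a * a powr \<beta>)" using a powr_add[of a 1 \<beta>] powr_minus[of a "1 + \<beta>"]
      by (simp add: divide_inverse)
    finally show ?thesis using a by simp
  qed
  have h2: "(u / a) powr p = a powr (- p) * u powr p"
    using True a by (simp add: powr_divide powr_minus_divide)
  have "(1 / a) * stretched_exp p (-1 - \<beta>) (u / a) = ((1 / a) * (u / a) powr (-1 - \<beta>)) * exp (- ((u / a) powr p))"
    using True a by (simp add: stretched_exp_def)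
  also have "\<dots> = scaled_stretched_exp a p \<beta> u"
    unfolding h1 h2 using True by (simp add: scaled_stretched_exp_def)
  finally show ?thesis .
qed (use a in \<open>simp add: stretched_exp_def scaled_stretched_exp_def field_simps\<close>)

lemma TS_exponent_scale:
  assumes p: "0 < p" and c: "(c = 0 \<and> \<beta> < 1) \<or> (c = 1 \<and> \<beta> < 2)" and a: "0 < a"
  shows "complex_integrable lborel (\<lambda>u. scaled_stretched_exp a p \<beta> u *\<^sub>R ID_kernel c w u)"
    and "TS_exponent p \<beta> c (a * w) = (CLINT u|lborel. scaled_stretched_exp a p \<beta> u *\<^sub>R ID_kernel c w u)"
proof -
  let ?f = "\<lambda>u. stretched_exp p (-1 - \<beta>) u *\<^sub>R ID_kernel c (a * w) u"
  have eq: "(1 / a) *\<^sub>R ?f (0 + (1 / a) * u) = scaled_stretched_exp a p \<beta> u *\<^sub>R ID_kernel c w u" for u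
    using a by (simp add: scaled_stretched_exp_eq[OF a, symmetric] ID_kernel_scale)
  have "complex_integrable lborel (\<lambda>u. (1 / a) *\<^sub>R ?f (0 + (1 / a) * u))"
    using a by (intro integrable_scaleR_right lborel_integrable_real_affine integrable_TS_exponent p c) auto
  then show "complex_integrable lborel (\<lambda>u. scaled_stretched_exp a p \<beta> u *\<^sub>R ID_kernel c w u)" unfolding eq .
  have "TS_exponent p \<beta> c (a * w) = \<bar>1 / a\<bar> *\<^sub>R (CLINT u|lborel. ?f (0 + (1 / a) * u))"
    unfolding TS_exponent_def using a by (intro lborel_integral_real_affine) auto
  also have "\<dots> = (CLINT u|lborel. (1 / a) *\<^sub>R ?f (0 + (1 / a) * u))"
    using a by (simp only: integral_scaleR_right abs_of_pos divide_pos_pos zero_less_one)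
  finally show "TS_exponent p \<beta> c (a * w) = (CLINT u|lborel. scaled_stretched_exp a p \<beta> u *\<^sub>R ID_kernel c w u)"
    unfolding eq .
qed

lemma TS_density_decomposition:
  assumes p: "0 < p" and a: "0 < a" "a < 1"
  shows "stretched_exp p (-1 - \<alpha>) u - scaled_stretched_exp a p \<alpha> u =
    (1 - a powr \<alpha>) * stretched_exp p (-1 - \<alpha>) u
    + (\<Sum>n\<in>{1..<Suc k}. (1 - a powr p) ^ n / fact n * scaled_stretched_exp a p (\<alpha> - real n * p) u)
    + a powr \<alpha> * IGa_kernel \<alpha> (Suc k) p (a powr (- p)) u"
proof (cases "0 < u")
  case u: True
  define \<eta> v X where "\<eta> = a powr (- p)" and "v = u powr p" and "X = u powr (-1 - \<alpha>)"
  have \<eta>: "1 < \<eta>" unfolding \<eta>_def using a p powr_less_mono2_neg[of "-p" a 1] by simp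
  have v: "0 < v" using u by (simp add: v_def)
  have ap: "a powr p * \<eta> = 1" using a by (simp add: \<eta>_def powr_minus)
  \<comment> \<open>Scaling by \<open>a\<close> produces a^(\<alpha> - n p) = a^\<alpha> \<eta>^n,
    and (1 - a^p) \<eta> = \<eta> - 1. So the weight (1 - a^p)^n / n! of R_n is exactly what turns
    the scaled density of index \<alpha> - n p into the n-th Erlang term.\<close>
  have summand: "(1 - a powr p) ^ n / fact n * scaled_stretched_exp a p (\<alpha> - real n * p) u
     = a powr \<alpha> * X * exp (- (\<eta> * v)) * (((\<eta> - 1) * v) ^ n / fact n)" for n
  proof -
    have "a powr (\<alpha> - real n * p) = a powr \<alpha> * \<eta> ^ n"
    proof -
      have "\<eta> ^ n = a powr (- p * real n)" using a powr_realpow[of "a powr (- p)" n] by (simp add: \<eta>_def powr_powr)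
      then show ?thesis by (simp add: powr_add[symmetric] algebra_simps)
    qed
    moreover have "u powr (-1 - (\<alpha> - real n * p)) = X * v ^ n"
    proof -
      have "v ^ n = u powr (p * real n)" using u powr_realpow[of "u powr p" n] by (simp add: v_def powr_powr)
      then show ?thesis by (simp add: X_def powr_add[symmetric] algebra_simps)
    qed
    moreover have "(1 - a powr p) * \<eta> = \<eta> - 1" using ap by (simp add: algebra_simps)
    then have "(1 - a powr p) ^ n * \<eta> ^ n = (\<eta> - 1) ^ n" by (metis power_mult_distrib)
    ultimately show ?thesis using u
      by (simp add: scaled_stretched_exp_def \<eta>_def[symmetric] v_def[symmetric] power_mult_distrib)
  qed
  define S where "S = (\<Sum>n\<le>k. ((\<eta> - 1) * v) ^ n / fact n)"
  \<comment> \<open>The Erlang term with n = 0 equals 1; it is accounted for by the part belonging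
    to X_0.\<close>
  have S: "(\<Sum>n\<in>{1..<Suc k}. ((\<eta> - 1) * v) ^ n / fact n) = S - 1"
    unfolding S_def using sum.atLeast_Suc_atMost[of 0 k "\<lambda>n. ((\<eta> - 1) * v) ^ n / fact n"]
    by (simp add: atLeast0AtMost atLeastLessThanSuc_atLeastAtMost)
  have "IGa_kernel \<alpha> (Suc k) p \<eta> u = (1 - S * exp (- ((\<eta> - 1) * v))) * (X * exp (- v))"
    using u v unfolding IGa_kernel_eq[OF \<eta>] v_def[symmetric]
    by (simp add: erlang_CDF_def S_def stretched_exp_def v_def[symmetric] X_def[symmetric] sum_distrib_right del: minus_diff_eq)
  also have "\<dots> = X * (exp (- v) - S * exp (- (\<eta> * v)))"
  proof -
    have "exp (- ((\<eta> - 1) * v)) * exp (- v) = exp (- (\<eta> * v))" by (simp add: exp_add[symmetric] algebra_simps)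
    then show ?thesis by (simp add: algebra_simps)
  qed
  finally have G: "IGa_kernel \<alpha> (Suc k) p \<eta> u = X * (exp (- v) - S * exp (- (\<eta> * v)))" .
  have sm: "(\<Sum>n\<in>{1..<Suc k}. (1 - a powr p) ^ n / fact n * scaled_stretched_exp a p (\<alpha> - real n * p) u)
    = a powr \<alpha> * X * exp (- (\<eta> * v)) * (S - 1)"
    by (simp only: summand sum_distrib_left[symmetric] S)
  have se: "stretched_exp p (-1 - \<alpha>) u = X * exp (- v)" "scaled_stretched_exp a p \<alpha> u = a powr \<alpha> * (X * exp (- (\<eta> * v)))"
    using u by (simp_all add: stretched_exp_def scaled_stretched_exp_def X_def v_def \<eta>_def)
  show ?thesis unfolding sm \<eta>_def[symmetric] G se by (simp add: algebra_simps)
qed (simp add: stretched_exp_def scaled_stretched_exp_def IGa_kernel_def)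

text \<open>The jump density is integrable, so the compensator can be split off as a drift. Its
  integral is the constant that appears in b_0.\<close>

lemma integrable_IGa_ID_kernel:
  assumes p: "0 < p" and \<eta>: "1 < \<eta>" and \<alpha>: "\<alpha> < p * real (Suc k)" and c: "c = 0 \<or> c = 1"
  shows "complex_integrable lborel (\<lambda>u. IGa_kernel \<alpha> (Suc k) p \<eta> u *\<^sub>R (iexp (w * u) - 1))"
    and "complex_integrable lborel (\<lambda>u. IGa_kernel \<alpha> (Suc k) p \<eta> u *\<^sub>R ID_kernel c w u)"
    and "(CLINT u|lborel. IGa_kernel \<alpha> (Suc k) p \<eta> u *\<^sub>R ID_kernel c w u) =
      (CLINT u|lborel. IGa_kernel \<alpha> (Suc k) p \<eta> u *\<^sub>R (iexp (w * u) - 1)) - \<i> * complex_of_real (c * w * IGa_K (\<alpha> - 1) (real (Suc k)) p \<eta>)"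
proof -
  let ?g = "IGa_kernel \<alpha> (Suc k) p \<eta>" and ?h = "IGa_kernel (\<alpha> - 1) (Suc k) p \<eta>"
  have [measurable]: "?g \<in> borel_measurable borel" using \<eta> by (rule borel_measurable_IGa_kernel)
  have "\<alpha> - 1 < p * real (Suc k)" using \<alpha> by simp
  then have ih: "integrable lborel ?h" by (rule integrable_IGa_kernel[OF p \<eta>])
  have i2: "integrable lborel (\<lambda>u. 2 * ?g u)" using integrable_IGa_kernel[OF p \<eta> \<alpha>] by simp
  show 1: "complex_integrable lborel (\<lambda>u. ?g u *\<^sub>R (iexp (w * u) - 1))"
  proof (rule Bochner_Integration.integrable_bound[OF i2])
    show "AE u in lborel. norm (?g u *\<^sub>R (iexp (w * u) - 1)) \<le> norm (2 * ?g u)"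
    proof (rule always_eventually, rule allI)
      fix u
      have "norm (iexp (w * u) - 1) \<le> 2" using iexp_approx2[of "w * u" 0] by simp
      then show "norm (?g u *\<^sub>R (iexp (w * u) - 1)) \<le> norm (2 * ?g u)"
        using mult_left_mono[of "norm (iexp (w * u) - 1)" 2 "\<bar>?g u\<bar>"] by (simp add: mult.commute)
    qed
  qed simp
  have eq: "?g u *\<^sub>R ID_kernel c w u = ?g u *\<^sub>R (iexp (w * u) - 1) - \<i> * complex_of_real (c * w * ?h u)" for u
  proof -
    have "?g u *\<^sub>R ID_kernel c w u = ?g u *\<^sub>R (iexp (w * u) - 1) - \<i> * complex_of_real (c * w * (u * ?g u))"
      by (simp add: ID_kernel_def scaleR_conv_of_real algebra_simps)
    then show ?thesis by (simp only: IGa_kernel_mult_self)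
  qed
  have 2: "complex_integrable lborel (\<lambda>u. \<i> * complex_of_real (c * w * ?h u))"
    using ih by (intro integrable_mult_right integrable_of_real) auto
  show "complex_integrable lborel (\<lambda>u. ?g u *\<^sub>R ID_kernel c w u)"
    unfolding eq by (intro Bochner_Integration.integrable_diff 1 2)
  have "(CLINT u|lborel. ?g u *\<^sub>R ID_kernel c w u) = (CLINT u|lborel. ?g u *\<^sub>R (iexp (w * u) - 1)) - (CLINT u|lborel. \<i> * complex_of_real (c * w * ?h u))"
    unfolding eq by (rule Bochner_Integration.integral_diff[OF 1 2])
  also have "(CLINT u|lborel. \<i> * complex_of_real (c * w * ?h u)) = \<i> * complex_of_real (c * w * IGa_K (\<alpha> - 1) (real (Suc k)) p \<eta>)"
    unfolding IGa_K_eq by (simp only: integral_mult_right_zero integral_complex_of_real)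
  finally show "(CLINT u|lborel. ?g u *\<^sub>R ID_kernel c w u) =
    (CLINT u|lborel. ?g u *\<^sub>R (iexp (w * u) - 1)) - \<i> * complex_of_real (c * w * IGa_K (\<alpha> - 1) (real (Suc k)) p \<eta>)" .
qed

text \<open>The pointwise identity integrated against one kernel with the centering of \<alpha>. All
  terms are integrable: the condition on \<open>c\<close> bounds an index only from above, hence
  passes to \<alpha> - n p.\<close>

lemma TS_exponent_decomposition:
  assumes p: "0 < p" and a: "0 < a" "a < 1" and c: "(c = 0 \<and> \<alpha> < 1) \<or> (c = 1 \<and> \<alpha> < 2)" and k: "\<alpha> < p * real (Suc k)"
  shows "TS_exponent p \<alpha> c w - TS_exponent p \<alpha> c (a * w) =
    complex_of_real (1 - a powr \<alpha>) * TS_exponent p \<alpha> c w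
    + (\<Sum>n\<in>{1..<Suc k}. complex_of_real ((1 - a powr p) ^ n / fact n) * TS_exponent p (\<alpha> - real n * p) c (a * w))
    + complex_of_real (a powr \<alpha>) * (CLINT u|lborel. IGa_kernel \<alpha> (Suc k) p (a powr (- p)) u *\<^sub>R ID_kernel c w u)"
proof -
  let ?E = "ID_kernel c w" and ?\<eta> = "a powr (- p)"
  have \<eta>: "1 < ?\<eta>" using a p powr_less_mono2_neg[of "-p" a 1] by simp
  have cn: "(c = 0 \<and> \<alpha> - real n * p < 1) \<or> (c = 1 \<and> \<alpha> - real n * p < 2)" for n
  proof -
    have "\<alpha> - real n * p \<le> \<alpha>" using p by simp
    then show ?thesis using c by linarith
  qed
  have c': "c = 0 \<or> c = 1" using c by auto
  note i1 = integrable_TS_exponent[OF p c, of w] and i2 = TS_exponent_scale[OF p c a(1), of w]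
    and i3 = TS_exponent_scale[OF p cn a(1), of _ w] and i4 = integrable_IGa_ID_kernel(2)[OF p \<eta> k c', of w]
  let ?q = "\<lambda>n. (1 - a powr p) ^ n / fact n"
  have "TS_exponent p \<alpha> c w - TS_exponent p \<alpha> c (a * w) =
     (CLINT u|lborel. stretched_exp p (-1 - \<alpha>) u *\<^sub>R ?E u - scaled_stretched_exp a p \<alpha> u *\<^sub>R ?E u)"
    unfolding i2(2) unfolding TS_exponent_def by (rule Bochner_Integration.integral_diff[OF i1 i2(1), symmetric])
  also have "\<dots> = (CLINT u|lborel. ((1 - a powr \<alpha>) *\<^sub>R (stretched_exp p (-1 - \<alpha>) u *\<^sub>R ?E u)
    + (\<Sum>n\<in>{1..<Suc k}. ?q n *\<^sub>R (scaled_stretched_exp a p (\<alpha> - real n * p) u *\<^sub>R ?E u)))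
    + a powr \<alpha> *\<^sub>R (IGa_kernel \<alpha> (Suc k) p ?\<eta> u *\<^sub>R ?E u))"
  proof (rule Bochner_Integration.integral_cong[OF refl])
    fix u
    show "stretched_exp p (-1 - \<alpha>) u *\<^sub>R ?E u - scaled_stretched_exp a p \<alpha> u *\<^sub>R ?E u =
      ((1 - a powr \<alpha>) *\<^sub>R (stretched_exp p (-1 - \<alpha>) u *\<^sub>R ?E u)
    + (\<Sum>n\<in>{1..<Suc k}. ?q n *\<^sub>R (scaled_stretched_exp a p (\<alpha> - real n * p) u *\<^sub>R ?E u)))
    + a powr \<alpha> *\<^sub>R (IGa_kernel \<alpha> (Suc k) p ?\<eta> u *\<^sub>R ?E u)"
      unfolding scaleR_diff_left[symmetric] TS_density_decomposition[OF p a, of \<alpha> u k]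
      by (simp only: scaleR_add_left scaleR_scaleR scaleR_sum_left)
  qed
  also have "\<dots> = ((CLINT u|lborel. (1 - a powr \<alpha>) *\<^sub>R (stretched_exp p (-1 - \<alpha>) u *\<^sub>R ?E u))
    + (CLINT u|lborel. (\<Sum>n\<in>{1..<Suc k}. ?q n *\<^sub>R (scaled_stretched_exp a p (\<alpha> - real n * p) u *\<^sub>R ?E u))))
    + (CLINT u|lborel. a powr \<alpha> *\<^sub>R (IGa_kernel \<alpha> (Suc k) p ?\<eta> u *\<^sub>R ?E u))"
  proof -
    have A: "complex_integrable lborel (\<lambda>u. (1 - a powr \<alpha>) *\<^sub>R (stretched_exp p (-1 - \<alpha>) u *\<^sub>R ?E u))"
      using i1 by (rule integrable_scaleR_right)
    have B: "complex_integrable lborel (\<lambda>u. \<Sum>n\<in>{1..<Suc k}. ?q n *\<^sub>R (scaled_stretched_exp a p (\<alpha> - real n * p) u *\<^sub>R ?E u))"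
      using i3(1) by (intro Bochner_Integration.integrable_sum integrable_scaleR_right)
    have C: "complex_integrable lborel (\<lambda>u. a powr \<alpha> *\<^sub>R (IGa_kernel \<alpha> (Suc k) p ?\<eta> u *\<^sub>R ?E u))"
      using i4 by (rule integrable_scaleR_right)
    show ?thesis
      by (simp only: Bochner_Integration.integral_add[OF Bochner_Integration.integrable_add[OF A B] C] Bochner_Integration.integral_add[OF A B])
  qed
  also have "(CLINT u|lborel. (\<Sum>n\<in>{1..<Suc k}. ?q n *\<^sub>R (scaled_stretched_exp a p (\<alpha> - real n * p) u *\<^sub>R ?E u)))
     = (\<Sum>n\<in>{1..<Suc k}. ?q n *\<^sub>R TS_exponent p (\<alpha> - real n * p) c (a * w))"
    unfolding i3(2) integral_scaleR_right[symmetric]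
    by (rule Bochner_Integration.integral_sum) (intro integrable_scaleR_right i3(1))
  finally show ?thesis
    unfolding integral_scaleR_right TS_exponent_def[symmetric] by (simp only: scaleR_conv_of_real)
qed

section \<open>Change of centering\<close>

text \<open>Below index 1 the compensator is integrable by itself, and its integral is a stretched
  exponential integral. This is the origin of the Gamma factor in b_n.\<close>

lemma TS_exponent_drift:
  assumes p: "0 < p" and \<beta>: "\<beta> < 1"
  shows "TS_exponent p \<beta> 1 w = TS_exponent p \<beta> 0 w - \<i> * complex_of_real (w * (Gamma ((1 - \<beta>) / p) / p))"
proof -
  have eq: "stretched_exp p (-1 - \<beta>) u *\<^sub>R ID_kernel 1 w u = stretched_exp p (-1 - \<beta>) u *\<^sub>R ID_kernel 0 w u - \<i> * complex_of_real (w * stretched_exp p (- \<beta>) u)" for u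
  proof -
    have "stretched_exp p (-1 - \<beta>) u *\<^sub>R ID_kernel 1 w u = stretched_exp p (-1 - \<beta>) u *\<^sub>R ID_kernel 0 w u - \<i> * complex_of_real (w * (u * stretched_exp p (-1 - \<beta>) u))"
      by (simp add: ID_kernel_def scaleR_conv_of_real algebra_simps)
    then show ?thesis by (simp only: stretched_exp_mult_self) simp
  qed
  have i: "integrable lborel (stretched_exp p (- \<beta>))" "(\<integral>u. stretched_exp p (- \<beta>) u \<partial>lborel) = Gamma ((1 - \<beta>) / p) / p"
    using integrable_stretched_exp[OF p, of "- \<beta>"] integral_stretched_exp[OF p, of "- \<beta>"] \<beta> by simp_all
  have 2: "complex_integrable lborel (\<lambda>u. \<i> * complex_of_real (w * stretched_exp p (- \<beta>) u))"
    using i by (intro integrable_mult_right integrable_of_real) auto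
  have 1: "complex_integrable lborel (\<lambda>u. stretched_exp p (-1 - \<beta>) u *\<^sub>R ID_kernel 0 w u)"
    using p \<beta> by (intro integrable_TS_exponent) auto
  have "TS_exponent p \<beta> 1 w = TS_exponent p \<beta> 0 w - (CLINT u|lborel. \<i> * complex_of_real (w * stretched_exp p (- \<beta>) u))"
    unfolding TS_exponent_def eq by (rule Bochner_Integration.integral_diff[OF 1 2])
  also have "(CLINT u|lborel. \<i> * complex_of_real (w * stretched_exp p (- \<beta>) u)) = \<i> * complex_of_real (w * (Gamma ((1 - \<beta>) / p) / p))"
    unfolding i(2)[symmetric] by (simp only: integral_mult_right_zero integral_complex_of_real)
  finally show ?thesis .
qed

lemma is_TS_char:
  fixes R :: "(real^'d) measure"
  assumes TS: "is_TS \<mu> p \<beta> R b" and R: "finite_measure R"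
  shows "complex_integrable R (\<lambda>x. TS_exponent p \<beta> (TS_drift \<beta>) (z \<bullet> x))"
    and "char_vec \<mu> z = exp (\<i> * complex_of_real (b \<bullet> z) + (CLINT x|R. TS_exponent p \<beta> (TS_drift \<beta>) (z \<bullet> x)))"
proof -
  have s: "sets R = sets borel" and i: "complex_integrable (TS_levy p \<beta> R) (ID_kernel (TS_drift \<beta>) z)"
    and ch: "char_vec \<mu> z = exp (ID_exponent 0 (TS_levy p \<beta> R) b (TS_h \<beta>) z)"
    using TS by (auto simp: is_TS_def is_ID_def TS_admissible_def ID_integrand_TS_h)
  note I = integral_TS_levy[OF R s _ i, unfolded ID_kernel_scaleR, folded TS_exponent_def, simplified]
  show "complex_integrable R (\<lambda>x. TS_exponent p \<beta> (TS_drift \<beta>) (z \<bullet> x))" by (rule I)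
  have "ID_exponent 0 (TS_levy p \<beta> R) b (TS_h \<beta>) z = \<i> * complex_of_real (b \<bullet> z) + (CLINT x|R. TS_exponent p \<beta> (TS_drift \<beta>) (z \<bullet> x))"
    by (simp add: ID_exponent_def ID_integrand_TS_h I)
  then show "char_vec \<mu> z = exp (\<i> * complex_of_real (b \<bullet> z) + (CLINT x|R. TS_exponent p \<beta> (TS_drift \<beta>) (z \<bullet> x)))"
    using ch by simp
qed

section \<open>Joint law of the variables in the representation\<close>

lemma scale_measure_eq_density:
  "scale_measure (ennreal r) R = density R (\<lambda>_. ennreal r)"
  by (rule measure_eqI) (auto simp: emeasure_density_const)

lemma integral_scale_measure:
  fixes f :: "'a \<Rightarrow> 'b::{banach, second_countable_topology}"
  assumes "f \<in> borel_measurable R" "0 \<le> r"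
  shows "(\<integral>x. f x \<partial>scale_measure (ennreal r) R) = r *\<^sub>R (\<integral>x. f x \<partial>R)"
  unfolding scale_measure_eq_density using assms by (subst integral_density) auto

text \<open>All variables are embedded in one value type with 0 in the other component, so that the
  theory of \<open>indep_vars\<close> applies to the whole family.\<close>

definition embed_rv :: "('q \<Rightarrow> nat) \<Rightarrow> (nat \<Rightarrow> 'q \<Rightarrow> real^'d) \<Rightarrow> (nat \<Rightarrow> 'q \<Rightarrow> real^'d) \<Rightarrow> (nat \<Rightarrow> 'q \<Rightarrow> real)
    \<Rightarrow> rv_index \<Rightarrow> 'q \<Rightarrow> (real^'d) \<times> real" where
  "embed_rv N X V W i \<omega> = (case i of Ix_N \<Rightarrow> (0, real (N \<omega>)) | Ix_X n \<Rightarrow> (X n \<omega>, 0) | Ix_V j \<Rightarrow> (V j \<omega>, 0) | Ix_W j \<Rightarrow> (0, W j \<omega>))"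

text \<open>The pair \<open>(V\<^sub>j, W\<^sub>j)\<close> forms one block, represented by its first index.\<close>

definition rv_block :: "rv_index \<Rightarrow> rv_index set" where
  "rv_block i = (case i of Ix_V j \<Rightarrow> {Ix_V j, Ix_W j} | _ \<Rightarrow> {i})"

text \<open>Each embedded variable generates only events of the original one, and independence of
  families of events passes to subfamilies.\<close>

lemma indep_vars_embed_rv:
  fixes X V :: "nat \<Rightarrow> 'q \<Rightarrow> real^'d"
  assumes T: "TSOU_variables p \<alpha> lam t R g Q N X V W"
  shows "prob_space.indep_vars Q (\<lambda>_. borel) (embed_rv N X V W) ({Ix_N} \<union> Ix_X ` {..<g} \<union> Ix_V ` {1..} \<union> Ix_W ` {1..})"
    (is "prob_space.indep_vars Q _ _ ?I")
proof -
  have Q: "prob_space Q" and [measurable]: "N \<in> measurable Q (count_space UNIV)"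
    and X: "\<And>n. n < g \<Longrightarrow> X n \<in> borel_measurable Q"
    and V: "\<And>j. 1 \<le> j \<Longrightarrow> V j \<in> borel_measurable Q" and W: "\<And>j. 1 \<le> j \<Longrightarrow> W j \<in> borel_measurable Q"
    and ind: "prob_space.indep_sets Q
       (\<lambda>i. case i of
              Ix_N \<Rightarrow> events_of Q (count_space UNIV) N
            | Ix_X n \<Rightarrow> events_of Q borel (X n)
            | Ix_V j \<Rightarrow> events_of Q borel (V j)
            | Ix_W j \<Rightarrow> events_of Q borel (W j)) ?I"
    using T by (auto simp: TSOU_variables_def)
  interpret prob_space Q by fact
  have pl: "(\<lambda>x. (x, 0::real)) \<in> borel \<rightarrow>\<^sub>M (borel :: ((real^'d) \<times> real) measure)"
    and pr: "(\<lambda>u. (0::real^'d, u)) \<in> borel \<rightarrow>\<^sub>M (borel :: ((real^'d) \<times> real) measure)"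
    by (auto intro!: borel_measurable_continuous_onI continuous_intros)
  have pn: "(\<lambda>n. (0::real^'d, real n)) \<in> count_space UNIV \<rightarrow>\<^sub>M (borel :: ((real^'d) \<times> real) measure)" by simp
  have rv: "embed_rv N X V W i \<in> borel_measurable Q" if "i \<in> ?I" for i
  proof (cases i)
    case Ix_N
    then show ?thesis using measurable_compose[OF \<open>N \<in> _\<close> pn] by (simp add: embed_rv_def[abs_def])
  next
    case (Ix_X n)
    then have "n < g" using that by auto
    from measurable_compose[OF X[OF this] pl] show ?thesis using Ix_X by (simp add: embed_rv_def[abs_def])
  next
    case (Ix_V j)
    then have "1 \<le> j" using that by auto
    from measurable_compose[OF V[OF this] pl] show ?thesis using Ix_V by (simp add: embed_rv_def[abs_def])
  next
    case (Ix_W j)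
    then have "1 \<le> j" using that by auto
    from measurable_compose[OF W[OF this] pr] show ?thesis using Ix_W by (simp add: embed_rv_def[abs_def])
  qed
  have ev: "{(\<lambda>\<omega>. f (Y \<omega>)) -` A \<inter> space Q |A. A \<in> sets borel} \<subseteq> events_of Q S Y"
    if "f \<in> S \<rightarrow>\<^sub>M (borel :: ((real^'d) \<times> real) measure)" "space S = UNIV" for f S and Y :: "'q \<Rightarrow> 'z"
  proof -
    have eq: "(\<lambda>\<omega>. f (Y \<omega>)) -` A \<inter> space Q = Y -` (f -` A \<inter> space S) \<inter> space Q" for A using that(2) by auto
    show ?thesis
    proof (rule subsetI)
      fix E assume "E \<in> {(\<lambda>\<omega>. f (Y \<omega>)) -` A \<inter> space Q |A. A \<in> sets borel}"
      then obtain A where A: "A \<in> sets borel" and E: "E = (\<lambda>\<omega>. f (Y \<omega>)) -` A \<inter> space Q" by (elim CollectE exE conjE)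
      show "E \<in> events_of Q S Y"
        unfolding events_of_def E eq
        by (intro CollectI exI[of _ "f -` A \<inter> space S"] conjI refl measurable_sets[OF that(1) A])
    qed
  qed
  have sub: "{embed_rv N X V W i -` A \<inter> space Q |A. A \<in> sets borel} \<subseteq> (case i of
              Ix_N \<Rightarrow> events_of Q (count_space UNIV) N
            | Ix_X n \<Rightarrow> events_of Q borel (X n)
            | Ix_V j \<Rightarrow> events_of Q borel (V j)
            | Ix_W j \<Rightarrow> events_of Q borel (W j))" for i
  proof (cases i)
    case Ix_N
    then show ?thesis using ev[OF pn, of N] by (simp add: embed_rv_def[abs_def])
  next
    case (Ix_X n)
    then show ?thesis using ev[OF pl, of "X n"] by (simp add: embed_rv_def[abs_def])
  next
    case (Ix_V j)
    then show ?thesis using ev[OF pl, of "V j"] by (simp add: embed_rv_def[abs_def])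
  next
    case (Ix_W j)
    then show ?thesis using ev[OF pr, of "W j"] by (simp add: embed_rv_def[abs_def])
  qed
  show ?thesis
    unfolding indep_vars_def2
  proof (intro conjI ballI)
    show "indep_sets (\<lambda>i. {embed_rv N X V W i -` A \<inter> space Q |A. A \<in> sets borel}) ?I"
      by (rule indep_sets_mono_sets[OF ind sub])
  qed (rule rv)
qed

text \<open>Restricting the independent family to two disjoint singletons makes the joint law of V_j
  and W_j a product; Fubini then gives the iterated integral.\<close>

lemma TSOU_VW_char:
  fixes X V :: "nat \<Rightarrow> 'q \<Rightarrow> real^'d"
  assumes T: "TSOU_variables p \<alpha> lam t R g Q N X V W" and j: "1 \<le> j"
  shows "(CLINT \<omega>|Q. iexp (z \<bullet> (W j \<omega> *\<^sub>R V j \<omega>))) =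
    (CLINT x|scale_measure (1 / emeasure R UNIV) R. CLINT u|IGa \<alpha> (real g) p (exp (p * lam * t)). iexp ((z \<bullet> x) * u))"
proof -
  have Q: "prob_space Q"
    and V[measurable]: "V j \<in> borel_measurable Q" and W[measurable]: "W j \<in> borel_measurable Q"
    and dV: "distr Q borel (V j) = scale_measure (1 / emeasure R UNIV) R"
    and dW: "distr Q borel (W j) = IGa \<alpha> (real g) p (exp (p * lam * t))"
    using T j by (auto simp: TSOU_variables_def)
  interpret prob_space Q by fact
  let ?I = "{Ix_N} \<union> Ix_X ` {..<g} \<union> Ix_V ` {1..} \<union> Ix_W ` {1..}"
  let ?E = "embed_rv N X V W"
  have "indep_var (PiM {Ix_V j} (\<lambda>_. borel)) (\<lambda>\<omega>. restrict (\<lambda>i. ?E i \<omega>) {Ix_V j}) (PiM {Ix_W j} (\<lambda>_. borel)) (\<lambda>\<omega>. restrict (\<lambda>i. ?E i \<omega>) {Ix_W j})"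
    using j by (intro indep_var_restrict[OF indep_vars_embed_rv[OF T]]) auto
  then have "indep_var borel ((\<lambda>f. f (Ix_V j)) \<circ> (\<lambda>\<omega>. restrict (\<lambda>i. ?E i \<omega>) {Ix_V j})) borel ((\<lambda>f. f (Ix_W j)) \<circ> (\<lambda>\<omega>. restrict (\<lambda>i. ?E i \<omega>) {Ix_W j}))"
    by (rule indep_var_compose) (auto intro: measurable_component_singleton)
  then have iv: "indep_var borel (\<lambda>\<omega>. (V j \<omega>, 0::real)) borel (\<lambda>\<omega>. (0::real^'d, W j \<omega>))"
    by (simp add: comp_def embed_rv_def)
  let ?A = "distr Q borel (\<lambda>\<omega>. (V j \<omega>, 0::real))" and ?B = "distr Q borel (\<lambda>\<omega>. (0::real^'d, W j \<omega>))"
  have m: "(\<lambda>\<omega>. (V j \<omega>, 0::real)) \<in> borel_measurable Q" "(\<lambda>\<omega>. (0::real^'d, W j \<omega>)) \<in> borel_measurable Q"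
    using iv by (auto simp: indep_var_distribution_eq)
  have joint: "?A \<Otimes>\<^sub>M ?B = distr Q (borel \<Otimes>\<^sub>M borel) (\<lambda>\<omega>. ((V j \<omega>, 0::real), (0::real^'d, W j \<omega>)))"
    using iv by (simp add: indep_var_distribution_eq)
  interpret A: prob_space ?A by (rule prob_space_distr[OF m(1)])
  interpret B: prob_space ?B by (rule prob_space_distr[OF m(2)])
  interpret P: pair_prob_space ?A ?B ..
  define F where "F q = iexp (z \<bullet> (snd (snd q) *\<^sub>R fst (fst q)))" for q :: "((real^'d) \<times> real) \<times> ((real^'d) \<times> real)"
  have fsm: "fst \<in> borel_measurable (borel :: ((real^'d) \<times> real) measure)" "snd \<in> borel_measurable (borel :: ((real^'d) \<times> real) measure)"
    by (auto intro!: borel_measurable_continuous_onI continuous_intros)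
  note [measurable] = fsm
  have Fm[measurable]: "F \<in> borel_measurable (borel \<Otimes>\<^sub>M borel)" unfolding F_def by measurable
  have s: "sets (?A \<Otimes>\<^sub>M ?B) = sets (borel \<Otimes>\<^sub>M borel)" by (rule sets_pair_measure_cong) simp_all
  have Fi: "complex_integrable (?A \<Otimes>\<^sub>M ?B) F"
    by (rule P.integrable_const_bound[where B=1]) (use Fm in \<open>auto simp: F_def measurable_cong_sets[OF s refl]\<close>)
  have "(CLINT \<omega>|Q. iexp (z \<bullet> (W j \<omega> *\<^sub>R V j \<omega>))) = (CLINT q|distr Q (borel \<Otimes>\<^sub>M borel) (\<lambda>\<omega>. ((V j \<omega>, 0::real), (0::real^'d, W j \<omega>))). F q)"
    using m by (subst integral_distr) (auto simp: F_def)
  also have "\<dots> = (CLINT q|(?A \<Otimes>\<^sub>M ?B). F q)" by (simp only: joint)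
  also have "\<dots> = (CLINT a|?A. CLINT b|?B. F (a, b))" by (rule P.integral_fst'[OF Fi, symmetric])
  also have "\<dots> = (CLINT a|?A. CLINT \<omega>|Q. iexp (z \<bullet> (W j \<omega> *\<^sub>R fst a)))"
    using m by (subst integral_distr) (auto simp: F_def)
  also have "\<dots> = (CLINT \<omega>'|Q. CLINT \<omega>|Q. iexp (z \<bullet> (W j \<omega> *\<^sub>R V j \<omega>')))"
  proof -
    have "(\<lambda>a. CLINT \<omega>|Q. iexp (z \<bullet> (W j \<omega> *\<^sub>R fst a))) \<in> borel_measurable (borel :: ((real^'d) \<times> real) measure)"
      by (rule borel_measurable_lebesgue_integral) measurable
    then show ?thesis using m by (subst integral_distr) auto
  qed
  also have "\<dots> = (CLINT \<omega>'|Q. CLINT u|distr Q borel (W j). iexp ((z \<bullet> V j \<omega>') * u))"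
    by (subst integral_distr) (auto simp: mult.commute)
  also have "\<dots> = (CLINT x|distr Q borel (V j). CLINT u|distr Q borel (W j). iexp ((z \<bullet> x) * u))"
  proof -
    interpret Wd: prob_space "distr Q borel (W j)" by (rule prob_space_distr) simp
    have "(\<lambda>x. CLINT u|distr Q borel (W j). iexp ((z \<bullet> x) * u)) \<in> borel_measurable borel"
      by (rule Wd.borel_measurable_lebesgue_integral) measurable
    then show ?thesis by (subst integral_distr) auto
  qed
  finally show ?thesis by (simp only: dV dW)
qed

text \<open>On the event that \<open>N\<close> equals n the random sum has exactly n terms, and the
  integrand is a product over the independent blocks of N, of each X_k and of each pair (V_j, W_j)
  with 1 \<le> j \<le> n. \<open>poisson_mixture\<close> sums the results over n.\<close>

lemma TSOU_variables_char:
  fixes X V :: "nat \<Rightarrow> 'q \<Rightarrow> real^'d" and R :: "(real^'d) measure"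
  assumes T: "TSOU_variables p \<alpha> lam t R g Q N X V W"
    and m: "m = exp (- \<alpha> * lam * t) * measure R UNIV * IGa_K \<alpha> (real g) p (exp (p * lam * t))" "0 < m"
  shows "(CLINT \<omega>|Q. (\<Prod>n<g. iexp (y n \<bullet> X n \<omega>)) * iexp (z \<bullet> (\<Sum>j\<in>{1..N \<omega>}. W j \<omega> *\<^sub>R V j \<omega>))) =
    (\<Prod>n<g. char_vec (distr Q borel (X n)) (y n)) *
    exp (m * ((CLINT x|scale_measure (1 / emeasure R UNIV) R. CLINT u|IGa \<alpha> (real g) p (exp (p * lam * t)). iexp ((z \<bullet> x) * u)) - 1))"
proof -
  have Q: "prob_space Q" and N[measurable]: "N \<in> measurable Q (count_space UNIV)"
    and X: "\<And>n. n < g \<Longrightarrow> X n \<in> borel_measurable Q"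
    and V: "\<And>j. 1 \<le> j \<Longrightarrow> V j \<in> borel_measurable Q" and W: "\<And>j. 1 \<le> j \<Longrightarrow> W j \<in> borel_measurable Q"
    and dN: "distr Q (count_space UNIV) N = measure_pmf (poisson_pmf m)"
    using T m by (auto simp: TSOU_variables_def)
  interpret prob_space Q by fact
  let ?I = "{Ix_N} \<union> Ix_X ` {..<g} \<union> Ix_V ` {1..} \<union> Ix_W ` {1..}"
  let ?E = "embed_rv N X V W"
  let ?L = "{Ix_N} \<union> Ix_X ` {..<g} \<union> Ix_V ` {1..}"
  define \<phi> where "\<phi> = (CLINT x|scale_measure (1 / emeasure R UNIV) R. CLINT u|IGa \<alpha> (real g) p (exp (p * lam * t)). iexp ((z \<bullet> x) * u))"
  define F where "F \<omega> = (\<Prod>n<g. iexp (y n \<bullet> X n \<omega>)) * iexp (z \<bullet> (\<Sum>j\<in>{1..N \<omega>}. W j \<omega> *\<^sub>R V j \<omega>))" for \<omega>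
  have Xm: "(\<lambda>\<omega>. iexp (y n \<bullet> X n \<omega>)) \<in> borel_measurable Q" if "n < g" for n using X[OF that] by simp
  have VWm: "(\<lambda>\<omega>. W j \<omega> *\<^sub>R V j \<omega>) \<in> borel_measurable Q" if "1 \<le> j" for j using V[OF that] W[OF that] by simp
  have Sm: "(\<lambda>\<omega>. \<Sum>j\<in>{1..N \<omega>}. W j \<omega> *\<^sub>R V j \<omega>) \<in> borel_measurable Q"
    by (rule measurable_compose_countable[OF _ N]) (auto intro!: borel_measurable_sum VWm)
  have Fm: "F \<in> borel_measurable Q" unfolding F_def
    using Xm Sm by (intro borel_measurable_times borel_measurable_prod) auto
  have fsm[measurable]: "fst \<in> borel_measurable (borel :: ((real^'d) \<times> real) measure)" "snd \<in> borel_measurable (borel :: ((real^'d) \<times> real) measure)"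
    by (auto intro!: borel_measurable_continuous_onI continuous_intros)
  have fn: "(CLINT \<omega>|Q. indicator {n} (N \<omega>) * F \<omega>) =
    (\<Prod>n<g. char_vec (distr Q borel (X n)) (y n)) * complex_of_real (pmf (poisson_pmf m) n) * \<phi> ^ n" for n
  proof -
    \<comment> \<open>The factor of each block as a function of the block's variables. The value at
      \<open>Ix_W\<close> is a dummy: W_j belongs to the block of \<open>Ix_V j\<close>, so no index
      of the product has this form.\<close>
    define h where "h i f = (case i of Ix_N \<Rightarrow> indicator {real n} (snd (f Ix_N)) | Ix_X k \<Rightarrow> iexp (y k \<bullet> fst (f (Ix_X k)))
       | Ix_V j \<Rightarrow> iexp (z \<bullet> (snd (f (Ix_W j)) *\<^sub>R fst (f (Ix_V j)))) | Ix_W j \<Rightarrow> (0::complex))" for i and f :: "rv_index \<Rightarrow> (real^'d) \<times> real"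
    let ?S = "insert Ix_N (Ix_X ` {..<g} \<union> Ix_V ` {1..n})"
    have "indep_vars (\<lambda>i. PiM (rv_block i) (\<lambda>_. borel)) (\<lambda>i \<omega>. restrict (\<lambda>k. ?E k \<omega>) (rv_block i)) ?L"
      by (rule indep_vars_restrict[OF indep_vars_embed_rv[OF T]]) (auto simp: rv_block_def disjoint_family_on_def)
    then have "indep_vars (\<lambda>i. PiM (rv_block i) (\<lambda>_. borel)) (\<lambda>i \<omega>. restrict (\<lambda>k. ?E k \<omega>) (rv_block i)) ?S"
      by (rule indep_vars_subset) auto
    then have "indep_vars (\<lambda>_. borel) (\<lambda>i \<omega>. h i (restrict (\<lambda>k. ?E k \<omega>) (rv_block i))) ?S"
    proof (rule indep_vars_compose2)
      fix i assume "i \<in> ?S"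
      have c[measurable]: "(\<lambda>f. f k) \<in> borel_measurable (PiM (rv_block i) (\<lambda>_. borel :: ((real^'d) \<times> real) measure))" if "k \<in> rv_block i" for k
        using that by (rule measurable_component_singleton)
      have c1: "(\<lambda>f. fst (f k)) \<in> borel_measurable (PiM (rv_block i) (\<lambda>_. borel :: ((real^'d) \<times> real) measure))"
        "(\<lambda>f. snd (f k)) \<in> borel_measurable (PiM (rv_block i) (\<lambda>_. borel :: ((real^'d) \<times> real) measure))" if "k \<in> rv_block i" for k
        using c[OF that] by (auto intro: measurable_compose[OF _ fsm(1)] measurable_compose[OF _ fsm(2)])
      have ind: "(indicator {real n} :: real \<Rightarrow> complex) \<in> borel_measurable borel" by simp
      show "h i \<in> borel_measurable (PiM (rv_block i) (\<lambda>_. borel))"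
      proof (cases i)
        case Ix_N
        then show ?thesis using measurable_compose[OF c1(2)[of Ix_N] ind] by (simp add: h_def[abs_def] rv_block_def)
      next
        case (Ix_X k)
        then have "(\<lambda>f. fst (f (Ix_X k))) \<in> borel_measurable (PiM (rv_block i) (\<lambda>_. borel :: ((real^'d) \<times> real) measure))"
          by (intro c1) (simp add: rv_block_def)
        then show ?thesis using Ix_X by (simp add: h_def[abs_def])
      next
        case (Ix_V j)
        then have "(\<lambda>f. fst (f (Ix_V j))) \<in> borel_measurable (PiM (rv_block i) (\<lambda>_. borel :: ((real^'d) \<times> real) measure))"
          "(\<lambda>f. snd (f (Ix_W j))) \<in> borel_measurable (PiM (rv_block i) (\<lambda>_. borel :: ((real^'d) \<times> real) measure))"
          by (auto intro!: c1 simp: rv_block_def)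
        then show ?thesis using Ix_V by (simp add: h_def[abs_def])
      qed (simp add: h_def[abs_def])
    qed
    moreover have hE: "h i (restrict (\<lambda>k. ?E k \<omega>) (rv_block i)) = (case i of Ix_N \<Rightarrow> indicator {n} (N \<omega>) | Ix_X k \<Rightarrow> iexp (y k \<bullet> X k \<omega>)
       | Ix_V j \<Rightarrow> iexp (z \<bullet> (W j \<omega> *\<^sub>R V j \<omega>)) | Ix_W j \<Rightarrow> 0)" for i \<omega>
      by (cases i) (simp_all add: h_def rv_block_def embed_rv_def indicator_def)
    ultimately have ind: "indep_vars (\<lambda>_. borel) (\<lambda>i \<omega>. case i of Ix_N \<Rightarrow> indicator {n} (N \<omega>) | Ix_X k \<Rightarrow> iexp (y k \<bullet> X k \<omega>)
       | Ix_V j \<Rightarrow> iexp (z \<bullet> (W j \<omega> *\<^sub>R V j \<omega>)) | Ix_W j \<Rightarrow> (0::complex)) ?S" (is "indep_vars _ ?H ?S")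
      by simp
    have prodS: "(\<Prod>i\<in>?S. G i) = G Ix_N * ((\<Prod>k<g. G (Ix_X k)) * (\<Prod>j\<in>{1..n}. G (Ix_V j)))" for G :: "rv_index \<Rightarrow> complex"
    proof -
      have "(\<Prod>i\<in>?S. G i) = G Ix_N * (\<Prod>i\<in>Ix_X ` {..<g} \<union> Ix_V ` {1..n}. G i)" by (rule prod.insert) auto
      also have "(\<Prod>i\<in>Ix_X ` {..<g} \<union> Ix_V ` {1..n}. G i) = (\<Prod>i\<in>Ix_X ` {..<g}. G i) * (\<Prod>i\<in>Ix_V ` {1..n}. G i)"
        by (rule prod.union_disjoint) auto
      finally show ?thesis by (simp add: prod.reindex inj_on_def)
    qed
    have "(CLINT \<omega>|Q. indicator {n} (N \<omega>) * F \<omega>) = (CLINT \<omega>|Q. \<Prod>i\<in>?S. ?H i \<omega>)"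
    proof (rule Bochner_Integration.integral_cong[OF refl])
      fix \<omega>
      show "indicator {n} (N \<omega>) * F \<omega> = (\<Prod>i\<in>?S. ?H i \<omega>)"
        unfolding prodS
        by (cases "N \<omega> = n") (simp_all add: F_def inner_sum_right sum_distrib_left exp_sum)
    qed
    also have "\<dots> = (\<Prod>i\<in>?S. CLINT \<omega>|Q. ?H i \<omega>)"
    proof (rule indep_vars_lebesgue_integral[OF _ ind])
      fix i assume i: "i \<in> ?S"
      then have "?H i \<in> borel_measurable Q" using ind by (auto simp: indep_vars_def)
      moreover have "norm (?H i \<omega>) \<le> 1" for \<omega> by (cases i) (simp_all add: indicator_def)
      ultimately show "complex_integrable Q (?H i)" by (intro integrable_const_bound[where B=1]) auto
    qed simp
    also have "\<dots> = (CLINT \<omega>|Q. indicator {n} (N \<omega>)) * ((\<Prod>k<g. CLINT \<omega>|Q. iexp (y k \<bullet> X k \<omega>)) * (\<Prod>j\<in>{1..n}. CLINT \<omega>|Q. iexp (z \<bullet> (W j \<omega> *\<^sub>R V j \<omega>))))"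
      unfolding prodS by simp
    also have "(CLINT \<omega>|Q. indicator {n} (N \<omega>)) = complex_of_real (pmf (poisson_pmf m) n)"
    proof -
      have "(CLINT \<omega>|Q. indicator {n} (N \<omega>)) = (CLINT k|distr Q (count_space UNIV) N. indicator {n} k)"
        by (rule integral_distr[symmetric]) simp_all
      also have "\<dots> = (CLINT k|measure_pmf (poisson_pmf m). complex_of_real (indicator {n} k))"
        unfolding dN by (simp add: of_real_indicator)
      also have "\<dots> = complex_of_real (pmf (poisson_pmf m) n)"
        unfolding integral_complex_of_real by (simp add: measure_pmf_single)
      finally show ?thesis .
    qed
    also have "(\<Prod>k<g. CLINT \<omega>|Q. iexp (y k \<bullet> X k \<omega>)) = (\<Prod>n<g. char_vec (distr Q borel (X n)) (y n))"
      using X by (intro prod.cong refl) (simp add: char_vec_def integral_distr)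
    also have "(\<Prod>j\<in>{1..n}. CLINT \<omega>|Q. iexp (z \<bullet> (W j \<omega> *\<^sub>R V j \<omega>))) = (\<Prod>j\<in>{1..n}. \<phi>)"
      unfolding \<phi>_def by (intro prod.cong refl TSOU_VW_char[OF T]) simp
    finally show ?thesis by (simp add: mult_ac)
  qed
  have "norm (F \<omega>) \<le> 1" for \<omega> by (simp add: F_def norm_mult flip: prod_norm)
  from poisson_mixture[OF Q N dN m(2) Fm this fn] show ?thesis
    unfolding F_def \<phi>_def .
qed

section \<open>A product space carrying the variables\<close>

text \<open>Every coordinate carries a vector, a real and a natural number, so one product space of
  a single type serves all variables. Each variable will read one component of a coordinate of its
  own.\<close>

lemma exists_independent_coordinates:
  assumes P: "\<And>i. prob_space (A i)" "\<And>i. prob_space (B i)"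
    and s: "\<And>i. sets (A i) = sets (borel :: (real^'d) measure)" "\<And>i. sets (B i) = sets (borel :: real measure)"
  shows "\<exists>(Q :: (rv_index \<Rightarrow> (real^'d) \<times> real \<times> nat) measure). prob_space Q \<and>
    (\<forall>i. (\<lambda>\<omega>. fst (\<omega> i)) \<in> borel_measurable Q \<and> distr Q borel (\<lambda>\<omega>. fst (\<omega> i)) = A i) \<and>
    (\<forall>i. (\<lambda>\<omega>. fst (snd (\<omega> i))) \<in> borel_measurable Q \<and> distr Q borel (\<lambda>\<omega>. fst (snd (\<omega> i))) = B i) \<and>
    (\<forall>i. (\<lambda>\<omega>. snd (snd (\<omega> i))) \<in> measurable Q (count_space UNIV) \<and> distr Q (count_space UNIV) (\<lambda>\<omega>. snd (snd (\<omega> i))) = measure_pmf D) \<and>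
    prob_space.indep_vars Q (\<lambda>i. A i \<Otimes>\<^sub>M (B i \<Otimes>\<^sub>M measure_pmf D)) (\<lambda>i \<omega>. \<omega> i) UNIV"
proof -
  define Mi where "Mi i = A i \<Otimes>\<^sub>M (B i \<Otimes>\<^sub>M measure_pmf D)" for i
  interpret A: prob_space "A i" for i by (rule P)
  interpret B: prob_space "B i" for i by (rule P)
  interpret BD: pair_prob_space "B i" "measure_pmf D" for i ..
  interpret M: pair_prob_space "A i" "B i \<Otimes>\<^sub>M measure_pmf D" for i ..
  have Mp: "prob_space (Mi i)" for i unfolding Mi_def by (rule M.prob_space_axioms)
  let ?Q = "PiM UNIV Mi"
  interpret Q: prob_space ?Q by (rule prob_space_PiM) (rule Mp)
  have co: "(\<lambda>\<omega>. \<omega> i) \<in> ?Q \<rightarrow>\<^sub>M Mi i" for i by (rule measurable_component_singleton) simp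
  have dc: "distr ?Q (Mi i) (\<lambda>\<omega>. \<omega> i) = Mi i" for i by (rule distr_PiM_component) (auto simp: Mp)
  have f1: "fst \<in> Mi i \<rightarrow>\<^sub>M A i" "snd \<in> Mi i \<rightarrow>\<^sub>M (B i \<Otimes>\<^sub>M measure_pmf D)" for i unfolding Mi_def by simp_all
  have f2: "(\<lambda>x. fst (snd x)) \<in> Mi i \<rightarrow>\<^sub>M B i" "(\<lambda>x. snd (snd x)) \<in> Mi i \<rightarrow>\<^sub>M measure_pmf D" for i
    using f1(2)[of i] by (auto intro: measurable_compose)
  have d1: "distr (Mi i) (A i) fst = A i" "distr (Mi i) (B i) (\<lambda>x. fst (snd x)) = B i"
     "distr (Mi i) (measure_pmf D) (\<lambda>x. snd (snd x)) = measure_pmf D" for i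
  proof -
    show "distr (Mi i) (A i) fst = A i" unfolding Mi_def by (rule BD.distr_pair_fst)
    have sn: "distr (Mi i) (B i \<Otimes>\<^sub>M measure_pmf D) snd = B i \<Otimes>\<^sub>M measure_pmf D"
    proof (rule measure_eqI)
      fix E assume "E \<in> sets (distr (Mi i) (B i \<Otimes>\<^sub>M measure_pmf D) snd)"
      then have E: "E \<in> sets (B i \<Otimes>\<^sub>M measure_pmf D)" by simp
      have "snd -` E \<inter> space (Mi i) = space (A i) \<times> E" using sets.sets_into_space[OF E] by (auto simp: Mi_def space_pair_measure)
      then show "emeasure (distr (Mi i) (B i \<Otimes>\<^sub>M measure_pmf D) snd) E = emeasure (B i \<Otimes>\<^sub>M measure_pmf D) E"
        using E f1(2)[of i] BD.emeasure_pair_measure_Times[of "space (A i)" "A i" E i]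
        by (subst emeasure_distr) (auto simp: Mi_def A.emeasure_space_1)
    qed simp
    have "distr (Mi i) (B i) (\<lambda>x. fst (snd x)) = distr (distr (Mi i) (B i \<Otimes>\<^sub>M measure_pmf D) snd) (B i) fst"
      using f1(2)[of i] by (subst distr_distr) (auto simp: comp_def)
    also have "\<dots> = B i" unfolding sn by (rule measure_pmf.distr_pair_fst)
    finally show "distr (Mi i) (B i) (\<lambda>x. fst (snd x)) = B i" .
    have "distr (Mi i) (measure_pmf D) (\<lambda>x. snd (snd x)) = distr (distr (Mi i) (B i \<Otimes>\<^sub>M measure_pmf D) snd) (measure_pmf D) snd"
      using f1(2)[of i] by (subst distr_distr) (auto simp: comp_def)
    also have "\<dots> = measure_pmf D" unfolding sn
    proof (rule measure_eqI)
      fix E assume "E \<in> sets (distr (B i \<Otimes>\<^sub>M measure_pmf D) (measure_pmf D) snd)"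
      have "snd -` E \<inter> space (B i \<Otimes>\<^sub>M measure_pmf D) = space (B i) \<times> E" by (auto simp: space_pair_measure)
      then show "emeasure (distr (B i \<Otimes>\<^sub>M measure_pmf D) (measure_pmf D) snd) E = emeasure (measure_pmf D) E"
        using measure_pmf.emeasure_pair_measure_Times[of "space (B i)" "B i" E D]
        by (subst emeasure_distr) (auto simp: B.emeasure_space_1)
    qed simp
    finally show "distr (Mi i) (measure_pmf D) (\<lambda>x. snd (snd x)) = measure_pmf D" .
  qed
  have dd: "distr ?Q S (\<lambda>\<omega>. f (\<omega> i)) = distr (Mi i) S f" if "f \<in> Mi i \<rightarrow>\<^sub>M S" for f i and S :: "'z measure"
  proof -
    have "distr ?Q S (\<lambda>\<omega>. f (\<omega> i)) = distr (distr ?Q (Mi i) (\<lambda>\<omega>. \<omega> i)) S f"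
      using co that by (subst distr_distr) (auto simp: comp_def)
    then show ?thesis by (simp only: dc)
  qed
  have cs: "distr L borel f = distr L (A i) f" for L :: "'y measure" and f i by (intro distr_cong) (auto simp: s)
  have cs': "distr L borel f = distr L (B i) f" for L :: "'y measure" and f i by (intro distr_cong) (auto simp: s)
  have cs'': "distr L (count_space UNIV) f = distr L (measure_pmf D) f" for L :: "'y measure" and f by (intro distr_cong) auto
  have "prob_space.indep_vars ?Q Mi (\<lambda>i \<omega>. \<omega> i) UNIV"
    by (rule indep_vars_PiM_coordinates) (rule Mp)
  then have iv: "prob_space.indep_vars ?Q (\<lambda>i. A i \<Otimes>\<^sub>M (B i \<Otimes>\<^sub>M measure_pmf D)) (\<lambda>i \<omega>. \<omega> i) UNIV"
    unfolding Mi_def .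
  show ?thesis
  proof (intro exI[of _ ?Q] conjI allI Q.prob_space_axioms iv)
    fix i
    have "(\<lambda>\<omega>. fst (\<omega> i)) \<in> ?Q \<rightarrow>\<^sub>M A i" by (rule measurable_compose[OF co f1(1)])
    then show "(\<lambda>\<omega>. fst (\<omega> i)) \<in> borel_measurable ?Q" by (simp only: measurable_cong_sets[OF refl s(1)])
    show "distr ?Q borel (\<lambda>\<omega>. fst (\<omega> i)) = A i" unfolding cs[of _ _ i] dd[OF f1(1)] by (rule d1)
    have "(\<lambda>\<omega>. fst (snd (\<omega> i))) \<in> ?Q \<rightarrow>\<^sub>M B i" by (rule measurable_compose[OF co f2(1)])
    then show "(\<lambda>\<omega>. fst (snd (\<omega> i))) \<in> borel_measurable ?Q" by (simp only: measurable_cong_sets[OF refl s(2)])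
    show "distr ?Q borel (\<lambda>\<omega>. fst (snd (\<omega> i))) = B i" unfolding cs'[of _ _ i] dd[OF f2(1)] by (rule d1)
    have "(\<lambda>\<omega>. snd (snd (\<omega> i))) \<in> ?Q \<rightarrow>\<^sub>M measure_pmf D" by (rule measurable_compose[OF co f2(2)])
    then show "(\<lambda>\<omega>. snd (snd (\<omega> i))) \<in> ?Q \<rightarrow>\<^sub>M count_space UNIV" by simp
    show "distr ?Q (count_space UNIV) (\<lambda>\<omega>. snd (snd (\<omega> i))) = measure_pmf D" unfolding cs'' dd[OF f2(2)] by (rule d1)
  qed
qed

section \<open>The transition law of a TSOU-process\<close>

text \<open>Read off from an existing law: integrability of the Levy integrand is part of
  \<open>is_ID\<close>, and Fubini passes it on to the directional exponent.\<close>

lemma integrable_TS_exponent_measure: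
  fixes R :: "(real^'d) measure"
  assumes "finite_measure R" "TS_admissible \<beta> R" "0 \<le> \<beta>" "\<beta> < 2" "0 < p"
  shows "complex_integrable R (\<lambda>x. TS_exponent p \<beta> (TS_drift \<beta>) (z \<bullet> x))"
  using exists_TS[OF assms] is_TS_char(1)[OF _ assms(1)] by blast

lemma integrable_identity_of_moment:
  fixes R :: "(real^'d) measure"
  assumes R: "finite_measure R" and ad: "TS_admissible \<alpha> R" and \<alpha>: "1 \<le> \<alpha>" "\<alpha> < 2"
  shows "integrable R (\<lambda>x. x)"
proof -
  interpret finite_measure R by fact
  have s[measurable_cong]: "sets R = sets borel" using ad by (simp add: TS_admissible_def)
  have M: "(\<integral>\<^sup>+x. ennreal (norm x powr \<alpha>) \<partial>R) < \<infinity>" using \<alpha> by (intro TS_admissible_moment[OF ad]) auto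
  have "(\<integral>\<^sup>+x. ennreal (norm x) \<partial>R) < \<infinity>"
  proof (rule nn_integral_const_add_less_top[OF R _ M, where c=1 and d=1])
    fix x :: "real^'d"
    show "norm x \<le> 1 + 1 * norm x powr \<alpha>"
    proof (cases "norm x \<le> 1")
      case False
      then have "norm x powr 1 \<le> norm x powr \<alpha>" using \<alpha> by (intro powr_mono) auto
      then show ?thesis using False by simp
    qed (simp add: add_increasing2)
  qed auto
  then show ?thesis by (intro integrableI_bounded) simp_all
qed

text \<open>The drift correction caused by the different centerings of the indices \<open>\<alpha>\<close> and \<open>\<alpha> - n p\<close>.\<close>

definition TS_shift :: "real \<Rightarrow> real \<Rightarrow> nat \<Rightarrow> real" where
  "TS_shift p \<alpha> n = (if 1 \<le> \<alpha> \<and> \<alpha> < 1 + real n * p then Gamma ((1 - \<alpha> + real n * p) / p) / p else 0)"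

text \<open>The centerings of \<alpha> and \<alpha> - n p differ exactly when 1 \<le> \<alpha> < 1 +
  n p, and \<open>TS_exponent_drift\<close> then supplies the correction.\<close>

lemma TS_exponent_shift:
  assumes p: "0 < p"
  shows "TS_exponent p (\<alpha> - real n * p) (TS_drift \<alpha>) w =
    TS_exponent p (\<alpha> - real n * p) (TS_drift (\<alpha> - real n * p)) w - \<i> * complex_of_real (w * TS_shift p \<alpha> n)"
proof -
  have np: "0 \<le> real n * p" using p by simp
  show ?thesis
  proof (cases "1 \<le> \<alpha> \<and> \<alpha> < 1 + real n * p")
    case True
    have e: "(1 - (\<alpha> - real n * p)) / p = (1 - \<alpha> + real n * p) / p" by (simp add: algebra_simps)
    have "\<alpha> - real n * p < 1" using True by simp
    from TS_exponent_drift[OF p this, of w] show ?thesis using True unfolding e TS_shift_def TS_drift_def by simp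
  next
    case False
    then have "TS_drift (\<alpha> - real n * p) = TS_drift \<alpha>" using np by (auto simp: TS_drift_def)
    then show ?thesis using False by (simp only: TS_shift_def if_False mult_zero_right of_real_0 diff_zero)
  qed
qed

section \<open>Matching the exponents after integration over directions\<close>

definition jump_exponent :: "real \<Rightarrow> nat \<Rightarrow> real \<Rightarrow> real \<Rightarrow> real \<Rightarrow> complex" where
  "jump_exponent \<alpha> g p \<eta> w = (CLINT u|lborel. IGa_kernel \<alpha> g p \<eta> u *\<^sub>R (iexp (w * u) - 1))"

lemma jump_exponent_bound:
  assumes p: "0 < p" and \<eta>: "1 < \<eta>" and \<alpha>: "\<alpha> < p * real (Suc k)"
  shows "norm (jump_exponent \<alpha> (Suc k) p \<eta> w) \<le> 2 * IGa_K \<alpha> (real (Suc k)) p \<eta>"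
    and "jump_exponent \<alpha> (Suc k) p \<eta> \<in> borel_measurable borel"
proof -
  have [measurable]: "IGa_kernel \<alpha> (Suc k) p \<eta> \<in> borel_measurable borel" using \<eta> by (rule borel_measurable_IGa_kernel)
  have "norm (jump_exponent \<alpha> (Suc k) p \<eta> w) \<le> (\<integral>u. 2 * IGa_kernel \<alpha> (Suc k) p \<eta> u \<partial>lborel)"
    unfolding jump_exponent_def
  proof (rule order_trans[OF integral_norm_bound], rule integral_mono)
    show "integrable lborel (\<lambda>u. norm (IGa_kernel \<alpha> (Suc k) p \<eta> u *\<^sub>R (iexp (w * u) - 1)))"
      by (intro integrable_norm integrable_IGa_ID_kernel(1)[OF p \<eta> \<alpha>, of 0]) simp
    show "integrable lborel (\<lambda>u. 2 * IGa_kernel \<alpha> (Suc k) p \<eta> u)"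
      using integrable_IGa_kernel[OF p \<eta> \<alpha>] by simp
    fix u
    have "norm (iexp (w * u) - 1) \<le> 2" using iexp_approx2[of "w * u" 0] by simp
    then show "norm (IGa_kernel \<alpha> (Suc k) p \<eta> u *\<^sub>R (iexp (w * u) - 1)) \<le> 2 * IGa_kernel \<alpha> (Suc k) p \<eta> u"
      using mult_left_mono[of "norm (iexp (w * u) - 1)" 2 "IGa_kernel \<alpha> (Suc k) p \<eta> u"] IGa_kernel_nonneg[OF \<eta>, of \<alpha> k p u]
      by (simp add: mult.commute)
  qed
  then show "norm (jump_exponent \<alpha> (Suc k) p \<eta> w) \<le> 2 * IGa_K \<alpha> (real (Suc k)) p \<eta>"
    unfolding IGa_K_eq by simp
  show "jump_exponent \<alpha> (Suc k) p \<eta> \<in> borel_measurable borel"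
    unfolding jump_exponent_def[abs_def] by (rule lborel.borel_measurable_lebesgue_integral) measurable
qed

text \<open>The directional decomposition integrated against R. The drift corrections become
  multiples of the first moment of R, which exists for \<alpha> \<ge> 1; for \<alpha> < 1 their
  coefficients are 0.\<close>

lemma TS_transition_exponent:
  fixes R :: "(real^'d) measure"
  assumes p: "0 < p" and a: "0 < a" "a < 1" and \<alpha>: "0 \<le> \<alpha>" "\<alpha> < 2"
    and R: "finite_measure R" and ad: "TS_admissible \<alpha> R"
    and k: "real k * p \<le> \<alpha>" "\<alpha> < p * real (Suc k)"
  defines "\<eta> \<equiv> a powr (- p)" and "q \<equiv> \<lambda>n. (1 - a powr p) ^ n / fact n"
  shows "(CLINT x|R. TS_exponent p \<alpha> (TS_drift \<alpha>) (z \<bullet> x)) - (CLINT x|R. TS_exponent p \<alpha> (TS_drift \<alpha>) ((a *\<^sub>R z) \<bullet> x)) =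
    (complex_of_real (1 - a powr \<alpha>) * (CLINT x|R. TS_exponent p \<alpha> (TS_drift \<alpha>) (z \<bullet> x))
    + (\<Sum>n\<in>{1..<Suc k}. complex_of_real (q n) *
        ((CLINT x|R. TS_exponent p (\<alpha> - real n * p) (TS_drift (\<alpha> - real n * p)) ((a *\<^sub>R z) \<bullet> x))
         - \<i> * complex_of_real (a * TS_shift p \<alpha> n * (z \<bullet> (\<integral>x. x \<partial>R))))))
    + complex_of_real (a powr \<alpha>) * ((CLINT x|R. jump_exponent \<alpha> (Suc k) p \<eta> (z \<bullet> x))
        - \<i> * complex_of_real (TS_drift \<alpha> * IGa_K (\<alpha> - 1) (real (Suc k)) p \<eta> * (z \<bullet> (\<integral>x. x \<partial>R))))"
proof -
  interpret finite_measure R by fact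
  have s[measurable_cong]: "sets R = sets borel" using ad by (simp add: TS_admissible_def)
  have \<eta>: "1 < \<eta>" unfolding \<eta>_def using a p powr_less_mono2_neg[of "-p" a 1] by simp
  let ?c = "TS_drift \<alpha>" and ?K = "IGa_K (\<alpha> - 1) (real (Suc k)) p \<eta>"
  let ?T = "\<lambda>w. TS_exponent p \<alpha> ?c w" and ?Tn = "\<lambda>n w. TS_exponent p (\<alpha> - real n * p) (TS_drift (\<alpha> - real n * p)) w"
  let ?J = "jump_exponent \<alpha> (Suc k) p \<eta>"
  have c: "(?c = 0 \<and> \<alpha> < 1) \<or> (?c = 1 \<and> \<alpha> < 2)" using \<alpha> by (simp add: TS_drift_def)
  have iT: "complex_integrable R (\<lambda>x. ?T (y \<bullet> x))" for y by (rule integrable_TS_exponent_measure[OF R ad \<alpha> p])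
  have iTn: "complex_integrable R (\<lambda>x. ?Tn n (y \<bullet> x))" if "n \<in> {1..<Suc k}" for n y
  proof -
    have "real n * p \<le> real k * p" using that p by (intro mult_right_mono) auto
    from order_trans[OF this k(1)] have n: "0 \<le> \<alpha> - real n * p" "\<alpha> - real n * p < \<alpha>" using p that by auto
    show ?thesis using n \<alpha> by (intro integrable_TS_exponent_measure[OF R TS_admissible_lower[OF R ad]] p) auto
  qed
  have iJ: "complex_integrable R (\<lambda>x. ?J (z \<bullet> x))"
    using jump_exponent_bound[OF p \<eta> k(2)] by (intro integrable_const_bound[where B="2 * IGa_K \<alpha> (real (Suc k)) p \<eta>"]) auto
  \<comment> \<open>For \<alpha> < 1 the identity need not be R-integrable, but then the coefficient
    \<open>d\<close> is 0 and both sides vanish.\<close>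
  have ix: "complex_integrable R (\<lambda>x. \<i> * complex_of_real (d * (z \<bullet> x))) \<and> (CLINT x|R. \<i> * complex_of_real (d * (z \<bullet> x))) = \<i> * complex_of_real (d * (z \<bullet> (\<integral>x. x \<partial>R)))"
    if "d \<noteq> 0 \<Longrightarrow> 1 \<le> \<alpha>" for d
  proof (cases "d = 0")
    case False
    then have "integrable R (\<lambda>x. x)" using that \<alpha> by (intro integrable_identity_of_moment[OF R ad]) auto
    then have i: "integrable R (\<lambda>x. d * (z \<bullet> x))" "(\<integral>x. d * (z \<bullet> x) \<partial>R) = d * (z \<bullet> (\<integral>x. x \<partial>R))" by simp_all
    have "(CLINT x|R. \<i> * complex_of_real (d * (z \<bullet> x))) = \<i> * (CLINT x|R. complex_of_real (d * (z \<bullet> x)))"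
      by (rule integral_mult_right_zero)
    also have "\<dots> = \<i> * complex_of_real (d * (z \<bullet> (\<integral>x. x \<partial>R)))" by (simp only: integral_complex_of_real i)
    finally show ?thesis using i(1) by (intro conjI integrable_mult_right integrable_of_real) auto
  qed simp
  define d where "d n = a * TS_shift p \<alpha> n" for n
  have d1: "1 \<le> \<alpha>" if "d n \<noteq> 0" for n using that by (auto simp: d_def TS_shift_def split: if_splits)
  have K1: "1 \<le> \<alpha>" if "?c * ?K \<noteq> 0" using that by (auto simp: TS_drift_def split: if_splits)
  have id: "complex_integrable R (\<lambda>x. \<i> * complex_of_real (d n * (z \<bullet> x))) \<and>
      (CLINT x|R. \<i> * complex_of_real (d n * (z \<bullet> x))) = \<i> * complex_of_real (d n * (z \<bullet> (\<integral>x. x \<partial>R)))" for n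
    by (rule ix) (rule d1)
  have iK: "complex_integrable R (\<lambda>x. \<i> * complex_of_real (?c * ?K * (z \<bullet> x))) \<and>
      (CLINT x|R. \<i> * complex_of_real (?c * ?K * (z \<bullet> x))) = \<i> * complex_of_real (?c * ?K * (z \<bullet> (\<integral>x. x \<partial>R)))"
    by (rule ix) (rule K1)
  have pt: "?T (z \<bullet> x) - ?T ((a *\<^sub>R z) \<bullet> x) =
    (complex_of_real (1 - a powr \<alpha>) * ?T (z \<bullet> x)
    + (\<Sum>n\<in>{1..<Suc k}. complex_of_real (q n) * (?Tn n ((a *\<^sub>R z) \<bullet> x) - \<i> * complex_of_real (d n * (z \<bullet> x)))))
    + complex_of_real (a powr \<alpha>) * (?J (z \<bullet> x) - \<i> * complex_of_real (?c * ?K * (z \<bullet> x)))" for x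
  proof -
    have c': "?c = 0 \<or> ?c = 1" by (simp add: TS_drift_def)
    have sh: "TS_exponent p (\<alpha> - real n * p) ?c (a * (z \<bullet> x)) = ?Tn n ((a *\<^sub>R z) \<bullet> x) - \<i> * complex_of_real (d n * (z \<bullet> x))" for n
      using TS_exponent_shift[OF p, of \<alpha> n "a * (z \<bullet> x)"] by (simp add: d_def mult_ac)
    have jk: "(CLINT u|lborel. IGa_kernel \<alpha> (Suc k) p \<eta> u *\<^sub>R ID_kernel ?c (z \<bullet> x) u) = ?J (z \<bullet> x) - \<i> * complex_of_real (?c * ?K * (z \<bullet> x))"
      using integrable_IGa_ID_kernel(3)[OF p \<eta> k(2) c', of "z \<bullet> x"] by (simp add: jump_exponent_def mult_ac)
    have qn: "(1 - a powr p) ^ n / fact n = q n" for n by (simp add: q_def)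
    show ?thesis
      using TS_exponent_decomposition[OF p a c k(2), of "z \<bullet> x"] unfolding \<eta>_def[symmetric] qn sh jk
      by (simp only: inner_scaleR_left)
  qed
  have i1: "complex_integrable R (\<lambda>x. complex_of_real (1 - a powr \<alpha>) * ?T (z \<bullet> x))" by (intro integrable_mult_right iT)
  have i2n: "complex_integrable R (\<lambda>x. complex_of_real (q n) * (?Tn n ((a *\<^sub>R z) \<bullet> x) - \<i> * complex_of_real (d n * (z \<bullet> x))))"
    if "n \<in> {1..<Suc k}" for n
    by (intro integrable_mult_right Bochner_Integration.integrable_diff iTn[OF that] conjunct1[OF id])
  have i2: "complex_integrable R (\<lambda>x. \<Sum>n\<in>{1..<Suc k}. complex_of_real (q n) * (?Tn n ((a *\<^sub>R z) \<bullet> x) - \<i> * complex_of_real (d n * (z \<bullet> x))))"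
    by (intro Bochner_Integration.integrable_sum i2n)
  have i3: "complex_integrable R (\<lambda>x. complex_of_real (a powr \<alpha>) * (?J (z \<bullet> x) - \<i> * complex_of_real (?c * ?K * (z \<bullet> x))))"
    by (intro integrable_mult_right Bochner_Integration.integrable_diff iJ conjunct1[OF iK])
  have "(CLINT x|R. ?T (z \<bullet> x)) - (CLINT x|R. ?T ((a *\<^sub>R z) \<bullet> x)) = (CLINT x|R. ?T (z \<bullet> x) - ?T ((a *\<^sub>R z) \<bullet> x))"
    by (rule Bochner_Integration.integral_diff[OF iT iT, symmetric])
  also have "\<dots> = ((CLINT x|R. complex_of_real (1 - a powr \<alpha>) * ?T (z \<bullet> x))
    + (CLINT x|R. \<Sum>n\<in>{1..<Suc k}. complex_of_real (q n) * (?Tn n ((a *\<^sub>R z) \<bullet> x) - \<i> * complex_of_real (d n * (z \<bullet> x)))))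
    + (CLINT x|R. complex_of_real (a powr \<alpha>) * (?J (z \<bullet> x) - \<i> * complex_of_real (?c * ?K * (z \<bullet> x))))"
    unfolding pt by (simp only: Bochner_Integration.integral_add[OF Bochner_Integration.integrable_add[OF i1 i2] i3] Bochner_Integration.integral_add[OF i1 i2])
  also have "(CLINT x|R. \<Sum>n\<in>{1..<Suc k}. complex_of_real (q n) * (?Tn n ((a *\<^sub>R z) \<bullet> x) - \<i> * complex_of_real (d n * (z \<bullet> x))))
     = (\<Sum>n\<in>{1..<Suc k}. CLINT x|R. complex_of_real (q n) * (?Tn n ((a *\<^sub>R z) \<bullet> x) - \<i> * complex_of_real (d n * (z \<bullet> x))))"
    by (rule Bochner_Integration.integral_sum[OF i2n])
  also have "\<dots> = (\<Sum>n\<in>{1..<Suc k}. complex_of_real (q n) * ((CLINT x|R. ?Tn n ((a *\<^sub>R z) \<bullet> x)) - \<i> * complex_of_real (d n * (z \<bullet> (\<integral>x. x \<partial>R)))))"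
  proof (intro sum.cong refl)
    fix n assume n: "n \<in> {1..<Suc k}"
    have "(CLINT x|R. ?Tn n ((a *\<^sub>R z) \<bullet> x) - \<i> * complex_of_real (d n * (z \<bullet> x))) =
      (CLINT x|R. ?Tn n ((a *\<^sub>R z) \<bullet> x)) - \<i> * complex_of_real (d n * (z \<bullet> (\<integral>x. x \<partial>R)))"
      unfolding conjunct2[OF id, symmetric] by (rule Bochner_Integration.integral_diff[OF iTn[OF n] conjunct1[OF id]])
    then show "(CLINT x|R. complex_of_real (q n) * (?Tn n ((a *\<^sub>R z) \<bullet> x) - \<i> * complex_of_real (d n * (z \<bullet> x)))) =
      complex_of_real (q n) * ((CLINT x|R. ?Tn n ((a *\<^sub>R z) \<bullet> x)) - \<i> * complex_of_real (d n * (z \<bullet> (\<integral>x. x \<partial>R))))"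
      by (rule trans[OF integral_mult_right_zero arg_cong[where f="(*) (complex_of_real (q n))"]])
  qed
  also have "(CLINT x|R. complex_of_real (1 - a powr \<alpha>) * ?T (z \<bullet> x)) = complex_of_real (1 - a powr \<alpha>) * (CLINT x|R. ?T (z \<bullet> x))"
    by (rule integral_mult_right_zero)
  also have "(CLINT x|R. complex_of_real (a powr \<alpha>) * (?J (z \<bullet> x) - \<i> * complex_of_real (?c * ?K * (z \<bullet> x)))) =
    complex_of_real (a powr \<alpha>) * ((CLINT x|R. ?J (z \<bullet> x)) - \<i> * complex_of_real (?c * ?K * (z \<bullet> (\<integral>x. x \<partial>R))))"
    unfolding conjunct2[OF iK, symmetric] Bochner_Integration.integral_diff[OF iJ conjunct1[OF iK], symmetric]
    by (rule integral_mult_right_zero)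
  finally show ?thesis by (simp only: d_def)
qed

text \<open>The jump V W is governed by R and the jump density, each divided by its total mass; the
  factor \<open>measure R UNIV * K\<close> undoes both normalisations and leaves the unnormalised
  exponent.\<close>

lemma compound_jump_exponent:
  fixes R :: "(real^'d) measure"
  assumes p: "0 < p" and \<eta>: "1 < \<eta>" and \<alpha>: "\<alpha> < p * real (Suc k)"
    and R: "finite_measure R" and s[measurable_cong]: "sets R = sets borel" and R0: "0 < measure R UNIV"
  defines "K \<equiv> IGa_K \<alpha> (real (Suc k)) p \<eta>"
  shows "complex_of_real (measure R UNIV * K) *
      ((CLINT x|scale_measure (1 / emeasure R UNIV) R. CLINT u|IGa \<alpha> (real (Suc k)) p \<eta>. iexp ((z \<bullet> x) * u)) - 1)
    = (CLINT x|R. jump_exponent \<alpha> (Suc k) p \<eta> (z \<bullet> x))"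
proof -
  interpret finite_measure R by fact
  let ?k = "IGa_kernel \<alpha> (Suc k) p \<eta>" and ?J = "jump_exponent \<alpha> (Suc k) p \<eta>"
  have K: "0 < K" unfolding K_def by (rule IGa_K_pos[OF p \<eta> \<alpha>])
  have [measurable]: "?k \<in> borel_measurable borel" using \<eta> by (rule borel_measurable_IGa_kernel)
  have Jm[measurable]: "?J \<in> borel_measurable borel" by (rule jump_exponent_bound[OF p \<eta> \<alpha>])
  have ik: "integrable lborel ?k" by (rule integrable_IGa_kernel[OF p \<eta> \<alpha>])
  have spR: "space R = UNIV" using sets_eq_imp_space_eq[OF s] by simp
  have in1: "(CLINT u|IGa \<alpha> (real (Suc k)) p \<eta>. iexp (w * u)) = ?J w / K + 1" for w
  proof -
    have i: "complex_integrable lborel (\<lambda>u. ?k u *\<^sub>R (iexp (w * u) - 1))" by (rule integrable_IGa_ID_kernel(1)[OF p \<eta> \<alpha>, of 0]) simp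
    have ik': "complex_integrable lborel (\<lambda>u. complex_of_real (?k u))" using ik by simp
    have "(CLINT u|IGa \<alpha> (real (Suc k)) p \<eta>. iexp (w * u)) = (1 / K) *\<^sub>R (CLINT u|lborel. ?k u *\<^sub>R iexp (w * u))"
      unfolding K_def by (rule integral_IGa[OF p \<eta> \<alpha>]) simp
    also have "(CLINT u|lborel. ?k u *\<^sub>R iexp (w * u)) = (CLINT u|lborel. ?k u *\<^sub>R (iexp (w * u) - 1) + complex_of_real (?k u))"
      by (intro Bochner_Integration.integral_cong refl) (simp add: scaleR_conv_of_real algebra_simps)
    also have "\<dots> = ?J w + complex_of_real K"
      unfolding Bochner_Integration.integral_add[OF i ik']
      unfolding K_def IGa_K_eq jump_exponent_def integral_complex_of_real ..
    finally show ?thesis using K by (simp add: scaleR_conv_of_real field_simps)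
  qed
  have sc: "scale_measure (1 / emeasure R UNIV) R = scale_measure (ennreal (1 / measure R UNIV)) R"
    using R0 by (simp add: emeasure_eq_measure divide_ennreal flip: ennreal_1)
  have iJ: "complex_integrable R (\<lambda>x. ?J (z \<bullet> x))"
    using jump_exponent_bound[OF p \<eta> \<alpha>] by (intro integrable_const_bound[where B="2 * K"]) (auto simp: K_def)
  have "(CLINT x|scale_measure (1 / emeasure R UNIV) R. CLINT u|IGa \<alpha> (real (Suc k)) p \<eta>. iexp ((z \<bullet> x) * u)) =
     (1 / measure R UNIV) *\<^sub>R (CLINT x|R. ?J (z \<bullet> x) / K + 1)"
    unfolding in1 sc by (rule integral_scale_measure) (use R0 in auto)
  also have "(CLINT x|R. ?J (z \<bullet> x) / K + 1) = (CLINT x|R. ?J (z \<bullet> x)) / K + complex_of_real (measure R UNIV)"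
    using iJ by (simp add: spR scaleR_conv_of_real)
  finally show ?thesis using K R0 by (simp add: scaleR_conv_of_real field_simps)
qed

text \<open>The bound \<open>real k * p \<le> \<alpha>\<close> keeps the indices \<alpha> - n p
  nonnegative for n \<le> k, so the laws of the X_n exist; the other bound makes the jump density
  normalisable.\<close>

lemma exists_TSOU_variables:
  fixes R :: "(real^'d) measure"
  assumes p: "0 < p" and \<alpha>: "0 \<le> \<alpha>" "\<alpha> < 2" and lam: "0 < lam" and t: "0 < t"
    and ad: "TS_admissible \<alpha> R" and R0: "0 < emeasure R UNIV" and Rf: "emeasure R UNIV < \<infinity>"
    and k: "real k * p \<le> \<alpha>" "\<alpha> < p * real (Suc k)"
  shows "\<exists>(Q :: (rv_index \<Rightarrow> (real^'d) \<times> real \<times> nat) measure) N X V W. TSOU_variables p \<alpha> lam t R (Suc k) Q N X V W"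
proof -
  have s[measurable_cong]: "sets R = sets borel" using ad by (simp add: TS_admissible_def)
  have spR: "space R = UNIV" using sets_eq_imp_space_eq[OF s] by simp
  have R: "finite_measure R" using Rf by (intro finite_measureI) (simp add: spR)
  interpret finite_measure R by fact
  have \<eta>: "1 < exp (p * lam * t)" using p lam t by simp
  have adn: "TS_admissible (\<alpha> - real n * p) (TSOU_R p \<alpha> lam t R n)" and fin: "finite_measure (TSOU_R p \<alpha> lam t R n)"
    and pos: "0 \<le> \<alpha> - real n * p" "\<alpha> - real n * p < 2"
    if "n < Suc k" for n
  proof -
    have "real n * p \<le> real k * p" using that p by (intro mult_right_mono) auto
    from order_trans[OF this k(1)] show "0 \<le> \<alpha> - real n * p" by simp
    moreover have np: "0 \<le> real n * p" using p by simp
    then show "\<alpha> - real n * p < 2" using \<alpha> by linarith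
    ultimately have "TS_admissible (\<alpha> - real n * p) R"
      using ad \<alpha> by (cases "n = 0") (auto intro!: TS_admissible_lower[OF R ad] simp: p)
    then show "TS_admissible (\<alpha> - real n * p) (TSOU_R p \<alpha> lam t R n)"
      unfolding TSOU_R_def by (rule TS_admissible_scale)
    show "finite_measure (TSOU_R p \<alpha> lam t R n)" unfolding TSOU_R_def by (rule finite_measure_scale[OF R])
  qed
  have "\<exists>\<mu>. is_TS \<mu> p (\<alpha> - real n * p) (TSOU_R p \<alpha> lam t R n) 0" if "n < Suc k" for n
    by (rule exists_TS[OF fin[OF that] adn[OF that] pos[OF that] p])
  then obtain \<mu> where \<mu>: "\<And>n. n < Suc k \<Longrightarrow> is_TS (\<mu> n) p (\<alpha> - real n * p) (TSOU_R p \<alpha> lam t R n) 0" by metis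
  let ?R1 = "scale_measure (1 / emeasure R UNIV) R" and ?G = "IGa \<alpha> (real (Suc k)) p (exp (p * lam * t))"
  have R1: "prob_space ?R1"
  proof
    have "1 / emeasure R UNIV * emeasure R UNIV = 1"
      using R0 Rf by (metis ennreal_divide_self ennreal_times_divide mult.commute mult.right_neutral not_gr_zero top.not_eq_extremum infinity_ennreal_def)
    then show "emeasure ?R1 (space ?R1) = 1" by (simp add: space_scale_measure spR)
  qed
  have G: "prob_space ?G" by (rule prob_space_IGa[OF p \<eta> k(2)])
  \<comment> \<open>The vector component of a coordinate is the law of X_n or of V_j; at indices
    where this component is never read, the law of V_j serves as a filler.\<close>
  define A where "A i = (case i of Ix_X n \<Rightarrow> if n < Suc k then \<mu> n else ?R1 | _ \<Rightarrow> ?R1)" for i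
  define D where "D = poisson_pmf (exp (- \<alpha> * lam * t) * measure R UNIV * IGa_K \<alpha> (real (Suc k)) p (exp (p * lam * t)))"
  have A: "prob_space (A i)" "sets (A i) = sets borel" for i
    using R1 \<mu> by (cases i; auto simp: A_def is_TS_def is_ID_def s)+
  obtain Q :: "(rv_index \<Rightarrow> (real^'d) \<times> real \<times> nat) measure" where Q: "prob_space Q"
    and QA: "\<And>i. (\<lambda>\<omega>. fst (\<omega> i)) \<in> borel_measurable Q" "\<And>i. distr Q borel (\<lambda>\<omega>. fst (\<omega> i)) = A i"
    and QB: "\<And>i. (\<lambda>\<omega>. fst (snd (\<omega> i))) \<in> borel_measurable Q" "\<And>i. distr Q borel (\<lambda>\<omega>. fst (snd (\<omega> i))) = ?G"
    and QD: "\<And>i. (\<lambda>\<omega>. snd (snd (\<omega> i))) \<in> measurable Q (count_space UNIV)"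
      "\<And>i. distr Q (count_space UNIV) (\<lambda>\<omega>. snd (snd (\<omega> i))) = measure_pmf D"
    and ind: "prob_space.indep_vars Q (\<lambda>i. A i \<Otimes>\<^sub>M (?G \<Otimes>\<^sub>M measure_pmf D)) (\<lambda>i \<omega>. \<omega> i) UNIV"
    using exists_independent_coordinates[of A "\<lambda>_. ?G" D] A G by (auto simp: IGa_def)
  interpret Q: prob_space Q by fact
  let ?N = "\<lambda>\<omega>. snd (snd (\<omega> Ix_N))" and ?X = "\<lambda>n \<omega>. fst (\<omega> (Ix_X n))" and ?V = "\<lambda>j \<omega>. fst (\<omega> (Ix_V j))"
    and ?W = "\<lambda>j \<omega>. fst (snd (\<omega> (Ix_W j)))"
  let ?S = "\<lambda>i. A i \<Otimes>\<^sub>M (?G \<Otimes>\<^sub>M measure_pmf D)"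
  \<comment> \<open>A variable that reads one component of coordinate i generates only events of
    that coordinate, so independence of the coordinates is inherited.\<close>
  have sub: "events_of Q B (\<lambda>\<omega>. f (\<omega> i)) \<subseteq> {(\<lambda>\<omega>. \<omega> i) -` E \<inter> space Q |E. E \<in> sets (?S i)}"
    if f: "f \<in> ?S i \<rightarrow>\<^sub>M B" for f and B :: "'z measure" and i
  proof -
    have co: "(\<lambda>\<omega>. \<omega> i) \<in> Q \<rightarrow>\<^sub>M ?S i" using ind by (simp add: Q.indep_vars_def2)
    have eq: "(\<lambda>\<omega>. f (\<omega> i)) -` E \<inter> space Q = (\<lambda>\<omega>. \<omega> i) -` (f -` E \<inter> space (?S i)) \<inter> space Q" for E
      using measurable_space[OF co] by auto
    show ?thesis
    proof (rule subsetI)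
      fix F assume "F \<in> events_of Q B (\<lambda>\<omega>. f (\<omega> i))"
      then obtain E where E: "E \<in> sets B" and F: "F = (\<lambda>\<omega>. f (\<omega> i)) -` E \<inter> space Q"
        unfolding events_of_def by (elim CollectE exE conjE)
      show "F \<in> {(\<lambda>\<omega>. \<omega> i) -` E \<inter> space Q |E. E \<in> sets (?S i)}"
        unfolding F eq by (intro CollectI exI[of _ "f -` E \<inter> space (?S i)"] conjI refl measurable_sets[OF f E])
    qed
  qed
  have fA: "fst \<in> ?S i \<rightarrow>\<^sub>M borel" for i
    using measurable_fst[of "A i" "?G \<Otimes>\<^sub>M measure_pmf D"] unfolding measurable_cong_sets[OF refl A(2)] .
  have fG: "(\<lambda>x. fst (snd x)) \<in> ?S i \<rightarrow>\<^sub>M borel" for i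
  proof -
    have sG: "sets ?G = sets borel" by (simp add: IGa_def)
    have "(\<lambda>x. fst (snd x)) \<in> ?S i \<rightarrow>\<^sub>M ?G"
      by (rule measurable_compose[OF measurable_snd measurable_fst])
    then show ?thesis unfolding measurable_cong_sets[OF refl sG] .
  qed
  have fD: "(\<lambda>x. snd (snd x)) \<in> ?S i \<rightarrow>\<^sub>M count_space UNIV" for i
  proof -
    have "(\<lambda>x. snd (snd x)) \<in> ?S i \<rightarrow>\<^sub>M measure_pmf D"
      by (rule measurable_compose[OF measurable_snd measurable_snd])
    then show ?thesis unfolding measurable_cong_sets[OF refl sets_measure_pmf_count_space] .
  qed
  have ind': "Q.indep_sets (\<lambda>i. case i of
              Ix_N \<Rightarrow> events_of Q (count_space UNIV) ?N
            | Ix_X n \<Rightarrow> events_of Q borel (?X n)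
            | Ix_V j \<Rightarrow> events_of Q borel (?V j)
            | Ix_W j \<Rightarrow> events_of Q borel (?W j))
       ({Ix_N} \<union> Ix_X ` {..<Suc k} \<union> Ix_V ` {1..} \<union> Ix_W ` {1..})"
  proof (rule Q.indep_sets_mono[OF conjunct2[OF ind[unfolded Q.indep_vars_def2]]])
    show "(case i of
              Ix_N \<Rightarrow> events_of Q (count_space UNIV) ?N
            | Ix_X n \<Rightarrow> events_of Q borel (?X n)
            | Ix_V j \<Rightarrow> events_of Q borel (?V j)
            | Ix_W j \<Rightarrow> events_of Q borel (?W j)) \<subseteq> {(\<lambda>\<omega>. \<omega> i) -` E \<inter> space Q |E. E \<in> sets (?S i)}" for i
    proof (cases i)
      case Ix_N then show ?thesis using sub[OF fD, of i] by (simp only: rv_index.case)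
    next
      case (Ix_X n) then show ?thesis using sub[OF fA, of i] by (simp only: rv_index.case)
    next
      case (Ix_V n) then show ?thesis using sub[OF fA, of i] by (simp only: rv_index.case)
    next
      case (Ix_W n) then show ?thesis using sub[OF fG, of i] by (simp only: rv_index.case)
    qed
  qed simp
  have "TSOU_variables p \<alpha> lam t R (Suc k) Q ?N ?X ?V ?W"
    unfolding TSOU_variables_def
  proof (intro conjI)
    show "is_TS (distr Q borel (?X 0)) p \<alpha> (TSOU_R p \<alpha> lam t R 0) 0" using \<mu>[of 0] by (simp add: QA A_def)
    show "\<forall>n\<in>{1..<Suc k}. is_TS (distr Q borel (?X n)) p (\<alpha> - real n * p) (TSOU_R p \<alpha> lam t R n) 0"
      using \<mu> by (simp add: QA A_def)
    show "\<forall>j\<ge>1. distr Q borel (?V j) = ?R1" by (simp add: QA A_def)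
    show "\<forall>j\<ge>1. distr Q borel (?W j) = ?G" using QB by blast
    show "distr Q (count_space UNIV) ?N = measure_pmf (poisson_pmf (exp (- \<alpha> * lam * t) * measure R UNIV * IGa_K \<alpha> (real (Suc k)) p (exp (p * lam * t))))"
      unfolding QD D_def ..
  qed (use Q QA QB QD ind' in auto)
  then show ?thesis by blast
qed

text \<open>The representation is evaluated at y = 0, since the term a y is a mere translation. Its
  characteristic function is assembled from the constant drift, the X_n and the compound sum, and
  compared with the decomposition of the exponent of \<mu>.\<close>

lemma TSOU_transition_char:
  fixes X V :: "nat \<Rightarrow> 'q \<Rightarrow> real^'d" and R :: "(real^'d) measure"
  assumes p: "0 < p" and \<alpha>: "0 \<le> \<alpha>" "\<alpha> < 2" and lam: "0 < lam" and t: "0 < t"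
    and ad: "TS_admissible \<alpha> R" and R0: "0 < emeasure R UNIV" and Rf: "emeasure R UNIV < \<infinity>"
    and k: "real k * p \<le> \<alpha>" "\<alpha> < p * real (Suc k)"
    and T: "TSOU_variables p \<alpha> lam t R (Suc k) Q N X V W" and TS: "is_TS \<mu> p \<alpha> R b"
  defines "a \<equiv> exp (- lam * t)"
  shows "(\<lambda>\<omega>. TSOU_transition p \<alpha> lam t R b (Suc k) N X V W 0 \<omega>) \<in> borel_measurable Q"
    and "char_vec \<mu> z = (CLINT \<omega>|Q. iexp (z \<bullet> TSOU_transition p \<alpha> lam t R b (Suc k) N X V W 0 \<omega>)) * char_vec \<mu> (a *\<^sub>R z)"
proof -
  let ?U = "TSOU_transition p \<alpha> lam t R b (Suc k) N X V W 0"
  have s[measurable_cong]: "sets R = sets borel" using ad by (simp add: TS_admissible_def)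
  have spR: "space R = UNIV" using sets_eq_imp_space_eq[OF s] by simp
  have R: "finite_measure R" using Rf by (intro finite_measureI) (simp add: spR)
  interpret finite_measure R by fact
  have R0': "0 < measure R UNIV" using R0 by (simp add: emeasure_eq_measure)
  have Q: "prob_space Q" and N[measurable]: "N \<in> measurable Q (count_space UNIV)"
    and X: "\<And>n. n < Suc k \<Longrightarrow> X n \<in> borel_measurable Q"
    and V: "\<And>j. 1 \<le> j \<Longrightarrow> V j \<in> borel_measurable Q" and W: "\<And>j. 1 \<le> j \<Longrightarrow> W j \<in> borel_measurable Q"
    and TS0: "is_TS (distr Q borel (X 0)) p \<alpha> (TSOU_R p \<alpha> lam t R 0) 0"
    and TSn: "\<And>n. n \<in> {1..<Suc k} \<Longrightarrow> is_TS (distr Q borel (X n)) p (\<alpha> - real n * p) (TSOU_R p \<alpha> lam t R n) 0"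
    using T by (auto simp: TSOU_variables_def)
  interpret Q: prob_space Q by fact
  have a: "0 < a" "a < 1" using lam t by (simp_all add: a_def)
  define \<eta> where "\<eta> = a powr (- p)"
  have \<eta>e: "exp (p * lam * t) = \<eta>" and aa: "exp (- \<alpha> * lam * t) = a powr \<alpha>" and ap: "exp (- p * lam * t) = a powr p"
    by (simp_all add: \<eta>_def a_def exp_powr_real mult_ac)
  have \<eta>: "1 < \<eta>" using p lam t by (simp flip: \<eta>e)
  define q where "q n = (1 - a powr p) ^ n / fact n" for n :: nat
  have ap1: "a powr p < 1" using a p powr_less_mono2[of p a 1] by simp
  have aal: "a powr \<alpha> \<le> 1" using a \<alpha> powr_mono2[of \<alpha> a 1] by simp
  have q0: "0 \<le> q n" for n using ap1 by (simp add: q_def)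
  have R_0: "TSOU_R p \<alpha> lam t R 0 = scale_measure (ennreal (1 - a powr \<alpha>)) R"
    unfolding TSOU_R_def aa by simp
  have R_n: "TSOU_R p \<alpha> lam t R n = scale_measure (ennreal (q n)) R" if "n \<noteq> 0" for n
    unfolding TSOU_R_def ap q_def using that by simp
  let ?K = "IGa_K (\<alpha> - 1) (real (Suc k)) p \<eta>" and ?I = "\<integral>x. x \<partial>R"
  let ?B = "TSOU_b p \<alpha> lam t R (Suc k)"
  define v where "v = (1 - a) *\<^sub>R b - (\<Sum>n<Suc k. ?B n)"
  have U: "?U \<omega> = v + X 0 \<omega> + a *\<^sub>R (\<Sum>n\<in>{1..<Suc k}. X n \<omega>) + (\<Sum>j\<in>{1..N \<omega>}. W j \<omega> *\<^sub>R V j \<omega>)" for \<omega>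
    by (simp only: TSOU_transition_def v_def a_def scaleR_zero_right add_0)
  have Sm: "(\<lambda>\<omega>. \<Sum>j\<in>{1..N \<omega>}. W j \<omega> *\<^sub>R V j \<omega>) \<in> borel_measurable Q"
    by (rule measurable_compose_countable[OF _ N]) (auto intro!: borel_measurable_sum borel_measurable_scaleR V W)
  show "(\<lambda>\<omega>. ?U \<omega>) \<in> borel_measurable Q"
    unfolding U using X Sm by (intro borel_measurable_add borel_measurable_const borel_measurable_scaleR borel_measurable_sum) auto
  \<comment> \<open>X_0 enters with factor 1 and every other X_n with factor \<open>a\<close>, which
    is moved to the frequency.\<close>
  define y where "y n = (if n = 0 then z else a *\<^sub>R z)" for n :: nat
  have zU: "iexp (z \<bullet> ?U \<omega>) = iexp (z \<bullet> v) * ((\<Prod>n<Suc k. iexp (y n \<bullet> X n \<omega>)) * iexp (z \<bullet> (\<Sum>j\<in>{1..N \<omega>}. W j \<omega> *\<^sub>R V j \<omega>)))" for \<omega>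
  proof -
    have "(\<Prod>n<Suc k. iexp (y n \<bullet> X n \<omega>)) = iexp (z \<bullet> X 0 \<omega>) * (\<Prod>n\<in>{1..<Suc k}. iexp ((a *\<^sub>R z) \<bullet> X n \<omega>))"
      unfolding lessThan_atLeast0 by (subst prod.atLeast_Suc_lessThan) (auto simp: y_def)
    also have "(\<Prod>n\<in>{1..<Suc k}. iexp ((a *\<^sub>R z) \<bullet> X n \<omega>)) = iexp (z \<bullet> (a *\<^sub>R (\<Sum>n\<in>{1..<Suc k}. X n \<omega>)))"
      by (simp add: inner_sum_right sum_distrib_left exp_sum del: sum.op_ivl_Suc prod.op_ivl_Suc)
    finally show ?thesis unfolding U
      by (simp only: inner_add_right of_real_add distrib_left exp_add mult.assoc)
  qed
  define m where "m = exp (- \<alpha> * lam * t) * measure R UNIV * IGa_K \<alpha> (real (Suc k)) p (exp (p * lam * t))"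
  have m: "0 < m" using IGa_K_pos[OF p \<eta> k(2)] R0' by (simp add: m_def \<eta>e)
  let ?T = "\<lambda>w. TS_exponent p \<alpha> (TS_drift \<alpha>) w" and ?Tn = "\<lambda>n w. TS_exponent p (\<alpha> - real n * p) (TS_drift (\<alpha> - real n * p)) w"
  have TSm: "complex_integrable R (\<lambda>x. ?T (z \<bullet> x))" by (rule is_TS_char(1)[OF TS R])
  have X0: "char_vec (distr Q borel (X 0)) (y 0) = exp (complex_of_real (1 - a powr \<alpha>) * (CLINT x|R. ?T (z \<bullet> x)))"
  proof -
    have "char_vec (distr Q borel (X 0)) z = exp (CLINT x|scale_measure (ennreal (1 - a powr \<alpha>)) R. ?T (z \<bullet> x))"
      using is_TS_char(2)[OF TS0, of z] finite_measure_scale[OF R] by (simp add: R_0)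
    then show ?thesis using aal TSm by (simp add: y_def integral_scale_measure scaleR_conv_of_real)
  qed
  have Xn: "char_vec (distr Q borel (X n)) (y n) = exp (complex_of_real (q n) * (CLINT x|R. ?Tn n ((a *\<^sub>R z) \<bullet> x)))"
    if n: "n \<in> {1..<Suc k}" for n
  proof -
    have n0: "n \<noteq> 0" using n by simp
    have "real n * p \<le> real k * p" using n p by (intro mult_right_mono) auto
    from order_trans[OF this k(1)] have nn: "0 \<le> \<alpha> - real n * p" "\<alpha> - real n * p < \<alpha>" using p n by auto
    have i: "complex_integrable R (\<lambda>x. ?Tn n ((a *\<^sub>R z) \<bullet> x))"
      using nn \<alpha> by (intro integrable_TS_exponent_measure[OF R TS_admissible_lower[OF R ad]] p) auto
    have "char_vec (distr Q borel (X n)) (a *\<^sub>R z) = exp (CLINT x|scale_measure (ennreal (q n)) R. ?Tn n ((a *\<^sub>R z) \<bullet> x))"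
      using is_TS_char(2)[OF TSn[OF n], of "a *\<^sub>R z"] finite_measure_scale[OF R] unfolding R_n[OF n0] by simp
    also have "(CLINT x|scale_measure (ennreal (q n)) R. ?Tn n ((a *\<^sub>R z) \<bullet> x)) = complex_of_real (q n) * (CLINT x|R. ?Tn n ((a *\<^sub>R z) \<bullet> x))"
      using integral_scale_measure[OF borel_measurable_integrable[OF i] q0] by (simp only: scaleR_conv_of_real)
    finally show ?thesis using n0 by (simp only: y_def if_False)
  qed
  let ?J = "CLINT x|R. jump_exponent \<alpha> (Suc k) p \<eta> (z \<bullet> x)"
  let ?E = "complex_of_real (1 - a powr \<alpha>) * (CLINT x|R. ?T (z \<bullet> x)) + (\<Sum>n\<in>{1..<Suc k}. complex_of_real (q n) * (CLINT x|R. ?Tn n ((a *\<^sub>R z) \<bullet> x)))"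
  have prodX: "(\<Prod>n<Suc k. char_vec (distr Q borel (X n)) (y n)) = exp ?E"
  proof -
    have "(\<Prod>n<Suc k. char_vec (distr Q borel (X n)) (y n)) = char_vec (distr Q borel (X 0)) (y 0) * (\<Prod>n\<in>{1..<Suc k}. char_vec (distr Q borel (X n)) (y n))"
      unfolding lessThan_atLeast0 by (subst prod.atLeast_Suc_lessThan) auto
    also have "(\<Prod>n\<in>{1..<Suc k}. char_vec (distr Q borel (X n)) (y n)) = (\<Prod>n\<in>{1..<Suc k}. exp (complex_of_real (q n) * (CLINT x|R. ?Tn n ((a *\<^sub>R z) \<bullet> x))))"
      by (intro prod.cong refl Xn)
    finally show ?thesis by (simp only: X0 exp_add exp_sum finite_atLeastLessThan)
  qed
  have mJ: "complex_of_real m * ((CLINT x|scale_measure (1 / emeasure R UNIV) R. CLINT u|IGa \<alpha> (real (Suc k)) p (exp (p * lam * t)). iexp ((z \<bullet> x) * u)) - 1)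
      = complex_of_real (a powr \<alpha>) * ?J"
    unfolding m_def \<eta>e aa compound_jump_exponent[OF p \<eta> k(2) R s R0', symmetric] by (simp only: of_real_mult mult.assoc)
  have "(CLINT \<omega>|Q. iexp (z \<bullet> ?U \<omega>)) = iexp (z \<bullet> v) * (exp ?E * exp (complex_of_real (a powr \<alpha>) * ?J))"
    unfolding zU integral_mult_right_zero TSOU_variables_char[OF T m_def m] prodX mJ ..
  also have "\<dots> = exp (\<i> * (z \<bullet> v) + (?E + complex_of_real (a powr \<alpha>) * ?J))" by (simp only: exp_add)
  finally have cU: "(CLINT \<omega>|Q. iexp (z \<bullet> ?U \<omega>)) = exp (\<i> * (z \<bullet> v) + (?E + complex_of_real (a powr \<alpha>) * ?J))" .
  \<comment> \<open>b_0 removes the compensator of the jump part, which is present only for \<alpha>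
    \<ge> 1.\<close>
  have b0: "z \<bullet> ?B 0 = a powr \<alpha> * (TS_drift \<alpha> * ?K * (z \<bullet> ?I))"
    unfolding TSOU_b_def aa \<eta>e by (simp add: TS_drift_def)
  have bn: "z \<bullet> ?B n = q n * (a * TS_shift p \<alpha> n * (z \<bullet> ?I))" if n: "n \<in> {1..<Suc k}" for n
  proof (cases "1 \<le> \<alpha> \<and> \<alpha> < 1 + real n * p")
    case True
    have n0: "n \<noteq> 0" using n by simp
    have "integrable R (\<lambda>x. x)" using True \<alpha> by (intro integrable_identity_of_moment[OF R ad]) auto
    then have "(\<integral>x. x \<partial>TSOU_R p \<alpha> lam t R n) = q n *\<^sub>R ?I"
      unfolding R_n[OF n0] using q0 by (intro integral_scale_measure) auto
    then show ?thesis using True n0 by (simp add: TSOU_b_def TS_shift_def a_def)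
  next
    case False
    then show ?thesis using n by (auto simp: TSOU_b_def TS_shift_def)
  qed
  have zv: "z \<bullet> v = (1 - a) * (b \<bullet> z) - a powr \<alpha> * (TS_drift \<alpha> * ?K * (z \<bullet> ?I)) - (\<Sum>n\<in>{1..<Suc k}. q n * (a * TS_shift p \<alpha> n * (z \<bullet> ?I)))"
  proof -
    have "(\<Sum>n<Suc k. ?B n) = ?B 0 + (\<Sum>n\<in>{1..<Suc k}. ?B n)"
      unfolding lessThan_atLeast0 by (subst sum.atLeast_Suc_lessThan) auto
    moreover have "(\<Sum>n\<in>{1..<Suc k}. z \<bullet> ?B n) = (\<Sum>n\<in>{1..<Suc k}. q n * (a * TS_shift p \<alpha> n * (z \<bullet> ?I)))"
      by (intro sum.cong refl bn)
    ultimately show ?thesis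
      unfolding v_def by (simp only: inner_diff_right inner_add_right inner_sum_right b0 inner_scaleR_right inner_commute[of z b])
  qed
  \<comment> \<open>The exponent of \<mu> at z equals that of the representation plus that of \<mu>
    at a z. The b_n inside \<open>v\<close> cancel the drift terms of
    \<open>TS_transition_exponent\<close>, and (1 - a) b is the difference of the two drifts
    b.\<close>
  have "\<i> * complex_of_real (b \<bullet> z) + (CLINT x|R. ?T (z \<bullet> x)) =
    (\<i> * (z \<bullet> v) + (?E + complex_of_real (a powr \<alpha>) * ?J)) + (\<i> * complex_of_real (b \<bullet> (a *\<^sub>R z)) + (CLINT x|R. ?T ((a *\<^sub>R z) \<bullet> x)))"
  proof -
    define D where "D = complex_of_real (z \<bullet> ?I)"
    have sp: "(\<Sum>n\<in>{1..<Suc k}. complex_of_real (q n) * ((CLINT x|R. ?Tn n ((a *\<^sub>R z) \<bullet> x)) - \<i> * complex_of_real (a * TS_shift p \<alpha> n * (z \<bullet> ?I))))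
      = (\<Sum>n\<in>{1..<Suc k}. complex_of_real (q n) * (CLINT x|R. ?Tn n ((a *\<^sub>R z) \<bullet> x)))
        - \<i> * complex_of_real (\<Sum>n\<in>{1..<Suc k}. q n * (a * TS_shift p \<alpha> n * (z \<bullet> ?I)))"
      by (simp add: right_diff_distrib sum_subtractf sum_distrib_left mult.left_commute del: sum.op_ivl_Suc)
    have main: "(CLINT x|R. ?T (z \<bullet> x)) = (CLINT x|R. ?T ((a *\<^sub>R z) \<bullet> x)) +
     ((complex_of_real (1 - a powr \<alpha>) * (CLINT x|R. ?T (z \<bullet> x))
      + ((\<Sum>n\<in>{1..<Suc k}. complex_of_real (q n) * (CLINT x|R. ?Tn n ((a *\<^sub>R z) \<bullet> x)))
        - \<i> * complex_of_real (\<Sum>n\<in>{1..<Suc k}. q n * (a * TS_shift p \<alpha> n * (z \<bullet> ?I)))))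
      + complex_of_real (a powr \<alpha>) * (?J - \<i> * complex_of_real (TS_drift \<alpha> * ?K * (z \<bullet> ?I))))"
      using TS_transition_exponent[OF p a \<alpha> R ad k, of z, folded \<eta>_def q_def, unfolded sp]
      by (simp only: diff_eq_eq add.commute)
    have zvc: "complex_of_real (z \<bullet> v) = complex_of_real (b \<bullet> z) - complex_of_real (b \<bullet> (a *\<^sub>R z))
       - complex_of_real (a powr \<alpha>) * complex_of_real (TS_drift \<alpha> * ?K * (z \<bullet> ?I)) - complex_of_real (\<Sum>n\<in>{1..<Suc k}. q n * (a * TS_shift p \<alpha> n * (z \<bullet> ?I)))"
      unfolding zv by (simp add: left_diff_distrib)
    show ?thesis
      by (subst main, unfold zvc) (simp only: algebra_simps)
  qed
  then show "char_vec \<mu> z = (CLINT \<omega>|Q. iexp (z \<bullet> ?U \<omega>)) * char_vec \<mu> (a *\<^sub>R z)"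
    unfolding cU is_TS_char(2)[OF TS R] by (simp only: exp_add[symmetric])
qed

text \<open>The existence claim shows that the conditions imposed on the variables can be met; the
  second claim covers every realisation of them, on a space of any type.\<close>

theorem theorem1:
  fixes M :: "'w measure" and Y :: "real \<Rightarrow> 'w \<Rightarrow> real^'d"
    and R :: "(real^'d) measure" and b :: "real^'d"
    and p \<alpha> lam s t :: real and g :: nat
  assumes "0 < p" and "0 \<le> \<alpha>" and "\<alpha> < 2" and "0 < lam"
    and "TS_admissible \<alpha> R"
    and "0 < emeasure R UNIV" and "emeasure R UNIV < \<infinity>"
    and "g = 1 + nat \<lfloor>\<alpha> / p\<rfloor>"
    and "TSOU_process M lam p \<alpha> R b Y"
    and "0 \<le> s" and "0 < t"
  shows "(\<exists>(Q :: (rv_index \<Rightarrow> (real^'d) \<times> real \<times> nat) measure) N X V W.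
            TSOU_variables p \<alpha> lam t R g Q N X V W) \<and>
         (\<forall>(Q :: 'q measure) N X V W. TSOU_variables p \<alpha> lam t R g Q N X V W \<longrightarrow>
            conditional_distribution M (Y (s + t)) (Y s)
              (\<lambda>y. distr Q borel (TSOU_transition p \<alpha> lam t R b g N X V W y)))"
proof -
  \<comment> \<open>The shape is g = \<open>Suc k\<close>, so k is both the Erlang parameter and the
    largest index n of an X_n.\<close>
  define k where "k = nat \<lfloor>\<alpha> / p\<rfloor>"
  have g: "g = Suc k" using assms(8) by (simp add: k_def)
  have fl: "real k = real_of_int \<lfloor>\<alpha> / p\<rfloor>" using assms(1,2) by (simp add: k_def)
  have "real k \<le> \<alpha> / p" unfolding fl by (rule of_int_floor_le)
  then have k1: "real k * p \<le> \<alpha>" using assms(1) by (simp add: field_simps)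
  have "\<alpha> / p < real k + 1" unfolding fl by linarith
  then have k2: "\<alpha> < p * real (Suc k)" using assms(1) by (simp add: field_simps)
  obtain Z \<mu> where OU: "OU_process M lam Z Y" and TS: "is_TS \<mu> p \<alpha> R b" and lim: "limiting_distribution M Y \<mu>"
    using assms(9) by (auto simp: TSOU_process_def)
  have M: "prob_space M" and Y: "\<And>t. 0 \<le> t \<Longrightarrow> Y t \<in> borel_measurable M"
    using OU by (auto simp: OU_process_def levy_process_def)
  let ?a = "exp (- lam * t)"
  have "conditional_distribution M (Y (s + t)) (Y s) (\<lambda>y. distr Q borel (TSOU_transition p \<alpha> lam t R b g N X V W y))"
    if T: "TSOU_variables p \<alpha> lam t R g Q N X V W" for Q :: "'q measure" and N X V W
  proof -
    note tc = TSOU_transition_char[OF assms(1-4,11,5-7) k1 k2 T[unfolded g] TS]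
    let ?U = "TSOU_transition p \<alpha> lam t R b (Suc k) N X V W 0"
    have Q: "prob_space Q" using T by (simp add: TSOU_variables_def)
    have "(CLINT \<omega>|M. iexp (w \<bullet> Y s \<omega> + z \<bullet> (Y (s + t) \<omega> - ?a *\<^sub>R Y s \<omega>))) = (CLINT \<omega>|M. iexp (w \<bullet> Y s \<omega>)) * (CLINT \<omega>|Q. iexp (z \<bullet> ?U \<omega>))" for w z
    proof -
      \<comment> \<open>As the characteristic function of an infinitely divisible law it is an
        exponential, which permits dividing the two product formulas.\<close>
      have "char_vec \<mu> (?a *\<^sub>R z) \<noteq> 0"
        using TS by (simp add: is_TS_def is_ID_def)
      then show ?thesis
        using OU_transition_char[OF OU lim assms(10,11), of w z] tc(2)[of z] by simp
    qed
    then have "conditional_distribution M (Y (s + t)) (Y s) (\<lambda>y. distr Q borel (\<lambda>\<omega>. ?a *\<^sub>R y + ?U \<omega>))"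
      using assms(10,11) by (intro conditional_distribution_affine M Q Y tc(1)) auto
    moreover have "?a *\<^sub>R y + ?U \<omega> = TSOU_transition p \<alpha> lam t R b g N X V W y \<omega>" for y \<omega>
      by (simp add: TSOU_transition_def g algebra_simps)
    ultimately show ?thesis by simp
  qed
  moreover have "\<exists>(Q :: (rv_index \<Rightarrow> (real^'d) \<times> real \<times> nat) measure) N X V W. TSOU_variables p \<alpha> lam t R g Q N X V W"
    unfolding g by (rule exists_TSOU_variables[OF assms(1-4,11,5-7) k1 k2])
  ultimately show ?thesis by blast
qed

end
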